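(* Let $\lambda$ be an infinite regular cardinal and let $\mathcal{C}$ be a locally $\lambda$-presentable additive category. A full subcategory $\mathcal{D}\subseteq\mathcal{C}$ is $\lambda$-definable if and only if there is a full subcategory $\mathcal{F}\subseteq\mathrm{fun}_\lambda(\mathcal{C})$ such that $$\mathcal{D}=\{C\in\mathcal{C}\ :\ \forall F\in\mathcal{F},\ FC=0\}.$$
   Context: $\mathrm{fun}_\lambda(\mathcal{C})$ denotes the category of functors $\mathcal{C}\to\mathrm{Ab}$ that preserve $\lambda$-directed colimits and products. A morphism $f:A\to B$ in $\mathcal{C}$ is *$\lambda$-pure* if for every morphism $g:C\to D$ between $\lambda$-presented objects of $\mathcal{C}$ and every morphism $u:C\to A$, if $fu$ factors through $g$ then $u$ factors through $g$. A full subcategory $\mathcal{D}\subseteq\mathcal{C}$ is *closed under $\lambda$-pure subobjects* if for every $\lambda$-pure $f:A\to B$ in $\mathcal{C}$ with $B\in\mathcal{D}$ one has $A\in\mathcal{D}$. A *$\lambda$-definable subcategory* of $\mathcal{C}$ is a full subcategory closed under products, $\lambda$-directed colimits and $\lambda$-pure subobjects. *)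

theory Defs
  imports "HOL-Algebra.Elementary_Groups"
begin

unbundle cardinal_syntax

section \<open>Size\<close>

text \<open>
  Sizes are measured by a type \<open>'u\<close> that plays the role of a Grothendieck universe: \<open>|UNIV :: 'u set|\<close>
  is an uncountable strongly inaccessible cardinal, and a set of any type is small if its
  cardinality is below it. Up to bijection the small sets are the small subsets of \<open>'u\<close>, so small
  index sets, small diagram shapes and small abelian groups can all be taken to live on \<open>'u\<close>.
  Collections that are not small (such as the objects of a category) are arbitrary sets.
\<close>

definition universe :: "'u itself \<Rightarrow> bool" where
  "universe (U :: 'u itself) \<longleftrightarrow>
     natLeq <o |UNIV :: 'u set| \<and>
     regularCard |UNIV :: 'u set| \<and>
     (\<forall>A :: 'u set. |A| <o |UNIV :: 'u set| \<longrightarrow> |Pow A| <o |UNIV :: 'u set| )"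

definition small :: "'u itself \<Rightarrow> 'a set \<Rightarrow> bool" where
  "small (U :: 'u itself) A \<longleftrightarrow> |A| <o |UNIV :: 'u set|"

definition infinite_regular_cardinal :: "'l rel \<Rightarrow> bool" where
  "infinite_regular_cardinal lam \<longleftrightarrow> Card_order lam \<and> cinfinite lam \<and> regularCard lam"


section \<open>Categories and functors\<close>

record ('o, 'm) cat =
  obj :: "'o set"
  arr :: "'m set"
  src :: "'m \<Rightarrow> 'o"
  tgt :: "'m \<Rightarrow> 'o"
  ident :: "'o \<Rightarrow> 'm"
  cmp :: "'m \<Rightarrow> 'm \<Rightarrow> 'm"  \<comment> \<open>\<open>cmp C g f\<close> is \<open>g\<close> after \<open>f\<close>\<close>

definition Hom :: "('o, 'm) cat \<Rightarrow> 'o \<Rightarrow> 'o \<Rightarrow> 'm set" where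
  "Hom C A B = {f \<in> arr C. src C f = A \<and> tgt C f = B}"

definition category :: "('o, 'm) cat \<Rightarrow> bool" where
  "category C \<longleftrightarrow>
     (\<forall>f \<in> arr C. src C f \<in> obj C \<and> tgt C f \<in> obj C) \<and>
     (\<forall>A \<in> obj C. ident C A \<in> Hom C A A) \<and>
     (\<forall>A B D f g. f \<in> Hom C A B \<longrightarrow> g \<in> Hom C B D \<longrightarrow> cmp C g f \<in> Hom C A D) \<and>
     (\<forall>A B. \<forall>f \<in> Hom C A B. cmp C f (ident C A) = f \<and> cmp C (ident C B) f = f) \<and>
     (\<forall>A B D E. \<forall>f \<in> Hom C A B. \<forall>g \<in> Hom C B D. \<forall>h \<in> Hom C D E.
        cmp C h (cmp C g f) = cmp C (cmp C h g) f)"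

definition locally_small :: "'u itself \<Rightarrow> ('o, 'm) cat \<Rightarrow> bool" where
  "locally_small U C \<longleftrightarrow> (\<forall>A \<in> obj C. \<forall>B \<in> obj C. small U (Hom C A B))"

record ('o, 'm, 'p, 'n) func =
  fob :: "'o \<Rightarrow> 'p"
  far :: "'m \<Rightarrow> 'n"

text \<open>Extensionality makes functors that agree on all objects and arrows equal.\<close>

definition is_functor ::
    "('o, 'm) cat \<Rightarrow> ('p, 'n) cat \<Rightarrow> ('o, 'm, 'p, 'n) func \<Rightarrow> bool" where
  "is_functor C E F \<longleftrightarrow>
     fob F \<in> obj C \<rightarrow>\<^sub>E obj E \<and> far F \<in> arr C \<rightarrow>\<^sub>E arr E \<and>
     (\<forall>A B. \<forall>f \<in> Hom C A B. far F f \<in> Hom E (fob F A) (fob F B)) \<and>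
     (\<forall>A \<in> obj C. far F (ident C A) = ident E (fob F A)) \<and>
     (\<forall>A B D. \<forall>f \<in> Hom C A B. \<forall>g \<in> Hom C B D.
        far F (cmp C g f) = cmp E (far F g) (far F f))"

definition comp_functor :: "('j, 'k) cat \<Rightarrow> ('o, 'm, 'p, 'n) func \<Rightarrow> ('j, 'k, 'o, 'm) func
    \<Rightarrow> ('j, 'k, 'p, 'n) func" where
  "comp_functor J F D =
     \<lparr>fob = (\<lambda>j \<in> obj J. fob F (fob D j)), far = (\<lambda>a \<in> arr J. far F (far D a))\<rparr>"

definition poset_cat :: "'i set \<Rightarrow> 'i rel \<Rightarrow> ('i, 'i \<times> 'i) cat" where
  "poset_cat I r = \<lparr>obj = I, arr = r, src = fst, tgt = snd, ident = (\<lambda>i. (i, i)),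
     cmp = (\<lambda>b a. (fst a, snd b))\<rparr>"


section \<open>Colimits, products, and their preservation\<close>

definition is_cocone :: "('j, 'k) cat \<Rightarrow> ('o, 'm) cat \<Rightarrow> ('j, 'k, 'o, 'm) func
    \<Rightarrow> 'o \<Rightarrow> ('j \<Rightarrow> 'm) \<Rightarrow> bool" where
  "is_cocone J C D L \<iota> \<longleftrightarrow>
     L \<in> obj C \<and>
     (\<forall>j \<in> obj J. \<iota> j \<in> Hom C (fob D j) L) \<and>
     (\<forall>a \<in> arr J. cmp C (\<iota> (tgt J a)) (far D a) = \<iota> (src J a))"

definition is_colimit :: "('j, 'k) cat \<Rightarrow> ('o, 'm) cat \<Rightarrow> ('j, 'k, 'o, 'm) func
    \<Rightarrow> 'o \<Rightarrow> ('j \<Rightarrow> 'm) \<Rightarrow> bool" where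
  "is_colimit J C D L \<iota> \<longleftrightarrow>
     is_cocone J C D L \<iota> \<and>
     (\<forall>M \<kappa>. is_cocone J C D M \<kappa> \<longrightarrow>
        (\<exists>!h. h \<in> Hom C L M \<and> (\<forall>j \<in> obj J. cmp C h (\<iota> j) = \<kappa> j)))"

definition is_product ::
    "('o, 'm) cat \<Rightarrow> 'i set \<Rightarrow> ('i \<Rightarrow> 'o) \<Rightarrow> 'o \<Rightarrow> ('i \<Rightarrow> 'm) \<Rightarrow> bool" where
  "is_product C I X P \<pi> \<longleftrightarrow>
     P \<in> obj C \<and>
     (\<forall>i \<in> I. \<pi> i \<in> Hom C P (X i)) \<and>
     (\<forall>T \<in> obj C. \<forall>t. (\<forall>i \<in> I. t i \<in> Hom C T (X i)) \<longrightarrow>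
        (\<exists>!h. h \<in> Hom C T P \<and> (\<forall>i \<in> I. cmp C (\<pi> i) h = t i)))"

definition cocomplete :: "'u itself \<Rightarrow> ('o, 'm) cat \<Rightarrow> bool" where
  "cocomplete U C \<longleftrightarrow>
     (\<forall>(J :: ('u, 'u) cat) D.
        category J \<longrightarrow> small U (obj J) \<longrightarrow> small U (arr J) \<longrightarrow> is_functor J C D \<longrightarrow>
        (\<exists>L \<iota>. is_colimit J C D L \<iota>))"

text \<open>Taking \<open>S = {}\<close> shows that directed posets are nonempty.\<close>

definition directed_poset :: "'l rel \<Rightarrow> 'i set \<Rightarrow> 'i rel \<Rightarrow> bool" where
  "directed_poset lam I r \<longleftrightarrow>
     partial_order_on I r \<and>
     (\<forall>S \<subseteq> I. |S| <o lam \<longrightarrow> (\<exists>u \<in> I. \<forall>s \<in> S. (s, u) \<in> r))"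

definition is_directed_colimit :: "'u itself \<Rightarrow> 'l rel \<Rightarrow> ('o, 'm) cat \<Rightarrow> 'u set \<Rightarrow> 'u rel
    \<Rightarrow> ('u, 'u \<times> 'u, 'o, 'm) func \<Rightarrow> 'o \<Rightarrow> ('u \<Rightarrow> 'm) \<Rightarrow> bool" where
  "is_directed_colimit U lam C I r D L \<iota> \<longleftrightarrow>
     small U I \<and> directed_poset lam I r \<and> is_functor (poset_cat I r) C D \<and>
     is_colimit (poset_cat I r) C D L \<iota>"

definition preserves_directed_colimits :: "'u itself \<Rightarrow> 'l rel \<Rightarrow> ('o, 'm) cat \<Rightarrow> ('p, 'n) cat
    \<Rightarrow> ('o, 'm, 'p, 'n) func \<Rightarrow> bool" where
  "preserves_directed_colimits U lam C E F \<longleftrightarrow>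
     (\<forall>(I :: 'u set) r D L \<iota>. is_directed_colimit U lam C I r D L \<iota> \<longrightarrow>
        is_colimit (poset_cat I r) E (comp_functor (poset_cat I r) F D)
          (fob F L) (\<lambda>i. far F (\<iota> i)))"

definition preserves_products :: "'u itself \<Rightarrow> ('o, 'm) cat \<Rightarrow> ('p, 'n) cat
    \<Rightarrow> ('o, 'm, 'p, 'n) func \<Rightarrow> bool" where
  "preserves_products U C E F \<longleftrightarrow>
     (\<forall>(I :: 'u set) X P \<pi>. small U I \<longrightarrow> X ` I \<subseteq> obj C \<longrightarrow> is_product C I X P \<pi> \<longrightarrow>
        is_product E I (\<lambda>i. fob F (X i)) (fob F P) (\<lambda>i. far F (\<pi> i)))"


section \<open>The categories of small sets and of small abelian groups\<close>

text \<open>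
  Arrows are triples (domain, function, codomain). The elements of the sets are drawn from an
  arbitrary type, so that the category can receive the hom-functors of any locally small category; directed colimits
  in it do not depend on this type, since test sets with at most two elements detect them.
\<close>

definition set_cat :: "'u itself \<Rightarrow> ('x set, 'x set \<times> ('x \<Rightarrow> 'x) \<times> 'x set) cat" where
  "set_cat U =
     \<lparr>obj = {X. small U X},
      arr = {(X, f, Y). small U X \<and> small U Y \<and> f \<in> X \<rightarrow>\<^sub>E Y},
      src = (\<lambda>(X, f, Y). X),
      tgt = (\<lambda>(X, f, Y). Y),
      ident = (\<lambda>X. (X, \<lambda>x \<in> X. x, X)),
      cmp = (\<lambda>(Y, g, Z) (X, f, Y'). (X, compose X g f, Z))\<rparr>"

definition hom_functor :: "('o, 'm) cat \<Rightarrow> 'o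
    \<Rightarrow> ('o, 'm, 'm set, 'm set \<times> ('m \<Rightarrow> 'm) \<times> 'm set) func" where
  "hom_functor C A =
     \<lparr>fob = (\<lambda>X \<in> obj C. Hom C A X),
      far = (\<lambda>f \<in> arr C. (Hom C A (src C f), \<lambda>g \<in> Hom C A (src C f). cmp C f g,
                            Hom C A (tgt C f)))\<rparr>"

definition small_ab_group :: "'u monoid \<Rightarrow> bool" where
  "small_ab_group (G :: 'u monoid) \<longleftrightarrow> comm_group G \<and> small TYPE('u) (carrier G)"

type_synonym 'u ab_arr = "'u monoid \<times> ('u \<Rightarrow> 'u) \<times> 'u monoid"

definition Ab :: "('u monoid, 'u ab_arr) cat" where
  "Ab =
     \<lparr>obj = {G. small_ab_group G},
      arr = {(G, f, H). small_ab_group G \<and> small_ab_group H \<and>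
                         f \<in> hom G H \<inter> extensional (carrier G)},
      src = (\<lambda>(G, f, H). G),
      tgt = (\<lambda>(G, f, H). H),
      ident = (\<lambda>G. (G, \<lambda>x \<in> carrier G. x, G)),
      cmp = (\<lambda>(H, g, K) (G, f, H'). (G, compose (carrier G) g f, K))\<rparr>"


section \<open>Locally presentable additive categories\<close>

definition presented :: "'u itself \<Rightarrow> 'l rel \<Rightarrow> ('o, 'm) cat \<Rightarrow> 'o \<Rightarrow> bool" where
  "presented U lam C A \<longleftrightarrow>
     A \<in> obj C \<and> preserves_directed_colimits U lam C (set_cat U) (hom_functor C A)"

definition locally_presentable :: "'u itself \<Rightarrow> 'l rel \<Rightarrow> ('o, 'm) cat \<Rightarrow> bool" where
  "locally_presentable (U :: 'u itself) lam C \<longleftrightarrow>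
     category C \<and> locally_small U C \<and> cocomplete U C \<and>
     (\<exists>G. small U G \<and> (\<forall>A \<in> G. presented U lam C A) \<and>
        (\<forall>X \<in> obj C. \<exists>(I :: 'u set) r D \<iota>.
           is_directed_colimit U lam C I r D X \<iota> \<and> fob D ` I \<subseteq> G))"

definition preadditive_structure :: "('o, 'm) cat \<Rightarrow> ('o \<Rightarrow> 'o \<Rightarrow> 'm monoid) \<Rightarrow> bool" where
  "preadditive_structure C G \<longleftrightarrow>
     (\<forall>A \<in> obj C. \<forall>B \<in> obj C. comm_group (G A B) \<and> carrier (G A B) = Hom C A B) \<and>
     (\<forall>A \<in> obj C. \<forall>B \<in> obj C. \<forall>D \<in> obj C.
        (\<forall>f \<in> Hom C A B. (\<lambda>g. cmp C g f) \<in> hom (G B D) (G A D)) \<and>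
        (\<forall>g \<in> Hom C B D. (\<lambda>f. cmp C g f) \<in> hom (G A B) (G A D)))"

text \<open>
  An additive category has an enrichment in abelian groups and all finite products (including the
  empty one); the enrichment is then unique, so additivity is a property of the category.
\<close>

definition additive :: "('o, 'm) cat \<Rightarrow> bool" where
  "additive C \<longleftrightarrow>
     category C \<and> (\<exists>G. preadditive_structure C G) \<and>
     (\<forall>(I :: nat set) X. finite I \<longrightarrow> X ` I \<subseteq> obj C \<longrightarrow> (\<exists>P \<pi>. is_product C I X P \<pi>))"


section \<open>Pure morphisms and definable subcategories\<close>

definition pure :: "'u itself \<Rightarrow> 'l rel \<Rightarrow> ('o, 'm) cat \<Rightarrow> 'o \<Rightarrow> 'o \<Rightarrow> 'm \<Rightarrow> bool" where
  "pure U lam C A B f \<longleftrightarrow>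
     f \<in> Hom C A B \<and>
     (\<forall>K L g u. presented U lam C K \<longrightarrow> presented U lam C L \<longrightarrow>
        g \<in> Hom C K L \<longrightarrow> u \<in> Hom C K A \<longrightarrow>
        (\<exists>v \<in> Hom C L B. cmp C f u = cmp C v g) \<longrightarrow>
        (\<exists>w \<in> Hom C L A. u = cmp C w g))"

text \<open>A full subcategory is given by its set of objects.\<close>

definition closed_under_products :: "'u itself \<Rightarrow> ('o, 'm) cat \<Rightarrow> 'o set \<Rightarrow> bool" where
  "closed_under_products U C \<D> \<longleftrightarrow>
     (\<forall>(I :: 'u set) X P \<pi>. small U I \<longrightarrow> X ` I \<subseteq> \<D> \<longrightarrow> is_product C I X P \<pi> \<longrightarrow> P \<in> \<D>)"

definition closed_under_directed_colimits ::
    "'u itself \<Rightarrow> 'l rel \<Rightarrow> ('o, 'm) cat \<Rightarrow> 'o set \<Rightarrow> bool" where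
  "closed_under_directed_colimits U lam C \<D> \<longleftrightarrow>
     (\<forall>(I :: 'u set) r D L \<iota>.
        is_directed_colimit U lam C I r D L \<iota> \<longrightarrow> fob D ` I \<subseteq> \<D> \<longrightarrow> L \<in> \<D>)"

definition closed_under_pure_subobjects ::
    "'u itself \<Rightarrow> 'l rel \<Rightarrow> ('o, 'm) cat \<Rightarrow> 'o set \<Rightarrow> bool" where
  "closed_under_pure_subobjects U lam C \<D> \<longleftrightarrow>
     (\<forall>A \<in> obj C. \<forall>B \<in> \<D>. \<forall>f. pure U lam C A B f \<longrightarrow> A \<in> \<D>)"

definition definable_subcategory ::
    "'u itself \<Rightarrow> 'l rel \<Rightarrow> ('o, 'm) cat \<Rightarrow> 'o set \<Rightarrow> bool" where
  "definable_subcategory U lam C \<D> \<longleftrightarrow>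
     \<D> \<subseteq> obj C \<and> closed_under_products U C \<D> \<and>
     closed_under_directed_colimits U lam C \<D> \<and> closed_under_pure_subobjects U lam C \<D>"


section \<open>The functor category\<close>

type_synonym ('o, 'm, 'u) ab_functor = "('o, 'm, 'u monoid, 'u ab_arr) func"

definition fun_obj :: "'l rel \<Rightarrow> ('o, 'm) cat \<Rightarrow> ('o, 'm, 'u) ab_functor set" where
  "fun_obj lam C =
     {F. is_functor C Ab F \<and> preserves_directed_colimits TYPE('u) lam C Ab F \<and>
         preserves_products TYPE('u) C Ab F}"

definition nat_trans :: "('o, 'm) cat \<Rightarrow> ('p, 'n) cat \<Rightarrow> ('o, 'm, 'p, 'n) func
    \<Rightarrow> ('o, 'm, 'p, 'n) func \<Rightarrow> ('o \<Rightarrow> 'n) set" where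
  "nat_trans C E F G =
     {\<eta> \<in> extensional (obj C).
        (\<forall>A \<in> obj C. \<eta> A \<in> Hom E (fob F A) (fob G A)) \<and>
        (\<forall>A B. \<forall>f \<in> Hom C A B. cmp E (\<eta> B) (far F f) = cmp E (far G f) (\<eta> A))}"

definition fun_cat :: "'l rel \<Rightarrow> ('o, 'm) cat \<Rightarrow> (('o, 'm, 'u) ab_functor,
    ('o, 'm, 'u) ab_functor \<times> ('o \<Rightarrow> 'u ab_arr) \<times> ('o, 'm, 'u) ab_functor) cat" where
  "fun_cat lam C =
     \<lparr>obj = fun_obj lam C,
      arr = {(F, \<eta>, G). F \<in> fun_obj lam C \<and> G \<in> fun_obj lam C \<and> \<eta> \<in> nat_trans C Ab F G},
      src = (\<lambda>(F, \<eta>, G). F),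
      tgt = (\<lambda>(F, \<eta>, G). G),
      ident = (\<lambda>F. (F, \<lambda>A \<in> obj C. ident Ab (fob F A), F)),
      cmp = (\<lambda>(G, \<theta>, H) (F, \<eta>, G'). (F, \<lambda>A \<in> obj C. cmp Ab (\<theta> A) (\<eta> A), H))\<rparr>"

end

theory Submission
  imports Defs "HOL-Algebra.Product_Groups"
begin

text \<open>
  Functors in \<open>fun\<^sub>\<lambda>(C)\<close> and definable subcategories are linked by factorization conditions.
  Given maps \<open>g : K \<rightarrow> L\<close> and \<open>u : K \<rightarrow> M\<close> between \<open>\<lambda>\<close>-presented objects, let \<open>N X\<close> be the subgroup of
  those \<open>h : M \<rightarrow> X\<close> for which \<open>h u\<close> factors through \<open>g\<close>. Then \<open>X \<mapsto> Hom(M, X) / N X\<close> preserves products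
  and \<open>\<lambda>\<close>-directed colimits, and it vanishes at \<open>X\<close> exactly if \<open>h u\<close> factors through \<open>g\<close> for every
  \<open>h : M \<rightarrow> X\<close> (\<open>factoring_functor_exists\<close>). These functors suffice to cut out every definable
  subcategory.

  \<^bold>\<open>The zeros of a class of functors are definable\<close> (\<open>annihilated_definable\<close>). Only closure under pure
  subobjects needs an argument. Let \<open>f : A \<rightarrow> B\<close> be \<open>\<lambda>\<close>-pure with \<open>F B = 0\<close>, and write \<open>A\<close> and \<open>B\<close> as
  \<open>\<lambda>\<close>-directed colimits of presented objects. An element \<open>x\<close> of \<open>F A\<close> comes from some \<open>y \<in> F A\<^sub>i\<close>. The
  composite \<open>A\<^sub>i \<rightarrow> A \<rightarrow> B\<close> factors through some \<open>B\<^sub>j\<close>, and since \<open>y\<close> dies in \<open>F B = colim F B\<^sub>j\<close> it already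
  dies in \<open>F B\<^sub>k\<close> for a later \<open>k\<close>. By purity \<open>A\<^sub>i \<rightarrow> A\<close> factors through \<open>A\<^sub>i \<rightarrow> B\<^sub>k\<close>, so \<open>x = 0\<close>.

  \<^bold>\<open>A definable subcategory is a class of zeros.\<close> Let \<open>\<D>\<close> be definable and suppose that every
  factorization functor that vanishes on \<open>\<D>\<close> vanishes at \<open>A\<close>. The claim is that whenever \<open>u : K \<rightarrow> A\<close>
  does not factor through \<open>g : K \<rightarrow> L\<close>, there is a map \<open>f : A \<rightarrow> B\<close> with \<open>B \<in> \<D>\<close> such that \<open>f u\<close> does not
  factor through \<open>g\<close> either (\<open>factors_if_all_into_definable_factor\<close>). Write \<open>A\<close>
  as a \<open>\<lambda>\<close>-directed colimit of presented objects \<open>A\<^sub>j\<close>, so that \<open>u\<close> comes from compatible maps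
  \<open>u\<^sub>j : K \<rightarrow> A\<^sub>j\<close> for \<open>j\<close> above some \<open>i\<close>. For each such \<open>j\<close> the functor of \<open>g\<close> and \<open>u\<^sub>j\<close> does not vanish
  at \<open>A\<close>, as witnessed by the leg \<open>A\<^sub>j \<rightarrow> A\<close>. Hence it does not vanish on \<open>\<D>\<close>: there is a map
  \<open>h\<^sub>j : A\<^sub>j \<rightarrow> B\<^sub>j\<close> with \<open>B\<^sub>j \<in> \<D>\<close> such that \<open>h\<^sub>j u\<^sub>j\<close> does not factor through \<open>g\<close>. The maps \<open>h\<^sub>j\<close> combine to
  a map \<open>f\<close> from \<open>A\<close> to the reduced product \<open>colim\<^sub>k (\<Prod>j \<ge> k. B\<^sub>j)\<close>, which lies in \<open>\<D>\<close>; as \<open>K\<close> and \<open>L\<close> are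
  presented, a factorization of \<open>f u\<close> would give one of some \<open>h\<^sub>l u\<^sub>l\<close>. The product of the maps \<open>f\<close> over
  a small set of tests \<open>(g, u)\<close> is then a \<open>\<lambda>\<close>-pure map from \<open>A\<close> into an object of \<open>\<D>\<close>, so \<open>A \<in> \<D>\<close>
  (\<open>definable_contains_inheriting\<close>).

  This uses products in \<open>C\<close>, whereas local presentability provides only colimits. A product of objects
  \<open>X\<^sub>i\<close> is a terminal cone, and it is constructed in \<open>presentable_product_exists\<close> as the colimit of all cones
  whose vertex is one of the generators.
\<close>

section \<open>Small sets\<close>

lemma small_subset: "small U B \<Longrightarrow> A \<subseteq> B \<Longrightarrow> small U A"
  unfolding small_def using card_of_mono1 ordLeq_ordLess_trans by blast

lemma small_image: "small U A \<Longrightarrow> small U (f ` A)"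
  unfolding small_def using card_of_image ordLeq_ordLess_trans by blast

lemma small_if_inj_on:
  assumes "small U B" "inj_on f A" "f ` A \<subseteq> B"
  shows "small U A"
proof -
  have "|A| \<le>o |B|"
    using assms(2,3) card_of_ordLeq[of A B] by blast
  then show ?thesis
    using assms(1) ordLeq_ordLess_trans unfolding small_def by blast
qed

lemma small_embedding:
  fixes A :: "'a set"
  assumes "small TYPE('u) A"
  obtains f :: "'a \<Rightarrow> 'u" where "inj_on f A"
  using assms card_of_ordLeq[of A "UNIV :: 'u set"] ordLess_imp_ordLeq
  unfolding small_def by blast

lemma small_finite:
  fixes A :: "'a set"
  assumes "universe TYPE('u)" "finite A"
  shows "small TYPE('u) A"
proof -
  have "natLeq \<le>o |UNIV :: 'u set|"
    using assms(1) ordLess_imp_ordLeq unfolding universe_def by blast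
  then have "infinite (UNIV :: 'u set)"
    using infinite_iff_natLeq_ordLeq by blast
  then show ?thesis
    using assms(2) finite_ordLess_infinite[OF card_of_Well_order card_of_Well_order]
    unfolding small_def Field_card_of by blast
qed

lemma small_Sigma:
  assumes "universe TYPE('u)" "small TYPE('u) A" "\<And>a. a \<in> A \<Longrightarrow> small TYPE('u) (B a)"
  shows "small TYPE('u) (Sigma A B)"
proof -
  have "natLeq \<le>o |UNIV :: 'u set|"
    using assms(1) ordLess_imp_ordLeq unfolding universe_def by blast
  then have "infinite (UNIV :: 'u set)"
    using infinite_iff_natLeq_ordLeq by blast
  then have "stable |UNIV :: 'u set|"
    using assms(1) regularCard_stable[OF card_of_Card_order]
    unfolding universe_def Field_card_of by blast
  then show ?thesis
    using stable_elim assms(2,3) unfolding small_def by blast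
qed

lemma small_UN:
  assumes "universe TYPE('u)" "small TYPE('u) A" "\<And>a. a \<in> A \<Longrightarrow> small TYPE('u) (B a)"
  shows "small TYPE('u) (\<Union>a\<in>A. B a)"
proof -
  have "(\<Union>a\<in>A. B a) = snd ` Sigma A B"
    by force
  moreover have "small TYPE('u) (snd ` Sigma A B)"
    by (intro small_image small_Sigma assms)
  ultimately show ?thesis by simp
qed

lemma small_Un:
  assumes "universe TYPE('u)" "small TYPE('u) A" "small TYPE('u) B"
  shows "small TYPE('u) (A \<union> B)"
proof -
  have "A \<union> B = (\<Union>b\<in>UNIV. if b then A else B)"
    by (auto split: if_splits)
  then show ?thesis
    using small_UN[OF assms(1), of "UNIV :: bool set" "\<lambda>b. if b then A else B"]
      small_finite[OF assms(1), of "UNIV :: bool set"] assms(2,3) by simp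
qed

lemma small_Pow:
  assumes "universe TYPE('u)" "small TYPE('u) A"
  shows "small TYPE('u) (Pow A)"
proof -
  obtain f :: "'a \<Rightarrow> 'u" where f: "inj_on f A"
    using small_embedding[OF assms(2)] .
  have "small TYPE('u) (f ` A)"
    using small_image[OF assms(2)] .
  then have "small TYPE('u) (Pow (f ` A))"
    using conjunct2[OF conjunct2[OF assms(1)[unfolded universe_def]]] unfolding small_def
    by (elim allE[of _ "f ` A"] impE)
  moreover have "inj_on (\<lambda>S. f ` S) (Pow A)"
    using inj_on_image_Pow[OF f] .
  moreover have "(\<lambda>S. f ` S) ` Pow A \<subseteq> Pow (f ` A)"
    by auto
  ultimately show ?thesis
    by (rule small_if_inj_on[where f = "\<lambda>S. f ` S" and B = "Pow (f ` A)"])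
qed

lemma small_PiE:
  assumes "universe TYPE('u)" "small TYPE('u) A" "\<And>a. a \<in> A \<Longrightarrow> small TYPE('u) (B a)"
  shows "small TYPE('u) (Pi\<^sub>E A B)"
proof -
  have "inj_on (\<lambda>f. (\<lambda>a. (a, f a)) ` A) (Pi\<^sub>E A B)"
  proof (rule inj_onI)
    fix f g
    assume f: "f \<in> Pi\<^sub>E A B" and g: "g \<in> Pi\<^sub>E A B"
      and eq: "(\<lambda>a. (a, f a)) ` A = (\<lambda>a. (a, g a)) ` A"
    have "f a = g a" if "a \<in> A" for a
    proof -
      have "(a, f a) \<in> (\<lambda>a. (a, g a)) ` A"
        using eq that by blast
      then show ?thesis by auto
    qed
    then show "f = g"
      using f g PiE_ext by metis
  qed
  moreover have "(\<lambda>f. (\<lambda>a. (a, f a)) ` A) ` Pi\<^sub>E A B \<subseteq> Pow (Sigma A B)"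
    by auto
  moreover have "small TYPE('u) (Pow (Sigma A B))"
    by (intro small_Pow small_Sigma assms)
  ultimately show ?thesis
    using small_if_inj_on[of "TYPE('u)" "Pow (Sigma A B)" "\<lambda>f. (\<lambda>a. (a, f a)) ` A"] by simp
qed


section \<open>Categories and colimits\<close>

lemma HomD: "f \<in> Hom C A B \<Longrightarrow> f \<in> arr C \<and> src C f = A \<and> tgt C f = B"
  by (simp add: Hom_def)

lemma Hom_arr: "f \<in> Hom C A B \<Longrightarrow> f \<in> arr C"
  by (simp add: Hom_def)

lemma arr_Hom: "f \<in> arr C \<Longrightarrow> f \<in> Hom C (src C f) (tgt C f)"
  by (simp add: Hom_def)

lemma
  assumes "category C"
  shows Hom_objD: "f \<in> Hom C A B \<Longrightarrow> A \<in> obj C \<and> B \<in> obj C"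
    and ident_Hom: "A \<in> obj C \<Longrightarrow> ident C A \<in> Hom C A A"
    and cmp_Hom: "f \<in> Hom C A B \<Longrightarrow> g \<in> Hom C B E \<Longrightarrow> cmp C g f \<in> Hom C A E"
    and cmp_ident_right: "f \<in> Hom C A B \<Longrightarrow> cmp C f (ident C A) = f"
    and cmp_ident_left: "f \<in> Hom C A B \<Longrightarrow> cmp C (ident C B) f = f"
    and cmp_assoc: "f \<in> Hom C A B \<Longrightarrow> g \<in> Hom C B E \<Longrightarrow> h \<in> Hom C E H \<Longrightarrow>
          cmp C h (cmp C g f) = cmp C (cmp C h g) f"
  using assms unfolding category_def by (auto dest: HomD)

lemma
  assumes "is_functor C E F"
  shows fob_obj: "A \<in> obj C \<Longrightarrow> fob F A \<in> obj E"
    and far_Hom: "f \<in> Hom C A B \<Longrightarrow> far F f \<in> Hom E (fob F A) (fob F B)"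
    and far_ident: "A \<in> obj C \<Longrightarrow> far F (ident C A) = ident E (fob F A)"
    and far_cmp: "f \<in> Hom C A B \<Longrightarrow> g \<in> Hom C B H \<Longrightarrow>
          far F (cmp C g f) = cmp E (far F g) (far F f)"
  using assms unfolding is_functor_def by auto

lemma colimit_cocone: "is_colimit J C D L \<iota> \<Longrightarrow> is_cocone J C D L \<iota>"
  by (simp add: is_colimit_def)

lemma cocone_obj: "is_cocone J C D L \<iota> \<Longrightarrow> L \<in> obj C"
  by (simp add: is_cocone_def)

lemma cocone_Hom: "is_cocone J C D L \<iota> \<Longrightarrow> j \<in> obj J \<Longrightarrow> \<iota> j \<in> Hom C (fob D j) L"
  by (simp add: is_cocone_def)

lemma cocone_commute:
  "is_cocone J C D L \<iota> \<Longrightarrow> a \<in> Hom J i j \<Longrightarrow> cmp C (\<iota> j) (far D a) = \<iota> i"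
  by (auto simp: is_cocone_def Hom_def)

lemma colimit_factor:
  assumes "is_colimit J C D L \<iota>" "is_cocone J C D M \<kappa>"
  obtains h where "h \<in> Hom C L M" "\<And>j. j \<in> obj J \<Longrightarrow> cmp C h (\<iota> j) = \<kappa> j"
  using assms unfolding is_colimit_def by blast

lemma cocone_cmp:
  assumes C: "category C" and J: "category J" and D: "is_functor J C D"
    and \<iota>: "is_cocone J C D L \<iota>" and h: "h \<in> Hom C L M"
  shows "is_cocone J C D M (\<lambda>j. cmp C h (\<iota> j))"
  unfolding is_cocone_def
proof (intro conjI ballI)
  show "M \<in> obj C"
    using Hom_objD[OF C h] by blast
  show "cmp C h (\<iota> j) \<in> Hom C (fob D j) M" if "j \<in> obj J" for j
    using cmp_Hom[OF C cocone_Hom[OF \<iota> that] h] .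
  show "cmp C (cmp C h (\<iota> (tgt J a))) (far D a) = cmp C h (\<iota> (src J a))" if "a \<in> arr J" for a
  proof -
    note a = arr_Hom[OF that]
    have "\<iota> (tgt J a) \<in> Hom C (fob D (tgt J a)) L"
      using Hom_objD[OF J a] cocone_Hom[OF \<iota>] by blast
    then show ?thesis
      using cmp_assoc[OF C far_Hom[OF D a] _ h] cocone_commute[OF \<iota> a] by metis
  qed
qed

lemma colimit_unique:
  assumes C: "category C" and J: "category J" and D: "is_functor J C D"
    and L: "is_colimit J C D L \<iota>" and h: "h \<in> Hom C L M" and h': "h' \<in> Hom C L M"
    and eq: "\<And>j. j \<in> obj J \<Longrightarrow> cmp C h (\<iota> j) = cmp C h' (\<iota> j)"
  shows "h = h'"
proof -
  have "is_cocone J C D M (\<lambda>j. cmp C h (\<iota> j))"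
    using cocone_cmp[OF C J D colimit_cocone[OF L] h] .
  then have "\<exists>!k. k \<in> Hom C L M \<and> (\<forall>j\<in>obj J. cmp C k (\<iota> j) = cmp C h (\<iota> j))"
    using L unfolding is_colimit_def by blast
  then show ?thesis
    using h h' eq by metis
qed

text \<open>
  Cocompleteness refers to index categories whose objects and arrows are elements of \<open>'u\<close>; the cone
  categories below live on other types, so index categories are transported along injections into \<open>'u\<close>.
\<close>

lemma cocomplete_any_small_category:
  fixes C :: "('o, 'm) cat" and J :: "('j, 'k) cat"
  assumes cocomp: "cocomplete TYPE('u) C" and J: "category J"
    and smallO: "small TYPE('u) (obj J)" and smallA: "small TYPE('u) (arr J)"
    and D: "is_functor J C D"
  obtains L \<iota> where "is_colimit J C D L \<iota>"
proof -
  obtain \<phi> :: "'j \<Rightarrow> 'u" where \<phi>: "inj_on \<phi> (obj J)"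
    using small_embedding[OF smallO] .
  obtain \<psi> :: "'k \<Rightarrow> 'u" where \<psi>: "inj_on \<psi> (arr J)"
    using small_embedding[OF smallA] .
  define \<phi>' where "\<phi>' = inv_into (obj J) \<phi>"
  define \<psi>' where "\<psi>' = inv_into (arr J) \<psi>"
  have \<phi>'[simp]: "\<phi>' (\<phi> x) = x" if "x \<in> obj J" for x
    using that \<phi> unfolding \<phi>'_def by simp
  have \<psi>'[simp]: "\<psi>' (\<psi> x) = x" if "x \<in> arr J" for x
    using that \<psi> unfolding \<psi>'_def by simp
  define J' :: "('u, 'u) cat" where "J' = \<lparr>obj = \<phi> ` obj J, arr = \<psi> ` arr J,
     src = (\<lambda>a. \<phi> (src J (\<psi>' a))), tgt = (\<lambda>a. \<phi> (tgt J (\<psi>' a))),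
     ident = (\<lambda>x. \<psi> (ident J (\<phi>' x))), cmp = (\<lambda>b a. \<psi> (cmp J (\<psi>' b) (\<psi>' a)))\<rparr>"
  have st: "src J f \<in> obj J" "tgt J f \<in> obj J" if "f \<in> arr J" for f
    using Hom_objD[OF J arr_Hom[OF that]] by auto
  have Hom_J'I: "\<psi> f \<in> Hom J' (\<phi> x) (\<phi> y)" if "f \<in> Hom J x y" for f x y
    using HomD[OF that] by (simp add: Hom_def J'_def)
  have Hom_J'E: "\<exists>f x y. a = \<psi> f \<and> X = \<phi> x \<and> Y = \<phi> y \<and> x \<in> obj J \<and> y \<in> obj J \<and> f \<in> Hom J x y"
    if "a \<in> Hom J' X Y" for a X Y
  proof -
    have "a \<in> \<psi> ` arr J"
      using HomD[OF that] by (simp add: J'_def)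
    then obtain f where f: "f \<in> arr J" "a = \<psi> f"
      by blast
    then have "X = \<phi> (src J f)" "Y = \<phi> (tgt J f)"
      using that by (auto simp: Hom_def J'_def)
    then show ?thesis
      using f arr_Hom[OF f(1)] st[OF f(1)] by blast
  qed
  note arr' = Hom_arr[where C = J]
  have cmp': "cmp J' (\<psi> g) (\<psi> f) = \<psi> (cmp J g f)" if "f \<in> arr J" "g \<in> arr J" for f g
    using that by (simp add: J'_def)
  have ident': "ident J' (\<phi> x) = \<psi> (ident J x)" if "x \<in> obj J" for x
    using that by (simp add: J'_def)
  have \<phi>_eq: "x = y" if "\<phi> x = \<phi> y" "x \<in> obj J" "y \<in> obj J" for x y
    using that \<phi> by (meson inj_onD)
  have cat': "category J'"
    unfolding category_def
  proof (intro conjI ballI allI impI)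
    fix f assume "f \<in> arr J'"
    then show "src J' f \<in> obj J'" "tgt J' f \<in> obj J'"
      using st by (auto simp: J'_def)
  next
    fix A assume "A \<in> obj J'"
    then obtain x where x: "x \<in> obj J" "A = \<phi> x"
      by (auto simp: J'_def)
    then show "ident J' A \<in> Hom J' A A"
      using Hom_J'I[OF ident_Hom[OF J x(1)]] ident' by simp
  next
    fix A B E f g assume fg: "f \<in> Hom J' A B" "g \<in> Hom J' B E"
    obtain f0 x y where f0: "f = \<psi> f0" "A = \<phi> x" "B = \<phi> y" "y \<in> obj J" "f0 \<in> Hom J x y"
      using Hom_J'E[OF fg(1)] by blast
    obtain g0 y' z where g0: "g = \<psi> g0" "B = \<phi> y'" "E = \<phi> z" "y' \<in> obj J" "g0 \<in> Hom J y' z"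
      using Hom_J'E[OF fg(2)] by blast
    have "y' = y" using \<phi>_eq f0 g0 by metis
    then have "cmp J g0 f0 \<in> Hom J x z"
      using cmp_Hom[OF J] f0 g0 by blast
    then show "cmp J' g f \<in> Hom J' A E"
      using Hom_J'I f0 g0 cmp' arr' by metis
  next
    fix A B f assume f: "f \<in> Hom J' A B"
    obtain f0 x y where f0: "f = \<psi> f0" "A = \<phi> x" "B = \<phi> y" "x \<in> obj J" "y \<in> obj J" "f0 \<in> Hom J x y"
      using Hom_J'E[OF f] by blast
    show "cmp J' f (ident J' A) = f"
      using f0 ident' cmp' arr' ident_Hom[OF J f0(4)] cmp_ident_right[OF J f0(6)] by metis
    show "cmp J' (ident J' B) f = f"
      using f0 ident' cmp' arr' ident_Hom[OF J f0(5)] cmp_ident_left[OF J f0(6)] by metis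
  next
    fix A B E H f g h assume fgh: "f \<in> Hom J' A B" "g \<in> Hom J' B E" "h \<in> Hom J' E H"
    obtain f0 x y where f0: "f = \<psi> f0" "A = \<phi> x" "B = \<phi> y" "y \<in> obj J" "f0 \<in> Hom J x y"
      using Hom_J'E[OF fgh(1)] by blast
    obtain g0 y' z where g0: "g = \<psi> g0" "B = \<phi> y'" "E = \<phi> z" "y' \<in> obj J" "z \<in> obj J"
        "g0 \<in> Hom J y' z"
      using Hom_J'E[OF fgh(2)] by blast
    obtain h0 z' w where h0: "h = \<psi> h0" "E = \<phi> z'" "H = \<phi> w" "z' \<in> obj J" "h0 \<in> Hom J z' w"
      using Hom_J'E[OF fgh(3)] by blast
    have eqs: "y' = y" "z' = z" using \<phi>_eq f0 g0 h0 by metis+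
    then have c1: "cmp J g0 f0 \<in> Hom J x z" and c2: "cmp J h0 g0 \<in> Hom J y w"
      using cmp_Hom[OF J] f0 g0 h0 by blast+
    have "cmp J h0 (cmp J g0 f0) = cmp J (cmp J h0 g0) f0"
      using cmp_assoc[OF J] f0 g0 h0 eqs by blast
    then show "cmp J' h (cmp J' g f) = cmp J' (cmp J' h g) f"
      using f0 g0 h0 cmp' arr'[OF c1] arr'[OF c2] arr' by metis
  qed
  define D' where "D' = \<lparr>fob = (\<lambda>x \<in> obj J'. fob D (\<phi>' x)), far = (\<lambda>a \<in> arr J'. far D (\<psi>' a))\<rparr>"
  have obj': "\<phi> x \<in> obj J'" if "x \<in> obj J" for x
    using that by (simp add: J'_def)
  have fob': "fob D' (\<phi> x) = fob D x" if "x \<in> obj J" for x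
    using that by (simp add: D'_def J'_def)
  have far': "far D' (\<psi> f) = far D f" if "f \<in> arr J" for f
    using that by (simp add: D'_def J'_def)
  have D': "is_functor J' C D'"
    unfolding is_functor_def
  proof (intro conjI ballI allI impI)
    show "fob D' \<in> obj J' \<rightarrow>\<^sub>E obj C"
      using fob_obj[OF D] by (auto simp: D'_def J'_def)
    have "far D f \<in> arr C" if "f \<in> arr J" for f
      by (rule Hom_arr[OF far_Hom[OF D arr_Hom[OF that]]])
    then show "far D' \<in> arr J' \<rightarrow>\<^sub>E arr C"
      by (auto simp: D'_def J'_def)
  next
    fix A B f assume f: "f \<in> Hom J' A B"
    obtain f0 x y where f0: "f = \<psi> f0" "A = \<phi> x" "B = \<phi> y" "x \<in> obj J" "y \<in> obj J" "f0 \<in> Hom J x y"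
      using Hom_J'E[OF f] by blast
    then show "far D' f \<in> Hom C (fob D' A) (fob D' B)"
      using far_Hom[OF D f0(6)] fob' far' arr' by metis
  next
    fix A assume "A \<in> obj J'"
    then obtain x where x: "x \<in> obj J" "A = \<phi> x"
      by (auto simp: J'_def)
    then show "far D' (ident J' A) = ident C (fob D' A)"
      using ident' fob' far' arr' ident_Hom[OF J x(1)] far_ident[OF D x(1)] by metis
  next
    fix A B E f g assume fg: "f \<in> Hom J' A B" "g \<in> Hom J' B E"
    obtain f0 x y where f0: "f = \<psi> f0" "A = \<phi> x" "B = \<phi> y" "y \<in> obj J" "f0 \<in> Hom J x y"
      using Hom_J'E[OF fg(1)] by blast
    obtain g0 y' z where g0: "g = \<psi> g0" "B = \<phi> y'" "E = \<phi> z" "y' \<in> obj J" "g0 \<in> Hom J y' z"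
      using Hom_J'E[OF fg(2)] by blast
    have "y' = y" using \<phi>_eq f0 g0 by metis
    then have *: "cmp J g0 f0 \<in> Hom J x z" "far D (cmp J g0 f0) = cmp C (far D g0) (far D f0)"
      using cmp_Hom[OF J] far_cmp[OF D] f0 g0 by blast+
    then show "far D' (cmp J' g f) = cmp C (far D' g) (far D' f)"
      using f0 g0 cmp' far' arr' by metis
  qed
  have "small TYPE('u) (obj J')" "small TYPE('u) (arr J')"
    using small_image[OF smallO] small_image[OF smallA] by (simp_all add: J'_def)
  then obtain L \<iota> where L: "is_colimit J' C D' L \<iota>"
    using cocomp cat' D' unfolding cocomplete_def by blast
  have cocone': "is_cocone J' C D' M (\<lambda>x. \<kappa> (\<phi>' x)) \<longleftrightarrow> is_cocone J C D M \<kappa>" for M \<kappa>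
    unfolding is_cocone_def by (auto simp: J'_def D'_def st)
  have \<iota>_eq: "is_cocone J C D L (\<lambda>x. \<iota> (\<phi> x))"
    using colimit_cocone[OF L] unfolding is_cocone_def by (auto simp: J'_def D'_def st)
  have "is_colimit J C D L (\<lambda>x. \<iota> (\<phi> x))"
    unfolding is_colimit_def
  proof (intro conjI allI impI)
    show "is_cocone J C D L (\<lambda>x. \<iota> (\<phi> x))" by (rule \<iota>_eq)
    fix M \<kappa> assume "is_cocone J C D M \<kappa>"
    then have "is_cocone J' C D' M (\<lambda>x. \<kappa> (\<phi>' x))"
      using cocone' by blast
    then have "\<exists>!h. h \<in> Hom C L M \<and> (\<forall>x\<in>obj J'. cmp C h (\<iota> x) = \<kappa> (\<phi>' x))"
      using L unfolding is_colimit_def by blast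
    moreover have "(\<forall>x\<in>obj J'. cmp C h (\<iota> x) = \<kappa> (\<phi>' x)) \<longleftrightarrow> (\<forall>x\<in>obj J. cmp C h (\<iota> (\<phi> x)) = \<kappa> x)" for h
      by (simp add: J'_def)
    ultimately show "\<exists>!h. h \<in> Hom C L M \<and> (\<forall>j\<in>obj J. cmp C h (\<iota> (\<phi> j)) = \<kappa> j)"
      by simp
  qed
  then show thesis by (rule that)
qed

section \<open>Directed colimits and presented objects\<close>

lemma obj_poset_cat [simp]: "obj (poset_cat I r) = I"
  and arr_poset_cat [simp]: "arr (poset_cat I r) = r"
  and src_poset_cat [simp]: "src (poset_cat I r) = fst"
  and tgt_poset_cat [simp]: "tgt (poset_cat I r) = snd"
  by (simp_all add: poset_cat_def)

lemma Hom_poset_cat: "f \<in> Hom (poset_cat I r) i j \<longleftrightarrow> f = (i, j) \<and> (i, j) \<in> r"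
  by (cases f) (auto simp: Hom_def)

lemma
  assumes "partial_order_on I r"
  shows poset_carrier: "(i, j) \<in> r \<Longrightarrow> i \<in> I \<and> j \<in> I"
    and poset_refl: "i \<in> I \<Longrightarrow> (i, i) \<in> r"
    and poset_trans: "(i, j) \<in> r \<Longrightarrow> (j, k) \<in> r \<Longrightarrow> (i, k) \<in> r"
  using assms unfolding partial_order_on_def preorder_on_def refl_on_def trans_def by blast+

lemma category_poset_cat:
  assumes "partial_order_on I r"
  shows "category (poset_cat I r)"
  unfolding category_def Hom_poset_cat Ball_def
  using poset_carrier[OF assms] poset_refl[OF assms] poset_trans[OF assms]
  by (auto simp: poset_cat_def)

lemma
  assumes "partial_order_on I r" "is_functor (poset_cat I r) C D"
  shows system_obj: "i \<in> I \<Longrightarrow> fob D i \<in> obj C"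
    and system_Hom: "(i, j) \<in> r \<Longrightarrow> far D (i, j) \<in> Hom C (fob D i) (fob D j)"
    and system_cmp: "(i, j) \<in> r \<Longrightarrow> (j, k) \<in> r \<Longrightarrow>
          cmp C (far D (j, k)) (far D (i, j)) = far D (i, k)"
    and system_refl: "i \<in> I \<Longrightarrow> far D (i, i) = ident C (fob D i)"
proof -
  show "i \<in> I \<Longrightarrow> fob D i \<in> obj C"
    using fob_obj[OF assms(2)] by simp
  show "(i, j) \<in> r \<Longrightarrow> far D (i, j) \<in> Hom C (fob D i) (fob D j)"
    using far_Hom[OF assms(2)] by (simp add: Hom_poset_cat)
  show "(i, j) \<in> r \<Longrightarrow> (j, k) \<in> r \<Longrightarrow> cmp C (far D (j, k)) (far D (i, j)) = far D (i, k)"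
    using far_cmp[OF assms(2), of "(i, j)" i j "(j, k)" k] by (simp add: Hom_poset_cat) (simp add: poset_cat_def)
  show "i \<in> I \<Longrightarrow> far D (i, i) = ident C (fob D i)"
    using far_ident[OF assms(2), of i] by simp (simp add: poset_cat_def)
qed

lemma finite_ordLess_regular:
  fixes A :: "'a set"
  assumes "infinite_regular_cardinal lam" "finite A"
  shows "|A| <o lam"
proof -
  have "Well_order lam" "infinite (Field lam)"
    using assms(1) card_order_on_well_order_on
    unfolding infinite_regular_cardinal_def cinfinite_def by blast+
  then show ?thesis
    using finite_ordLess_infinite[OF card_of_Well_order] assms(2) unfolding Field_card_of by blast
qed

lemma directed_upper_bound:
  assumes lam: "infinite_regular_cardinal lam" and dir: "directed_poset lam I r"
    and ij: "i \<in> I" "j \<in> I"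
  obtains k where "k \<in> I" "(i, k) \<in> r" "(j, k) \<in> r"
proof -
  have "|{i, j}| <o lam"
    by (rule finite_ordLess_regular[OF lam]) simp
  moreover have "{i, j} \<subseteq> I"
    using ij by simp
  ultimately have "\<exists>k\<in>I. \<forall>s\<in>{i, j}. (s, k) \<in> r"
    using dir by (simp only: directed_poset_def)
  then show thesis
    using that by auto
qed

lemma directed_nonempty:
  fixes I :: "'i set"
  assumes lam: "infinite_regular_cardinal lam" and dir: "directed_poset lam I r"
  obtains i where "i \<in> I"
proof -
  have "|{} :: 'i set| <o lam"
    by (rule finite_ordLess_regular[OF lam]) simp
  then have "\<exists>k\<in>I. \<forall>s\<in>{}. (s, k) \<in> r"
    using dir empty_subsetI[of I] unfolding directed_poset_def by (elim conjE allE impE)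
  then show thesis
    using that by blast
qed

lemma
  assumes "is_directed_colimit U lam C I r D L \<iota>"
  shows directed_colimit_small: "small U I"
    and directed_colimit_directed: "directed_poset lam I r"
    and directed_colimit_order: "partial_order_on I r"
    and directed_colimit_functor: "is_functor (poset_cat I r) C D"
    and directed_colimit_colimit: "is_colimit (poset_cat I r) C D L \<iota>"
    and directed_colimit_obj: "L \<in> obj C"
    and directed_colimit_leg: "i \<in> I \<Longrightarrow> \<iota> i \<in> Hom C (fob D i) L"
    and directed_colimit_commute: "(i, j) \<in> r \<Longrightarrow> cmp C (\<iota> j) (far D (i, j)) = \<iota> i"
proof -
  note d = assms[unfolded is_directed_colimit_def]
  show "small U I" "directed_poset lam I r" "partial_order_on I r"
    "is_functor (poset_cat I r) C D" "is_colimit (poset_cat I r) C D L \<iota>"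
    using d by (auto simp: directed_poset_def)
  then have c: "is_cocone (poset_cat I r) C D L \<iota>"
    by (intro colimit_cocone)
  show "L \<in> obj C"
    using cocone_obj[OF c] .
  show "i \<in> I \<Longrightarrow> \<iota> i \<in> Hom C (fob D i) L"
    using cocone_Hom[OF c] by simp
  show "(i, j) \<in> r \<Longrightarrow> cmp C (\<iota> j) (far D (i, j)) = \<iota> i"
    using cocone_commute[OF c] by (simp add: Hom_poset_cat)
qed

lemma directed_colimit_unique:
  assumes "category C" "is_directed_colimit U lam C I r D L \<iota>"
    and "h \<in> Hom C L M" "h' \<in> Hom C L M" "\<And>i. i \<in> I \<Longrightarrow> cmp C h (\<iota> i) = cmp C h' (\<iota> i)"
  shows "h = h'"
  using colimit_unique[OF assms(1) category_poset_cat[OF directed_colimit_order[OF assms(2)]]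
      directed_colimit_functor[OF assms(2)] directed_colimit_colimit[OF assms(2)] assms(3,4)]
    assms(5) by simp

lemma Hom_set_cat:
  "f \<in> Hom (set_cat U) X Y \<longleftrightarrow>
     small U X \<and> small U Y \<and> (\<exists>g. f = (X, g, Y) \<and> g \<in> X \<rightarrow>\<^sub>E Y)"
  by (auto simp: Hom_def set_cat_def)

lemma cmp_set_cat [simp]: "cmp (set_cat U) (Y, g, Z) (X, f, Y') = (X, compose X g f, Z)"
  by (simp add: set_cat_def)

text \<open>
  The union of the images of the legs is itself the vertex of a cocone, so the identity of the colimit
  factors through the inclusion of this union.
\<close>

lemma set_cat_colimit_stage:
  assumes col: "is_colimit (poset_cat I r) (set_cat U) E S \<sigma>"
    and fob: "\<And>i. i \<in> I \<Longrightarrow> fob E i = e i"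
    and far: "\<And>i j. (i, j) \<in> r \<Longrightarrow> far E (i, j) = (e i, t i j, e j)"
    and leg: "\<And>i. i \<in> I \<Longrightarrow> \<sigma> i = (e i, s i, S)"
    and order: "partial_order_on I r"
    and x: "x \<in> S"
  obtains i y where "i \<in> I" "y \<in> e i" "x = s i y"
proof -
  note coc = colimit_cocone[OF col]
  have S: "small U S"
    using cocone_obj[OF coc] by (simp add: set_cat_def)
  have s: "s i \<in> e i \<rightarrow>\<^sub>E S" "small U (e i)" if "i \<in> I" for i
    using cocone_Hom[OF coc, of i] that fob leg by (auto simp: Hom_set_cat)
  have comm: "compose (e i) (s j) (t i j) = s i" if "(i, j) \<in> r" for i j
  proof -
    have "(i, j) \<in> Hom (poset_cat I r) i j"
      by (simp add: Hom_poset_cat that)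
    note comm = cocone_commute[OF coc this]
    have ij: "i \<in> I" "j \<in> I"
      using poset_carrier[OF order that] by auto
    show ?thesis
      using comm unfolding far[OF that] leg[OF ij(1)] leg[OF ij(2)] by simp
  qed
  define M where "M = (\<Union>i\<in>I. s i ` e i)"
  have M: "M \<subseteq> S"
    using s unfolding M_def by blast
  have sM: "s i \<in> e i \<rightarrow>\<^sub>E M" if "i \<in> I" for i
    using s(1)[OF that] that unfolding M_def by blast
  have coM: "is_cocone (poset_cat I r) (set_cat U) E M (\<lambda>i. (e i, s i, M))"
    unfolding is_cocone_def
    using small_subset[OF S M] sM s(2) fob far comm poset_carrier[OF order]
    by (auto simp: Hom_set_cat) (auto simp: set_cat_def)
  obtain h where h: "h \<in> Hom (set_cat U) S M"
    "\<And>i. i \<in> I \<Longrightarrow> cmp (set_cat U) h (\<sigma> i) = (e i, s i, M)"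
    using colimit_factor[OF col coM] by (metis obj_poset_cat)
  obtain h0 where h0: "h = (S, h0, M)" "h0 \<in> S \<rightarrow>\<^sub>E M"
    using h(1) by (auto simp: Hom_set_cat)
  let ?P = "\<lambda>k. k \<in> Hom (set_cat U) S S \<and>
    (\<forall>i\<in>obj (poset_cat I r). cmp (set_cat U) k (\<sigma> i) = \<sigma> i)"
  have "?P (S, h0, S)"
    using h0 h(2) leg M S by (auto simp: Hom_set_cat)
  moreover have "?P (S, \<lambda>x\<in>S. x, S)"
  proof -
    have "compose (e i) (\<lambda>x\<in>S. x) (s i) = s i" if "i \<in> I" for i
      using s(1)[OF that] by (auto simp: compose_def fun_eq_iff PiE_def Pi_def extensional_def)
    then show ?thesis
      using leg S by (auto simp: Hom_set_cat)
  qed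
  moreover have "\<exists>!k. ?P k"
    using col coc unfolding is_colimit_def by blast
  ultimately have "h0 = (\<lambda>x\<in>S. x)"
    by blast
  then have "x \<in> M"
    using h0(2) x by auto
  then show thesis
    using that unfolding M_def by blast
qed

text \<open>
  Two elements that never become equal are separated by the cocone into \<open>{x, x'}\<close> that asks whether
  an element eventually becomes equal to the image of \<open>x\<close>.
\<close>

lemma set_cat_colimit_eq:
  assumes col: "is_colimit (poset_cat I r) (set_cat U) E S \<sigma>"
    and fob: "\<And>i. i \<in> I \<Longrightarrow> fob E i = e i"
    and far: "\<And>i j. (i, j) \<in> r \<Longrightarrow> far E (i, j) = (e i, t i j, e j)"
    and leg: "\<And>i. i \<in> I \<Longrightarrow> \<sigma> i = (e i, s i, S)"
    and order: "partial_order_on I r"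
    and ub: "\<And>i j. i \<in> I \<Longrightarrow> j \<in> I \<Longrightarrow> \<exists>k. (i, k) \<in> r \<and> (j, k) \<in> r"
    and t: "\<And>i j y. (i, j) \<in> r \<Longrightarrow> y \<in> e i \<Longrightarrow> t i j y \<in> e j"
    and tt: "\<And>i j k y. (i, j) \<in> r \<Longrightarrow> (j, k) \<in> r \<Longrightarrow> y \<in> e i \<Longrightarrow> t j k (t i j y) = t i k y"
    and i: "i \<in> I" and x: "x \<in> e i" "x' \<in> e i" and eq: "s i x = s i x'"
  obtains j where "(i, j) \<in> r" "t i j x = t i j x'"
proof (cases "x = x'")
  case True
  then show ?thesis
    using that poset_refl[OF order i] by blast
next
  case False
  note coc = colimit_cocone[OF col]
  have s: "s i \<in> e i \<rightarrow>\<^sub>E S" "small U (e i)" if "i \<in> I" for i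
    using cocone_Hom[OF coc, of i] that fob leg by (auto simp: Hom_set_cat)
  have smallM: "small U {x, x'}"
    by (rule small_subset[OF s(2)[OF i]]) (simp add: x)
  define \<chi> where "\<chi> j y = (if \<exists>k. (j, k) \<in> r \<and> (i, k) \<in> r \<and> t j k y = t i k x then x else x')" for j y
  have \<chi>: "\<chi> k (t j k y) = \<chi> j y" if jk: "(j, k) \<in> r" and y: "y \<in> e j" for j k y
  proof -
    have "(\<exists>l. (k, l) \<in> r \<and> (i, l) \<in> r \<and> t k l (t j k y) = t i l x) \<longleftrightarrow>
          (\<exists>l. (j, l) \<in> r \<and> (i, l) \<in> r \<and> t j l y = t i l x)"
    proof
      assume "\<exists>l. (k, l) \<in> r \<and> (i, l) \<in> r \<and> t k l (t j k y) = t i l x"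
      then show "\<exists>l. (j, l) \<in> r \<and> (i, l) \<in> r \<and> t j l y = t i l x"
        using tt[OF jk _ y] poset_trans[OF order jk] by metis
    next
      assume "\<exists>l. (j, l) \<in> r \<and> (i, l) \<in> r \<and> t j l y = t i l x"
      then obtain l where l: "(j, l) \<in> r" "(i, l) \<in> r" "t j l y = t i l x"
        by blast
      obtain m where m: "(k, m) \<in> r" "(l, m) \<in> r"
        using ub poset_carrier[OF order] jk l by metis
      have "t k m (t j k y) = t l m (t j l y)"
        using tt[OF jk m(1) y] tt[OF l(1) m(2) y] by simp
      also have "\<dots> = t i m x"
        using tt[OF l(2) m(2) x(1)] l(3) by simp
      finally show "\<exists>l. (k, l) \<in> r \<and> (i, l) \<in> r \<and> t k l (t j k y) = t i l x"
        using m poset_trans[OF order l(2) m(2)] by blast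
    qed
    then show ?thesis
      unfolding \<chi>_def by simp
  qed
  have "is_cocone (poset_cat I r) (set_cat U) E {x, x'} (\<lambda>j. (e j, \<lambda>y\<in>e j. \<chi> j y, {x, x'}))"
    unfolding is_cocone_def
  proof (intro conjI ballI)
    show "{x, x'} \<in> obj (set_cat U)"
      using smallM by (simp add: set_cat_def)
    show "(e j, \<lambda>y\<in>e j. \<chi> j y, {x, x'}) \<in> Hom (set_cat U) (fob E j) {x, x'}"
      if "j \<in> obj (poset_cat I r)" for j
      using that s(2)[of j] smallM fob by (auto simp: Hom_set_cat \<chi>_def)
    fix a assume a: "a \<in> arr (poset_cat I r)"
    obtain j k where jk: "a = (j, k)" "(j, k) \<in> r"
      using a by (cases a) auto
    have "compose (e j) (\<lambda>y\<in>e k. \<chi> k y) (t j k) = (\<lambda>y\<in>e j. \<chi> j y)"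
      using \<chi>[OF jk(2)] t[OF jk(2)] by (auto simp: compose_def fun_eq_iff)
    then show "cmp (set_cat U) (e (tgt (poset_cat I r) a), \<lambda>y\<in>e (tgt (poset_cat I r) a).
        \<chi> (tgt (poset_cat I r) a) y, {x, x'}) (far E a) =
      (e (src (poset_cat I r) a), \<lambda>y\<in>e (src (poset_cat I r) a). \<chi> (src (poset_cat I r) a) y, {x, x'})"
      using jk far by simp
  qed
  from colimit_factor[OF col this] obtain h where h: "h \<in> Hom (set_cat U) S {x, x'}"
    "\<And>j. j \<in> I \<Longrightarrow> cmp (set_cat U) h (\<sigma> j) = (e j, \<lambda>y\<in>e j. \<chi> j y, {x, x'})"
    by (metis obj_poset_cat)
  obtain h0 where h0: "h = (S, h0, {x, x'})"
    using h(1) by (auto simp: Hom_set_cat)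
  have h0s: "h0 (s i y) = \<chi> i y" if "y \<in> e i" for y
  proof -
    have "compose (e i) h0 (s i) = (\<lambda>y\<in>e i. \<chi> i y)"
      using h(2)[OF i] h0 leg[OF i] by simp
    then have "compose (e i) h0 (s i) y = (\<lambda>y\<in>e i. \<chi> i y) y"
      by simp
    then show ?thesis
      using that by (simp add: compose_def)
  qed
  have "\<chi> i x' = \<chi> i x"
    using h0s x eq by metis
  also have "\<chi> i x = x"
    using poset_refl[OF order i] unfolding \<chi>_def by auto
  finally have "\<exists>k. (i, k) \<in> r \<and> (i, k) \<in> r \<and> t i k x' = t i k x"
    using False unfolding \<chi>_def by (metis (full_types))
  then show ?thesis
    using that by metis
qed

text \<open>
  The hom-functor of \<open>A\<close> turns the directed colimit into a colimit of sets, to which the two preceding lemmas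
  apply. All later uses of presentability go through these two consequences.
\<close>

lemma
  assumes A: "presented U lam C A" and C: "category C" and col: "is_directed_colimit U lam C I r D L \<iota>"
  shows presented_factor: "f \<in> Hom C A L \<Longrightarrow> \<exists>i\<in>I. \<exists>h\<in>Hom C A (fob D i). f = cmp C (\<iota> i) h"
    and presented_eq: "infinite_regular_cardinal lam \<Longrightarrow> i \<in> I \<Longrightarrow> h \<in> Hom C A (fob D i) \<Longrightarrow>
      h' \<in> Hom C A (fob D i) \<Longrightarrow> cmp C (\<iota> i) h = cmp C (\<iota> i) h' \<Longrightarrow>
      \<exists>j. (i, j) \<in> r \<and> cmp C (far D (i, j)) h = cmp C (far D (i, j)) h'"
proof -
  let ?J = "poset_cat I r"
  let ?E = "comp_functor ?J (hom_functor C A) D"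
  let ?\<sigma> = "\<lambda>i. far (hom_functor C A) (\<iota> i)"
  let ?e = "\<lambda>i. Hom C A (fob D i)"
  let ?t = "\<lambda>i j. \<lambda>g\<in>?e i. cmp C (far D (i, j)) g"
  let ?s = "\<lambda>i. \<lambda>g\<in>?e i. cmp C (\<iota> i) g"
  note order = directed_colimit_order[OF col]
  note D = directed_colimit_functor[OF col]
  have L: "L \<in> obj C"
    using directed_colimit_obj[OF col] .
  have S: "fob (hom_functor C A) L = Hom C A L"
    using L by (simp add: hom_functor_def)
  have E: "is_colimit ?J (set_cat U) ?E (Hom C A L) ?\<sigma>"
    using A col S unfolding presented_def preserves_directed_colimits_def by metis
  have fob: "fob ?E i = ?e i" if "i \<in> I" for i
    using that system_obj[OF order D that] by (simp add: comp_functor_def hom_functor_def)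
  have far: "far ?E (i, j) = (?e i, ?t i j, ?e j)" if "(i, j) \<in> r" for i j
    using that HomD[OF system_Hom[OF order D that]] by (simp add: comp_functor_def hom_functor_def)
  have leg: "?\<sigma> i = (?e i, ?s i, Hom C A L)" if "i \<in> I" for i
    using HomD[OF directed_colimit_leg[OF col that]] by (simp add: hom_functor_def)
  show "\<exists>i\<in>I. \<exists>h\<in>Hom C A (fob D i). f = cmp C (\<iota> i) h" if f: "f \<in> Hom C A L"
  proof -
    obtain i y where "i \<in> I" "y \<in> ?e i" "f = ?s i y"
      by (rule set_cat_colimit_stage[where e = ?e and t = ?t and s = ?s, OF E fob far leg order f])
    then show ?thesis by auto
  qed
  show "\<exists>j. (i, j) \<in> r \<and> cmp C (far D (i, j)) h = cmp C (far D (i, j)) h'"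
    if lam: "infinite_regular_cardinal lam" and i: "i \<in> I" and h: "h \<in> ?e i" "h' \<in> ?e i"
      and eq: "cmp C (\<iota> i) h = cmp C (\<iota> i) h'"
  proof -
    have ub: "\<exists>k. (i, k) \<in> r \<and> (j, k) \<in> r" if "i \<in> I" "j \<in> I" for i j
      using directed_upper_bound[OF lam directed_colimit_directed[OF col] that] by metis
    have t: "?t i j y \<in> ?e j" if "(i, j) \<in> r" "y \<in> ?e i" for i j y
      using cmp_Hom[OF C that(2) system_Hom[OF order D that(1)]] that by simp
    have tt: "?t j k (?t i j y) = ?t i k y" if "(i, j) \<in> r" "(j, k) \<in> r" "y \<in> ?e i" for i j k y
    proof -
      have "?t i j y \<in> ?e j"
        by (rule t[OF that(1,3)])
      then show ?thesis
        using that cmp_assoc[OF C that(3) system_Hom[OF order D that(1)] system_Hom[OF order D that(2)]]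
          system_cmp[OF order D that(1,2)] by simp
    qed
    have eq': "?s i h = ?s i h'"
      using h eq by simp
    obtain j where "(i, j) \<in> r" "?t i j h = ?t i j h'"
      by (rule set_cat_colimit_eq[where e = ?e and t = ?t and s = ?s, OF E fob far leg order ub t tt i h eq'])
    then show ?thesis
      using h by auto
  qed
qed

section \<open>Products in a locally presentable category\<close>

text \<open>
  An object \<open>(A, a)\<close> is a cone over the family \<open>X\<close> with vertex \<open>A \<in> S\<close>. The legs are extensional functions so
  that the set of cones with a given vertex is small.
\<close>

definition cone_cat where
  "cone_cat C I X S = \<lparr>
     obj = Sigma S (\<lambda>A. \<Pi>\<^sub>E i\<in>I. Hom C A (X i)),
     arr = {(p, m, q). p \<in> Sigma S (\<lambda>A. \<Pi>\<^sub>E i\<in>I. Hom C A (X i)) \<and>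
                       q \<in> Sigma S (\<lambda>A. \<Pi>\<^sub>E i\<in>I. Hom C A (X i)) \<and>
                       m \<in> Hom C (fst p) (fst q) \<and> (\<forall>i\<in>I. cmp C (snd q i) m = snd p i)},
     src = fst, tgt = (\<lambda>(p, m, q). q), ident = (\<lambda>p. (p, ident C (fst p), p)),
     cmp = (\<lambda>(q, n, s) (p, m, q'). (p, cmp C n m, s))\<rparr>"

lemma Hom_cone_cat:
  "a \<in> Hom (cone_cat C I X S) p q \<longleftrightarrow>
     p \<in> obj (cone_cat C I X S) \<and> q \<in> obj (cone_cat C I X S) \<and>
     (\<exists>m. a = (p, m, q) \<and> m \<in> Hom C (fst p) (fst q) \<and> (\<forall>i\<in>I. cmp C (snd q i) m = snd p i))"
  by (auto simp: Hom_def cone_cat_def)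

text \<open>
  The colimit \<open>P\<close> of the vertices of all cones with vertex in \<open>S\<close>. The legs of these cones are compatible with
  the maps of cones, so they induce maps \<open>\<pi> i\<close> that turn \<open>P\<close> into a cone again.
\<close>

lemma cone_colimit:
  fixes C :: "('o, 'm) cat" and I :: "'i set"
  assumes U: "universe TYPE('u)" and C: "category C" and cocomp: "cocomplete TYPE('u) C"
    and ls: "locally_small TYPE('u) C"
    and S: "S \<subseteq> obj C" "small TYPE('u) S"
    and I: "small TYPE('u) I" and X: "\<forall>i\<in>I. X i \<in> obj C"
  obtains P \<kappa> \<pi> where "P \<in> obj C" "\<forall>i\<in>I. \<pi> i \<in> Hom C P (X i)"
    "\<forall>A\<in>S. \<forall>a\<in>(\<Pi>\<^sub>E i\<in>I. Hom C A (X i)).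
       \<kappa> (A, a) \<in> Hom C A P \<and> (\<forall>i\<in>I. cmp C (\<pi> i) (\<kappa> (A, a)) = a i)"
    "\<forall>A\<in>S. \<forall>a\<in>(\<Pi>\<^sub>E i\<in>I. Hom C A (X i)). \<forall>B\<in>S. \<forall>b\<in>(\<Pi>\<^sub>E i\<in>I. Hom C B (X i)).
       \<forall>m\<in>Hom C A B. (\<forall>i\<in>I. cmp C (b i) m = a i) \<longrightarrow> cmp C (\<kappa> (B, b)) m = \<kappa> (A, a)"
    "\<forall>M. \<forall>h\<in>Hom C P M. \<forall>h'\<in>Hom C P M.
       (\<forall>A\<in>S. \<forall>a\<in>(\<Pi>\<^sub>E i\<in>I. Hom C A (X i)). cmp C h (\<kappa> (A, a)) = cmp C h' (\<kappa> (A, a))) \<longrightarrow> h = h'"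
proof -
  let ?J = "cone_cat C I X S"
  have obj: "p \<in> obj ?J \<longleftrightarrow> fst p \<in> S \<and> snd p \<in> (\<Pi>\<^sub>E i\<in>I. Hom C (fst p) (X i))" for p
    by (cases p) (auto simp: cone_cat_def)
  have objC: "fst p \<in> obj C" if "p \<in> obj ?J" for p
    using that obj S(1) by blast
  have leg: "snd p i \<in> Hom C (fst p) (X i)" if "p \<in> obj ?J" "i \<in> I" for p i
    using that obj by blast
  have id: "ident ?J p = (p, ident C (fst p), p)" for p
    by (simp add: cone_cat_def)
  have comp: "cmp ?J (q', n, s) (p, m, q) = (p, cmp C n m, s)" for p q q' s m n
    by (simp add: cone_cat_def)
  have J: "category ?J"
    unfolding category_def
  proof (intro conjI ballI allI impI)
    fix f assume "f \<in> arr ?J"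
    then show "src ?J f \<in> obj ?J" "tgt ?J f \<in> obj ?J"
      using arr_Hom[of f ?J] by (auto simp: Hom_cone_cat)
  next
    fix p assume p: "p \<in> obj ?J"
    have "cmp C (snd p i) (ident C (fst p)) = snd p i" if "i \<in> I" for i
      using cmp_ident_right[OF C leg[OF p that]] .
    then show "ident ?J p \<in> Hom ?J p p"
      using p ident_Hom[OF C objC[OF p]] by (auto simp: Hom_cone_cat id)
  next
    fix p q s f g assume fg: "f \<in> Hom ?J p q" "g \<in> Hom ?J q s"
    obtain m where m: "f = (p, m, q)" "m \<in> Hom C (fst p) (fst q)" "\<forall>i\<in>I. cmp C (snd q i) m = snd p i"
      "p \<in> obj ?J"
      using fg(1) by (auto simp: Hom_cone_cat)
    obtain n where n: "g = (q, n, s)" "n \<in> Hom C (fst q) (fst s)" "\<forall>i\<in>I. cmp C (snd s i) n = snd q i"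
      "s \<in> obj ?J"
      using fg(2) by (auto simp: Hom_cone_cat)
    have "cmp C (snd s i) (cmp C n m) = snd p i" if "i \<in> I" for i
      using cmp_assoc[OF C m(2) n(2) leg[OF n(4) that]] m(3) n(3) that by simp
    then show "cmp ?J g f \<in> Hom ?J p s"
      using m n cmp_Hom[OF C m(2) n(2)] by (auto simp: Hom_cone_cat comp)
  next
    fix p q f assume "f \<in> Hom ?J p q"
    then obtain m where m: "f = (p, m, q)" "m \<in> Hom C (fst p) (fst q)"
      by (auto simp: Hom_cone_cat)
    show "cmp ?J f (ident ?J p) = f" "cmp ?J (ident ?J q) f = f"
      using m cmp_ident_right[OF C m(2)] cmp_ident_left[OF C m(2)] by (simp_all add: id comp)
  next
    fix p q s t f g h assume "f \<in> Hom ?J p q" "g \<in> Hom ?J q s" "h \<in> Hom ?J s t"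
    then obtain m n l where "f = (p, m, q)" "m \<in> Hom C (fst p) (fst q)"
      "g = (q, n, s)" "n \<in> Hom C (fst q) (fst s)" "h = (s, l, t)" "l \<in> Hom C (fst s) (fst t)"
      by (auto simp: Hom_cone_cat)
    then show "cmp ?J h (cmp ?J g f) = cmp ?J (cmp ?J h g) f"
      using cmp_assoc[OF C] by (auto simp: comp)
  qed
  define D where "D = \<lparr>fob = (\<lambda>p \<in> obj ?J. fst p), far = (\<lambda>a \<in> arr ?J. fst (snd a))\<rparr>"
  have farD: "far D (p, m, q) = m" if "(p, m, q) \<in> Hom ?J p q" for p m q
    using Hom_arr[OF that] by (simp add: D_def)
  have fobD: "fob D p = fst p" if "p \<in> obj ?J" for p
    using that by (simp add: D_def)
  have D: "is_functor ?J C D"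
    unfolding is_functor_def
  proof (intro conjI ballI allI impI)
    show "fob D \<in> obj ?J \<rightarrow>\<^sub>E obj C"
      using objC by (auto simp: D_def)
    show "far D \<in> arr ?J \<rightarrow>\<^sub>E arr C"
    proof -
      have "fst (snd a) \<in> arr C" if "a \<in> arr ?J" for a
        using that by (auto simp: cone_cat_def intro: Hom_arr)
      then show ?thesis by (simp add: D_def)
    qed
  next
    fix p q f assume f: "f \<in> Hom ?J p q"
    then obtain m where m: "f = (p, m, q)" "m \<in> Hom C (fst p) (fst q)" "p \<in> obj ?J" "q \<in> obj ?J"
      by (auto simp: Hom_cone_cat)
    show "far D f \<in> Hom C (fob D p) (fob D q)"
      using farD f m fobD by simp
  next
    fix p assume p: "p \<in> obj ?J"
    show "far D (ident ?J p) = ident C (fob D p)"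
      using farD ident_Hom[OF J p] fobD[OF p] by (simp add: id)
  next
    fix p q s f g assume fg: "f \<in> Hom ?J p q" "g \<in> Hom ?J q s"
    then obtain m n where m: "f = (p, m, q)" "g = (q, n, s)"
      by (auto simp: Hom_cone_cat)
    show "far D (cmp ?J g f) = cmp C (far D g) (far D f)"
      using cmp_Hom[OF J fg] fg farD m by (simp add: comp)
  qed
  have Hom_small: "small TYPE('u) (Hom C A B)" if "A \<in> obj C" "B \<in> obj C" for A B
    using ls that unfolding locally_small_def by blast
  have smallO: "small TYPE('u) (obj ?J)"
  proof -
    have "small TYPE('u) (Sigma S (\<lambda>A. \<Pi>\<^sub>E i\<in>I. Hom C A (X i)))"
      by (intro small_Sigma[OF U S(2)] small_PiE[OF U I] Hom_small) (use S(1) X in auto)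
    then show ?thesis by (simp add: cone_cat_def)
  qed
  have smallA: "small TYPE('u) (arr ?J)"
  proof (rule small_subset)
    show "small TYPE('u) (Sigma (obj ?J) (\<lambda>p. Sigma (\<Union>q\<in>obj ?J. Hom C (fst p) (fst q)) (\<lambda>_. obj ?J)))"
      by (intro small_Sigma[OF U] small_UN[OF U] smallO Hom_small objC)
    show "arr ?J \<subseteq> Sigma (obj ?J) (\<lambda>p. Sigma (\<Union>q\<in>obj ?J. Hom C (fst p) (fst q)) (\<lambda>_. obj ?J))"
      by (auto simp: cone_cat_def)
  qed
  obtain P \<kappa> where P: "is_colimit ?J C D P \<kappa>"
    using cocomplete_any_small_category[OF cocomp J smallO smallA D] .
  note coc = colimit_cocone[OF P]
  have \<pi>_ex: "\<exists>k. k \<in> Hom C P (X i) \<and> (\<forall>p\<in>obj ?J. cmp C k (\<kappa> p) = snd p i)" if i: "i \<in> I" for i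
  proof -
    have "is_cocone ?J C D (X i) (\<lambda>p. snd p i)"
      unfolding is_cocone_def
    proof (intro conjI ballI)
      show "X i \<in> obj C" using X i by blast
      show "snd p i \<in> Hom C (fob D p) (X i)" if "p \<in> obj ?J" for p
        using leg[OF that i] fobD[OF that] by simp
      fix a assume "a \<in> arr ?J"
      note a = arr_Hom[OF this]
      then obtain m where m: "a = (src ?J a, m, tgt ?J a)" "cmp C (snd (tgt ?J a) i) m = snd (src ?J a) i"
        unfolding Hom_cone_cat using i by blast
      have "(src ?J a, m, tgt ?J a) \<in> Hom ?J (src ?J a) (tgt ?J a)"
        using a m(1) by simp
      then have "far D a = m"
        using farD m(1) by metis
      then show "cmp C (snd (tgt ?J a) i) (far D a) = snd (src ?J a) i"
        using m by simp
    qed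
    from colimit_factor[OF P this] show ?thesis
      by metis
  qed
  then obtain \<pi> where \<pi>: "\<And>i. i \<in> I \<Longrightarrow> \<pi> i \<in> Hom C P (X i)"
    "\<And>i p. i \<in> I \<Longrightarrow> p \<in> obj ?J \<Longrightarrow> cmp C (\<pi> i) (\<kappa> p) = snd p i"
    by metis
  show thesis
  proof (intro that ballI allI impI)
    show "P \<in> obj C" using cocone_obj[OF coc] .
    show "\<pi> i \<in> Hom C P (X i)" if "i \<in> I" for i
      using \<pi>(1) that .
    show "\<kappa> (A, a) \<in> Hom C A P \<and> (\<forall>i\<in>I. cmp C (\<pi> i) (\<kappa> (A, a)) = a i)"
      if "A \<in> S" "a \<in> (\<Pi>\<^sub>E i\<in>I. Hom C A (X i))" for A a
    proof -
      have p: "(A, a) \<in> obj ?J" using that obj by simp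
      show ?thesis
        using cocone_Hom[OF coc p] \<pi>(2)[OF _ p] fobD[OF p] by simp
    qed
    show "cmp C (\<kappa> (B, b)) m = \<kappa> (A, a)"
      if "A \<in> S" "a \<in> (\<Pi>\<^sub>E i\<in>I. Hom C A (X i))" "B \<in> S" "b \<in> (\<Pi>\<^sub>E i\<in>I. Hom C B (X i))"
        "m \<in> Hom C A B" "\<forall>i\<in>I. cmp C (b i) m = a i" for A a B b m
    proof -
      have a: "((A, a), m, (B, b)) \<in> Hom ?J (A, a) (B, b)"
        using that by (simp add: Hom_cone_cat obj)
      show ?thesis
        using cocone_commute[OF coc a] farD[OF a] by simp
    qed
    show "h = h'"
      if "h \<in> Hom C P M" "h' \<in> Hom C P M"
        "\<forall>A\<in>S. \<forall>a\<in>(\<Pi>\<^sub>E i\<in>I. Hom C A (X i)). cmp C h (\<kappa> (A, a)) = cmp C h' (\<kappa> (A, a))"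
      for M h h'
    proof (rule colimit_unique[OF C J D P that(1,2)])
      fix p assume "p \<in> obj ?J"
      then show "cmp C h (\<kappa> p) = cmp C h' (\<kappa> p)"
        using that(3) obj[of p] by (metis prod.collapse)
    qed
  qed
qed

lemma presentable_generators:
  fixes C :: "('o, 'm) cat"
  assumes "locally_presentable TYPE('u) lam C"
  obtains G where "small TYPE('u) G" "\<forall>A\<in>G. presented TYPE('u) lam C A"
    "\<forall>T\<in>obj C. \<exists>(K :: 'u set) r D \<iota>.
       is_directed_colimit TYPE('u) lam C K r D T \<iota> \<and> fob D ` K \<subseteq> G"
proof -
  have "\<exists>G. small TYPE('u) G \<and> (\<forall>A\<in>G. presented TYPE('u) lam C A) \<and>
    (\<forall>T\<in>obj C. \<exists>(K :: 'u set) r D \<iota>.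
       is_directed_colimit TYPE('u) lam C K r D T \<iota> \<and> fob D ` K \<subseteq> G)"
    using assms unfolding locally_presentable_def by (elim conjE)
  then show thesis
  proof (elim exE conjE)
    fix G assume G: "small TYPE('u) G" "\<forall>A\<in>G. presented TYPE('u) lam C A"
      "\<forall>T\<in>obj C. \<exists>(K :: 'u set) r D \<iota>.
         is_directed_colimit TYPE('u) lam C K r D T \<iota> \<and> fob D ` K \<subseteq> G"
    show thesis
      by (rule that[OF G])
  qed
qed

text \<open>
  Let \<open>P\<close> be the colimit of all cones with vertex in the generating set \<open>G\<close>. A cone with vertex \<open>T\<close> maps to
  \<open>P\<close>, since \<open>T\<close> is a directed colimit of objects of \<open>G\<close>, each of which occurs in the diagram of \<open>P\<close>.
  If \<open>h, h' : T \<rightarrow> P\<close> have the same projections, take the colimit \<open>Q\<close> of all cones with vertex in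
  \<open>G \<union> {P, T}\<close>. Now \<open>h\<close> and \<open>h'\<close> are arrows of the diagram, so the leg \<open>q : P \<rightarrow> Q\<close> equalizes them; and \<open>q\<close>
  is a split monomorphism because \<open>Q\<close>, being a cone, maps back to \<open>P\<close> and the composite fixes
  all legs of \<open>P\<close>. Hence \<open>h = h'\<close>.
\<close>

lemma presentable_product_exists:
  fixes C :: "('o, 'm) cat" and I :: "'i set"
  assumes U: "universe TYPE('u)" and lp: "locally_presentable TYPE('u) lam C"
    and I: "small TYPE('u) I" and X: "\<forall>i\<in>I. X i \<in> obj C"
  obtains P \<pi> where "is_product C I X P \<pi>"
proof -
  have C: "category C" and ls: "locally_small TYPE('u) C" and cocomp: "cocomplete TYPE('u) C"
    using lp unfolding locally_presentable_def by blast+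
  obtain G where G: "small TYPE('u) G" "\<forall>A\<in>G. presented TYPE('u) lam C A"
    and gen: "\<forall>T\<in>obj C. \<exists>(K :: 'u set) r D \<iota>.
           is_directed_colimit TYPE('u) lam C K r D T \<iota> \<and> fob D ` K \<subseteq> G"
    using presentable_generators[OF lp] .
  have Gobj: "G \<subseteq> obj C"
    using G(2) unfolding presented_def by blast
  let ?cone = "\<lambda>A. \<Pi>\<^sub>E i\<in>I. Hom C A (X i)"
  obtain P \<kappa> \<pi> where P: "P \<in> obj C" and \<pi>': "\<forall>i\<in>I. \<pi> i \<in> Hom C P (X i)"
    and \<kappa>': "\<forall>A\<in>G. \<forall>a\<in>?cone A.
       \<kappa> (A, a) \<in> Hom C A P \<and> (\<forall>i\<in>I. cmp C (\<pi> i) (\<kappa> (A, a)) = a i)"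
    and \<kappa>_cmp': "\<forall>A\<in>G. \<forall>a\<in>?cone A. \<forall>B\<in>G. \<forall>b\<in>?cone B.
       \<forall>m\<in>Hom C A B. (\<forall>i\<in>I. cmp C (b i) m = a i) \<longrightarrow> cmp C (\<kappa> (B, b)) m = \<kappa> (A, a)"
    and P_unique: "\<forall>M. \<forall>h\<in>Hom C P M. \<forall>h'\<in>Hom C P M.
       (\<forall>A\<in>G. \<forall>a\<in>?cone A. cmp C h (\<kappa> (A, a)) = cmp C h' (\<kappa> (A, a))) \<longrightarrow> h = h'"
    using cone_colimit[OF U C cocomp ls Gobj G(1) I X] .
  note \<pi> = bspec[OF \<pi>'] and \<kappa> = bspec[OF bspec[OF \<kappa>']]
  have \<kappa>_cmp: "cmp C (\<kappa> (B, b)) m = \<kappa> (A, a)"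
    if "A \<in> G" "a \<in> ?cone A" "B \<in> G" "b \<in> ?cone B" "m \<in> Hom C A B"
      "\<And>i. i \<in> I \<Longrightarrow> cmp C (b i) m = a i" for A a B b m
    using \<kappa>_cmp' that by simp
  have cone_cmp: "(\<lambda>i\<in>I. cmp C (t i) m) \<in> ?cone A"
    if "\<And>i. i \<in> I \<Longrightarrow> t i \<in> Hom C T (X i)" "m \<in> Hom C A T" for T t m A
    using that cmp_Hom[OF C] by simp
  \<comment> \<open>The middle clause determines \<open>s\<close> on maps from generators. It holds because generators are
    presented, and it is what later shows that \<open>q\<close> splits.\<close>
  have mediate: "\<exists>s. s \<in> Hom C T P \<and>
      (\<forall>A\<in>G. \<forall>m\<in>Hom C A T. cmp C s m = \<kappa> (A, \<lambda>i\<in>I. cmp C (t i) m)) \<and>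
      (\<forall>i\<in>I. cmp C (\<pi> i) s = t i)"
    if T: "T \<in> obj C" and t: "\<And>i. i \<in> I \<Longrightarrow> t i \<in> Hom C T (X i)" for T t
  proof -
    obtain K :: "'u set" and r D \<iota> where K: "is_directed_colimit TYPE('u) lam C K r D T \<iota>" "fob D ` K \<subseteq> G"
      using bspec[OF gen T] by (elim exE conjE)
    note order = directed_colimit_order[OF K(1)]
    note D = directed_colimit_functor[OF K(1)]
    have DG: "fob D k \<in> G" if "k \<in> K" for k
      using K(2) that by blast
    have leg: "\<iota> k \<in> Hom C (fob D k) T" if "k \<in> K" for k
      using directed_colimit_leg[OF K(1) that] .
    let ?t = "\<lambda>k. \<lambda>i\<in>I. cmp C (t i) (\<iota> k)"
    have t_cone: "?t k \<in> ?cone (fob D k)" if "k \<in> K" for k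
      using cone_cmp[OF t leg[OF that]] .
    have "is_cocone (poset_cat K r) C D P (\<lambda>k. \<kappa> (fob D k, ?t k))"
      unfolding is_cocone_def
    proof (intro conjI ballI)
      show "P \<in> obj C" using P .
      show "\<kappa> (fob D k, ?t k) \<in> Hom C (fob D k) P" if "k \<in> obj (poset_cat K r)" for k
        using \<kappa>[OF DG t_cone] that by simp
      fix a assume a: "a \<in> arr (poset_cat K r)"
      obtain k l where kl: "a = (k, l)" "(k, l) \<in> r"
        using a by (cases a) auto
      have k: "k \<in> K" and l: "l \<in> K"
        using poset_carrier[OF order kl(2)] by auto
      have "cmp C (\<kappa> (fob D l, ?t l)) (far D (k, l)) = \<kappa> (fob D k, ?t k)"
      proof (rule \<kappa>_cmp[OF DG[OF k] t_cone[OF k] DG[OF l] t_cone[OF l] system_Hom[OF order D kl(2)]])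
        fix i assume i: "i \<in> I"
        show "cmp C (?t l i) (far D (k, l)) = ?t k i"
          using cmp_assoc[OF C system_Hom[OF order D kl(2)] leg[OF l] t[OF i]]
            directed_colimit_commute[OF K(1) kl(2)] i by simp
      qed
      then show "cmp C (\<kappa> (fob D (tgt (poset_cat K r) a), ?t (tgt (poset_cat K r) a))) (far D a) =
          \<kappa> (fob D (src (poset_cat K r) a), ?t (src (poset_cat K r) a))"
        using kl by simp
    qed
    from colimit_factor[OF directed_colimit_colimit[OF K(1)] this]
    obtain s where s: "s \<in> Hom C T P" "\<And>k. k \<in> K \<Longrightarrow> cmp C s (\<iota> k) = \<kappa> (fob D k, ?t k)"
      by (metis obj_poset_cat)
    have "cmp C s m = \<kappa> (A, \<lambda>i\<in>I. cmp C (t i) m)" if A: "A \<in> G" and m: "m \<in> Hom C A T" for A m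
    proof -
      obtain k m' where k: "k \<in> K" and m': "m' \<in> Hom C A (fob D k)" and mm': "m = cmp C (\<iota> k) m'"
        using presented_factor[OF bspec[OF G(2) A] C K(1) m] by blast
      have "cmp C (t i) (cmp C (\<iota> k) m') = cmp C (?t k i) m'" if "i \<in> I" for i
        using cmp_assoc[OF C m' leg[OF k] t[OF that]] that by simp
      then have "cmp C (\<kappa> (fob D k, ?t k)) m' = \<kappa> (A, \<lambda>i\<in>I. cmp C (t i) m)"
        using mm' by (intro \<kappa>_cmp[OF A cone_cmp[OF t m] DG[OF k] t_cone[OF k] m']) auto
      then show ?thesis
        using s(2)[OF k] cmp_assoc[OF C m' leg[OF k] s(1)] mm' by simp
    qed
    moreover have "cmp C (\<pi> i) s = t i" if i: "i \<in> I" for i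
    proof (rule directed_colimit_unique[OF C K(1) cmp_Hom[OF C s(1) \<pi>[OF i]] t[OF i]])
      fix k assume k: "k \<in> K"
      show "cmp C (cmp C (\<pi> i) s) (\<iota> k) = cmp C (t i) (\<iota> k)"
        using cmp_assoc[OF C leg[OF k] s(1) \<pi>[OF i]] s(2)[OF k] \<kappa>[OF DG[OF k] t_cone[OF k]] i by simp
    qed
    ultimately show ?thesis
      using s(1) by blast
  qed
  have unique: "h = h'"
    if h: "h \<in> Hom C T P" "h' \<in> Hom C T P" and eq: "\<And>i. i \<in> I \<Longrightarrow> cmp C (\<pi> i) h = cmp C (\<pi> i) h'" for T h h'
  proof -
    let ?S = "insert P (insert T G)"
    let ?\<pi> = "\<lambda>i\<in>I. \<pi> i" and ?t = "\<lambda>i\<in>I. cmp C (\<pi> i) h"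
    have T: "T \<in> obj C"
      using Hom_objD[OF C h(1)] by blast
    have "small TYPE('u) ({P, T} \<union> G)"
      by (intro small_Un[OF U] small_finite[OF U] G(1)) simp
    then have S: "?S \<subseteq> obj C" "small TYPE('u) ?S"
      using T P Gobj by auto
    obtain Q \<nu> \<rho> where Q: "Q \<in> obj C" and \<rho>': "\<forall>i\<in>I. \<rho> i \<in> Hom C Q (X i)"
      and \<nu>: "\<forall>A\<in>?S. \<forall>a\<in>?cone A.
         \<nu> (A, a) \<in> Hom C A Q \<and> (\<forall>i\<in>I. cmp C (\<rho> i) (\<nu> (A, a)) = a i)"
      and \<nu>_cmp: "\<forall>A\<in>?S. \<forall>a\<in>?cone A. \<forall>B\<in>?S. \<forall>b\<in>?cone B.
         \<forall>m\<in>Hom C A B. (\<forall>i\<in>I. cmp C (b i) m = a i) \<longrightarrow> cmp C (\<nu> (B, b)) m = \<nu> (A, a)"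
      using cone_colimit[OF U C cocomp ls S I X] .
    note \<rho> = bspec[OF \<rho>']
    have \<pi>_cone: "?\<pi> \<in> ?cone P" using \<pi> by simp
    have t_cone: "?t \<in> ?cone T" using cone_cmp[OF \<pi> h(1)] .
    define q where "q = \<nu> (P, ?\<pi>)"
    have q: "q \<in> Hom C P Q" and \<rho>q: "\<And>i. i \<in> I \<Longrightarrow> cmp C (\<rho> i) q = \<pi> i"
      using bspec[OF bspec[OF \<nu>] \<pi>_cone] unfolding q_def by auto
    have "cmp C q k = \<nu> (T, ?t)" if "k \<in> Hom C T P" "\<forall>i\<in>I. cmp C (\<pi> i) k = cmp C (\<pi> i) h" for k
      unfolding q_def using \<nu>_cmp \<pi>_cone t_cone that by simp
    then have "cmp C q h = \<nu> (T, ?t)" "cmp C q h' = \<nu> (T, ?t)"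
      using h eq by simp_all
    then have qh: "cmp C q h = cmp C q h'" by simp
    obtain s where s: "s \<in> Hom C Q P"
      and s\<kappa>: "\<And>A m. A \<in> G \<Longrightarrow> m \<in> Hom C A Q \<Longrightarrow> cmp C s m = \<kappa> (A, \<lambda>i\<in>I. cmp C (\<rho> i) m)"
      using mediate[OF Q \<rho>] by blast
    have "cmp C s q = ident C P"
    proof (rule P_unique[rule_format, OF cmp_Hom[OF C q s] ident_Hom[OF C P]])
      fix A a assume A: "A \<in> G" and a: "a \<in> ?cone A"
      have k: "\<kappa> (A, a) \<in> Hom C A P" "\<And>i. i \<in> I \<Longrightarrow> cmp C (\<pi> i) (\<kappa> (A, a)) = a i"
        using \<kappa>[OF A a] by auto
      have "cmp C (\<rho> i) (cmp C q (\<kappa> (A, a))) = a i" if "i \<in> I" for i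
        using cmp_assoc[OF C k(1) q \<rho>[OF that]] \<rho>q[OF that] k(2)[OF that] by simp
      then have "(\<lambda>i\<in>I. cmp C (\<rho> i) (cmp C q (\<kappa> (A, a)))) = a"
        using a by (auto simp: fun_eq_iff PiE_def extensional_def)
      then have "cmp C s (cmp C q (\<kappa> (A, a))) = \<kappa> (A, a)"
        using s\<kappa>[OF A cmp_Hom[OF C k(1) q]] by simp
      then show "cmp C (cmp C s q) (\<kappa> (A, a)) = cmp C (ident C P) (\<kappa> (A, a))"
        using cmp_assoc[OF C k(1) q s] cmp_ident_left[OF C k(1)] by simp
    qed
    then have "cmp C s (cmp C q h) = h" "cmp C s (cmp C q h') = h'"
      unfolding cmp_assoc[OF C h(1) q s] cmp_assoc[OF C h(2) q s]
      using cmp_ident_left[OF C h(1)] cmp_ident_left[OF C h(2)] by simp_all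
    then show ?thesis
      using qh by metis
  qed
  have "is_product C I X P \<pi>"
    unfolding is_product_def
  proof (intro conjI ballI allI impI)
    fix T t assume T: "T \<in> obj C" and t: "\<forall>i\<in>I. t i \<in> Hom C T (X i)"
    obtain s where "s \<in> Hom C T P" "\<forall>i\<in>I. cmp C (\<pi> i) s = t i"
      using mediate[OF T] t by blast
    then show "\<exists>!h. h \<in> Hom C T P \<and> (\<forall>i\<in>I. cmp C (\<pi> i) h = t i)"
      using unique by (intro ex1I[of _ s]) auto
  qed (use P \<pi> in auto)
  then show thesis by (rule that)
qed

lemma
  assumes "is_product C I X P \<pi>"
  shows product_obj: "P \<in> obj C"
    and product_proj: "i \<in> I \<Longrightarrow> \<pi> i \<in> Hom C P (X i)"
  using assms unfolding is_product_def by auto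

lemma product_ex1:
  assumes "is_product C I X P \<pi>" "T \<in> obj C" "\<And>i. i \<in> I \<Longrightarrow> t i \<in> Hom C T (X i)"
  shows "\<exists>!h. h \<in> Hom C T P \<and> (\<forall>i\<in>I. cmp C (\<pi> i) h = t i)"
  using assms unfolding is_product_def by simp

lemma product_pair:
  assumes "is_product C I X P \<pi>" "T \<in> obj C" "\<And>i. i \<in> I \<Longrightarrow> t i \<in> Hom C T (X i)"
  obtains h where "h \<in> Hom C T P" "\<And>i. i \<in> I \<Longrightarrow> cmp C (\<pi> i) h = t i"
  using product_ex1[OF assms] that by blast

lemma product_unique:
  assumes "category C" "is_product C I X P \<pi>" "h \<in> Hom C T P" "h' \<in> Hom C T P"
    "\<And>i. i \<in> I \<Longrightarrow> cmp C (\<pi> i) h = cmp C (\<pi> i) h'"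
  shows "h = h'"
proof -
  have "T \<in> obj C"
    using Hom_objD[OF assms(1,3)] by blast
  then have "\<exists>!k. k \<in> Hom C T P \<and> (\<forall>i\<in>I. cmp C (\<pi> i) k = cmp C (\<pi> i) h)"
    by (rule product_ex1[OF assms(2) _ cmp_Hom[OF assms(1,3) product_proj[OF assms(2)]]])
  then show ?thesis
    using assms(3-5) by metis
qed

text \<open>
  Closure under products refers to index sets in \<open>'u\<close>; here any small index set is reindexed by \<open>'u\<close>.
\<close>

lemma closed_under_products_small:
  fixes C :: "('o, 'm) cat" and I :: "'i set"
  assumes closed: "closed_under_products TYPE('u) C \<D>" and I: "small TYPE('u) I"
    and X: "\<And>i. i \<in> I \<Longrightarrow> X i \<in> \<D>" and P: "is_product C I X P \<pi>"
  shows "P \<in> \<D>"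
proof -
  obtain \<phi> :: "'i \<Rightarrow> 'u" where \<phi>: "inj_on \<phi> I"
    using small_embedding[OF I] .
  define \<phi>' where "\<phi>' = inv_into I \<phi>"
  have \<phi>': "\<phi>' (\<phi> i) = i" if "i \<in> I" for i
    using that \<phi> unfolding \<phi>'_def by simp
  have "is_product C (\<phi> ` I) (\<lambda>u. X (\<phi>' u)) P (\<lambda>u. \<pi> (\<phi>' u))"
    unfolding is_product_def
  proof (intro conjI ballI allI impI)
    fix T t assume T: "T \<in> obj C" and t: "\<forall>u\<in>\<phi> ` I. t u \<in> Hom C T (X (\<phi>' u))"
    have "\<exists>!h. h \<in> Hom C T P \<and> (\<forall>i\<in>I. cmp C (\<pi> i) h = t (\<phi> i))"
      using P T t \<phi>' unfolding is_product_def by simp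
    then show "\<exists>!h. h \<in> Hom C T P \<and> (\<forall>u\<in>\<phi> ` I. cmp C (\<pi> (\<phi>' u)) h = t u)"
      using \<phi>' by simp
  qed (use product_obj[OF P] product_proj[OF P] \<phi>' in auto)
  moreover have "(\<lambda>u. X (\<phi>' u)) ` \<phi> ` I \<subseteq> \<D>"
    using X \<phi>' by auto
  moreover have "small TYPE('u) (\<phi> ` I)"
    using small_image[OF I] .
  ultimately show ?thesis
    using closed unfolding closed_under_products_def by metis
qed

section \<open>Limits and colimits of abelian groups\<close>

lemma hom_eq_iff:
  assumes "f \<in> hom G H" "group G" "group H" "x \<in> carrier G" "y \<in> carrier G"
  shows "f x = f y \<longleftrightarrow> f (x \<otimes>\<^bsub>G\<^esub> inv\<^bsub>G\<^esub> y) = \<one>\<^bsub>H\<^esub>"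
proof -
  interpret group_hom G H f
    using assms by (simp add: group_hom_def group_hom_axioms_def)
  have "f (x \<otimes>\<^bsub>G\<^esub> inv\<^bsub>G\<^esub> y) = f x \<otimes>\<^bsub>H\<^esub> inv\<^bsub>H\<^esub> f y"
    using assms by simp
  moreover have "f x = f y \<longleftrightarrow> f x \<otimes>\<^bsub>H\<^esub> inv\<^bsub>H\<^esub> f y = \<one>\<^bsub>H\<^esub>"
  proof
    assume "f x \<otimes>\<^bsub>H\<^esub> inv\<^bsub>H\<^esub> f y = \<one>\<^bsub>H\<^esub>"
    then have "inv\<^bsub>H\<^esub> (inv\<^bsub>H\<^esub> f y) = f x"
      by (rule H.inv_equality) (simp_all add: assms)
    then show "f x = f y"
      using assms by simp
  qed (use assms in simp)
  ultimately show ?thesis by simp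
qed

lemma small_ab_groupD:
  assumes "small_ab_group G"
  shows "comm_group G" "group G" "small TYPE('u) (carrier (G :: 'u monoid))"
  using assms comm_group.axioms(2) unfolding small_ab_group_def by auto

definition ab_map :: "'u ab_arr \<Rightarrow> 'u \<Rightarrow> 'u" where
  "ab_map f = fst (snd f)"

definition ab_arrow :: "'u monoid \<Rightarrow> ('u \<Rightarrow> 'u) \<Rightarrow> 'u monoid \<Rightarrow> 'u ab_arr" where
  "ab_arrow G f H = (G, restrict f (carrier G), H)"

lemma Hom_Ab:
  "f \<in> Hom Ab G H \<longleftrightarrow> small_ab_group G \<and> small_ab_group H \<and> f = (G, ab_map f, H) \<and>
     ab_map f \<in> hom G H \<and> ab_map f \<in> extensional (carrier G)"
  by (cases f) (auto simp: Hom_def Ab_def ab_map_def)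

lemma obj_Ab [simp]: "G \<in> obj Ab \<longleftrightarrow> small_ab_group G"
  by (simp add: Ab_def)

lemma
  assumes "f \<in> Hom Ab G H"
  shows ab_map_hom: "ab_map f \<in> hom G H"
    and ab_map_closed: "x \<in> carrier G \<Longrightarrow> ab_map f x \<in> carrier H"
    and ab_map_mult: "x \<in> carrier G \<Longrightarrow> y \<in> carrier G \<Longrightarrow>
          ab_map f (x \<otimes>\<^bsub>G\<^esub> y) = ab_map f x \<otimes>\<^bsub>H\<^esub> ab_map f y"
    and ab_map_one: "ab_map f \<one>\<^bsub>G\<^esub> = \<one>\<^bsub>H\<^esub>"
    and Hom_Ab_dom: "small_ab_group G" and Hom_Ab_cod: "small_ab_group H"
proof -
  show *: "ab_map f \<in> hom G H" "small_ab_group G" "small_ab_group H"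
    using assms by (simp_all add: Hom_Ab)
  show "x \<in> carrier G \<Longrightarrow> ab_map f x \<in> carrier H"
    using *(1) by (rule hom_in_carrier)
  show "x \<in> carrier G \<Longrightarrow> y \<in> carrier G \<Longrightarrow> ab_map f (x \<otimes>\<^bsub>G\<^esub> y) = ab_map f x \<otimes>\<^bsub>H\<^esub> ab_map f y"
    using *(1) by (rule hom_mult)
  show "ab_map f \<one>\<^bsub>G\<^esub> = \<one>\<^bsub>H\<^esub>"
    using hom_one[OF *(1)] small_ab_groupD(2) * by blast
qed

lemma Hom_Ab_eqI:
  assumes "f \<in> Hom Ab G H" "g \<in> Hom Ab G H"
    and "\<And>x. x \<in> carrier G \<Longrightarrow> ab_map f x = ab_map g x"
  shows "f = g"
proof -
  have "ab_map f = ab_map g"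
    using assms by (intro extensionalityI[of _ "carrier G"]) (auto simp: Hom_Ab)
  then show ?thesis
    using assms(1,2) unfolding Hom_Ab by metis
qed

lemma ab_arrow_Hom:
  assumes "small_ab_group G" "small_ab_group H" "f \<in> hom G H"
  shows "ab_arrow G f H \<in> Hom Ab G H"
proof -
  have "restrict f (carrier G) \<in> hom G H"
    using assms(3) group.hom_restrict[OF small_ab_groupD(2)[OF assms(1)]] by force
  then show ?thesis
    using assms by (simp add: Hom_Ab ab_arrow_def ab_map_def)
qed

lemma ab_map_arrow [simp]: "x \<in> carrier G \<Longrightarrow> ab_map (ab_arrow G f H) x = f x"
  by (simp add: ab_arrow_def ab_map_def)

lemma ab_map_ident [simp]: "x \<in> carrier G \<Longrightarrow> ab_map (ident Ab G) x = x"
  by (simp add: Ab_def ab_map_def)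

lemma
  assumes "f \<in> Hom Ab G H" "g \<in> Hom Ab H K"
  shows cmp_Ab_Hom: "cmp Ab g f \<in> Hom Ab G K"
    and ab_map_cmp: "x \<in> carrier G \<Longrightarrow> ab_map (cmp Ab g f) x = ab_map g (ab_map f x)"
proof -
  have c: "cmp Ab g f = (G, compose (carrier G) (ab_map g) (ab_map f), K)"
  proof -
    have "f = (G, ab_map f, H)" "g = (H, ab_map g, K)"
      using assms Hom_Ab by blast+
    then have "cmp Ab g f = cmp Ab (H, ab_map g, K) (G, ab_map f, H)"
      by argo
    then show ?thesis
      by (simp add: Ab_def)
  qed
  have "compose (carrier G) (ab_map g) (ab_map f) \<in> hom G K"
    using ab_map_closed[OF assms(1)] ab_map_closed[OF assms(2)]
      ab_map_mult[OF assms(1)] ab_map_mult[OF assms(2)]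
      group.is_monoid[OF small_ab_groupD(2)[OF Hom_Ab_dom[OF assms(1)]]]
    by (auto simp: hom_def compose_def monoid.m_closed)
  then show "cmp Ab g f \<in> Hom Ab G K"
    using assms c by (simp add: Hom_Ab ab_map_def)
  show "x \<in> carrier G \<Longrightarrow> ab_map (cmp Ab g f) x = ab_map g (ab_map f x)"
    by (simp add: c) (simp add: ab_map_def compose_def)
qed

lemma ident_Ab_Hom: "small_ab_group G \<Longrightarrow> ident Ab G \<in> Hom Ab G G"
  by (auto simp: Hom_Ab) (auto simp: Ab_def ab_map_def hom_def dest!: small_ab_groupD(2) intro: group.subgroup_self
      monoid.m_closed[OF group.is_monoid])

lemma category_Ab: "category Ab"
  unfolding category_def
proof (intro conjI ballI allI impI)
  fix f :: "'u ab_arr" assume "f \<in> arr Ab"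
  note f = arr_Hom[OF this]
  show "src Ab f \<in> obj Ab" "tgt Ab f \<in> obj Ab"
    using Hom_Ab_dom[OF f] Hom_Ab_cod[OF f] by simp_all
next
  fix A :: "'u monoid" assume "A \<in> obj Ab"
  then show "ident Ab A \<in> Hom Ab A A"
    using ident_Ab_Hom by simp
next
  fix A B E and f g :: "'u ab_arr" assume "f \<in> Hom Ab A B" "g \<in> Hom Ab B E"
  then show "cmp Ab g f \<in> Hom Ab A E"
    by (rule cmp_Ab_Hom)
next
  fix A B and f :: "'u ab_arr" assume f: "f \<in> Hom Ab A B"
  note A = ident_Ab_Hom[OF Hom_Ab_dom[OF f]] and B = ident_Ab_Hom[OF Hom_Ab_cod[OF f]]
  show "cmp Ab f (ident Ab A) = f"
    by (rule Hom_Ab_eqI[OF cmp_Ab_Hom[OF A f] f]) (simp add: ab_map_cmp[OF A f])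
  show "cmp Ab (ident Ab B) f = f"
    by (rule Hom_Ab_eqI[OF cmp_Ab_Hom[OF f B] f]) (simp add: ab_map_cmp[OF f B] ab_map_closed[OF f])
next
  fix A B E H and f g h :: "'u ab_arr"
  assume f: "f \<in> Hom Ab A B" and g: "g \<in> Hom Ab B E" and h: "h \<in> Hom Ab E H"
  note gf = cmp_Ab_Hom[OF f g] and hg = cmp_Ab_Hom[OF g h]
  show "cmp Ab h (cmp Ab g f) = cmp Ab (cmp Ab h g) f"
    by (rule Hom_Ab_eqI[OF cmp_Ab_Hom[OF gf h] cmp_Ab_Hom[OF f hg]])
      (simp add: ab_map_cmp[OF gf h] ab_map_cmp[OF f g] ab_map_cmp[OF f hg] ab_map_cmp[OF g h]
        ab_map_closed[OF f])
qed

text \<open>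
  A quotient of a small group is again small, hence isomorphic to a group whose elements are drawn from \<open>'u\<close>.
  This produces objects of \<open>Ab\<close> both from hom-groups of \<open>C\<close> and from product groups.
\<close>

lemma small_quotient_group:
  fixes H :: "('a, 'b) monoid_scheme"
  assumes H: "comm_group H" and small: "small TYPE('u) (carrier H)" and N: "subgroup N H"
  obtains Q :: "'u monoid" and q where "small_ab_group Q" "q \<in> hom H Q"
    "q ` carrier H = carrier Q" "\<forall>x\<in>carrier H. q x = \<one>\<^bsub>Q\<^esub> \<longleftrightarrow> x \<in> N"
proof -
  interpret H: comm_group H by (rule H)
  have normal: "N \<lhd> H"
    using N by (simp add: H.normal_iff_subgroup)
  interpret R: comm_group "H Mod N"
    using H.abelian_FactGroup[OF N] .
  let ?c = "\<lambda>x. N #>\<^bsub>H\<^esub> x"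
  have c: "?c \<in> hom H (H Mod N)"
    using normal.r_coset_hom_Mod[OF normal] .
  have carrier: "carrier (H Mod N) = ?c ` carrier H"
    by (rule carrier_FactGroup)
  then have "small TYPE('u) (carrier (H Mod N))"
    using small_image[OF small] by simp
  then obtain \<phi> :: "'a set \<Rightarrow> 'u" where \<phi>: "inj_on \<phi> (carrier (H Mod N))"
    using small_embedding by metis
  define \<phi>' where "\<phi>' = inv_into (carrier (H Mod N)) \<phi>"
  have \<phi>'[simp]: "\<phi>' (\<phi> x) = x" if "x \<in> carrier (H Mod N)" for x
    using that \<phi> unfolding \<phi>'_def by simp
  define Q :: "'u monoid" where "Q = \<lparr>carrier = \<phi> ` carrier (H Mod N),
    mult = (\<lambda>a b. \<phi> (\<phi>' a \<otimes>\<^bsub>H Mod N\<^esub> \<phi>' b)), one = \<phi> \<one>\<^bsub>H Mod N\<^esub>\<rparr>"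
  have carrierQ: "carrier Q = \<phi> ` carrier (H Mod N)" and oneQ: "\<one>\<^bsub>Q\<^esub> = \<phi> \<one>\<^bsub>H Mod N\<^esub>"
    by (simp_all add: Q_def)
  have multQ: "\<phi> x \<otimes>\<^bsub>Q\<^esub> \<phi> y = \<phi> (x \<otimes>\<^bsub>H Mod N\<^esub> y)"
    if "x \<in> carrier (H Mod N)" "y \<in> carrier (H Mod N)" for x y
    using \<phi>'[OF that(1)] \<phi>'[OF that(2)] by (simp add: Q_def del: mult_FactGroup)
  have "comm_group Q"
  proof (rule comm_groupI)
    fix x y assume "x \<in> carrier Q" "y \<in> carrier Q"
    then obtain a b where ab: "x = \<phi> a" "y = \<phi> b" "a \<in> carrier (H Mod N)" "b \<in> carrier (H Mod N)"
      unfolding carrierQ by blast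
    then show "x \<otimes>\<^bsub>Q\<^esub> y \<in> carrier Q"
      using multQ[OF ab(3,4)] R.m_closed[OF ab(3,4)] unfolding carrierQ by simp
    show "x \<otimes>\<^bsub>Q\<^esub> y = y \<otimes>\<^bsub>Q\<^esub> x"
      using multQ[OF ab(3,4)] multQ[OF ab(4,3)] R.m_comm[OF ab(3,4)] ab by simp
  next
    show "\<one>\<^bsub>Q\<^esub> \<in> carrier Q"
      unfolding carrierQ oneQ using R.one_closed by blast
  next
    fix x y z assume "x \<in> carrier Q" "y \<in> carrier Q" "z \<in> carrier Q"
    then obtain a b d where ab: "x = \<phi> a" "y = \<phi> b" "z = \<phi> d" "a \<in> carrier (H Mod N)"
      "b \<in> carrier (H Mod N)" "d \<in> carrier (H Mod N)"
      unfolding carrierQ by blast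
    have "\<phi> a \<otimes>\<^bsub>Q\<^esub> \<phi> b \<otimes>\<^bsub>Q\<^esub> \<phi> d = \<phi> ((a \<otimes>\<^bsub>H Mod N\<^esub> b) \<otimes>\<^bsub>H Mod N\<^esub> d)"
      unfolding multQ[OF ab(4,5)] multQ[OF R.m_closed[OF ab(4,5)] ab(6)] ..
    also have "\<dots> = \<phi> (a \<otimes>\<^bsub>H Mod N\<^esub> (b \<otimes>\<^bsub>H Mod N\<^esub> d))"
      using R.m_assoc[OF ab(4-6)] by simp
    also have "\<dots> = \<phi> a \<otimes>\<^bsub>Q\<^esub> (\<phi> b \<otimes>\<^bsub>Q\<^esub> \<phi> d)"
      unfolding multQ[OF ab(5,6)] multQ[OF ab(4) R.m_closed[OF ab(5,6)]] ..
    finally show "x \<otimes>\<^bsub>Q\<^esub> y \<otimes>\<^bsub>Q\<^esub> z = x \<otimes>\<^bsub>Q\<^esub> (y \<otimes>\<^bsub>Q\<^esub> z)"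
      using ab by simp
  next
    fix x assume "x \<in> carrier Q"
    then obtain a where a: "x = \<phi> a" "a \<in> carrier (H Mod N)"
      unfolding carrierQ by blast
    show "\<one>\<^bsub>Q\<^esub> \<otimes>\<^bsub>Q\<^esub> x = x"
      unfolding oneQ a(1) multQ[OF R.one_closed a(2)] R.l_one[OF a(2)] ..
    have "\<phi> (inv\<^bsub>H Mod N\<^esub> a) \<otimes>\<^bsub>Q\<^esub> x = \<one>\<^bsub>Q\<^esub>"
      unfolding oneQ a(1) multQ[OF R.inv_closed[OF a(2)] a(2)] R.l_inv[OF a(2)] ..
    moreover have "\<phi> (inv\<^bsub>H Mod N\<^esub> a) \<in> carrier Q"
      unfolding carrierQ using R.inv_closed[OF a(2)] by blast
    ultimately show "\<exists>y\<in>carrier Q. y \<otimes>\<^bsub>Q\<^esub> x = \<one>\<^bsub>Q\<^esub>"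
      by blast
  qed
  moreover have "small TYPE('u) (carrier Q)"
    unfolding carrierQ carrier by (intro small_image small)
  ultimately have Q: "small_ab_group Q"
    by (simp add: small_ab_group_def)
  have cc: "?c x \<in> carrier (H Mod N)" if "x \<in> carrier H" for x
    using hom_in_carrier[OF c that] .
  have hom: "(\<lambda>x. \<phi> (?c x)) \<in> hom H Q"
  proof (rule homI)
    show "\<phi> (?c x) \<in> carrier Q" if "x \<in> carrier H" for x
      unfolding carrierQ using cc[OF that] by blast
    show "\<phi> (?c (x \<otimes>\<^bsub>H\<^esub> y)) = \<phi> (?c x) \<otimes>\<^bsub>Q\<^esub> \<phi> (?c y)" if "x \<in> carrier H" "y \<in> carrier H" for x y
      unfolding multQ[OF cc[OF that(1)] cc[OF that(2)]] hom_mult[OF c that] ..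
  qed
  have im: "(\<lambda>x. \<phi> (?c x)) ` carrier H = carrier Q"
    unfolding carrierQ carrier by (simp add: image_image)
  have ker: "\<forall>x\<in>carrier H. \<phi> (?c x) = \<one>\<^bsub>Q\<^esub> \<longleftrightarrow> x \<in> N"
  proof
    fix x assume x: "x \<in> carrier H"
    have "\<phi> (?c x) = \<one>\<^bsub>Q\<^esub> \<longleftrightarrow> ?c x = \<one>\<^bsub>H Mod N\<^esub>"
      unfolding oneQ using inj_on_eq_iff[OF \<phi> cc[OF x] R.one_closed] .
    also have "\<dots> \<longleftrightarrow> ?c x = N"
      by simp
    also have "\<dots> \<longleftrightarrow> x \<in> N"
      using H.coset_join1[OF _ x N] H.coset_join2[OF x N] by blast
    finally show "\<phi> (?c x) = \<one>\<^bsub>Q\<^esub> \<longleftrightarrow> x \<in> N" .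
  qed
  show thesis
    by (rule that[OF Q hom im ker])
qed

text \<open>
  Joint surjectivity of the projections provides a mediating function elementwise; joint injectivity makes
  it additive and unique.
\<close>

lemma is_product_AbI:
  assumes P: "small_ab_group P" and \<pi>: "\<And>i. i \<in> I \<Longrightarrow> \<pi> i \<in> Hom Ab P (X i)"
    and inj: "\<And>x. x \<in> carrier P \<Longrightarrow> (\<And>i. i \<in> I \<Longrightarrow> ab_map (\<pi> i) x = \<one>\<^bsub>X i\<^esub>) \<Longrightarrow> x = \<one>\<^bsub>P\<^esub>"
    and surj: "\<And>y. (\<And>i. i \<in> I \<Longrightarrow> y i \<in> carrier (X i)) \<Longrightarrow>
      \<exists>x\<in>carrier P. \<forall>i\<in>I. ab_map (\<pi> i) x = y i"
  shows "is_product Ab I X P \<pi>"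
proof -
  note gP = small_ab_groupD(2)[OF P]
  interpret P: group P by (rule gP)
  have inj': "x = y" if x: "x \<in> carrier P" "y \<in> carrier P"
    and eq: "\<And>i. i \<in> I \<Longrightarrow> ab_map (\<pi> i) x = ab_map (\<pi> i) y" for x y
  proof -
    have "x \<otimes>\<^bsub>P\<^esub> inv\<^bsub>P\<^esub> y = \<one>\<^bsub>P\<^esub>"
    proof (rule inj)
      fix i assume i: "i \<in> I"
      show "ab_map (\<pi> i) (x \<otimes>\<^bsub>P\<^esub> inv\<^bsub>P\<^esub> y) = \<one>\<^bsub>X i\<^esub>"
        using hom_eq_iff[OF ab_map_hom[OF \<pi>[OF i]] gP small_ab_groupD(2)[OF Hom_Ab_cod[OF \<pi>[OF i]]] x]
          eq[OF i] by simp
    qed (use x in simp)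
    then show ?thesis
      using hom_eq_iff[of "\<lambda>x. x", OF _ gP gP x] by (simp add: hom_def)
  qed
  show ?thesis
    unfolding is_product_def
  proof (intro conjI ballI allI impI)
    show "P \<in> obj Ab" using P by simp
    show "\<pi> i \<in> Hom Ab P (X i)" if "i \<in> I" for i using \<pi>[OF that] .
    fix T t assume T: "T \<in> obj Ab" and t': "\<forall>i\<in>I. t i \<in> Hom Ab T (X i)"
    then have T: "small_ab_group T" and t: "\<And>i. i \<in> I \<Longrightarrow> t i \<in> Hom Ab T (X i)" by auto
    interpret T: group T by (rule small_ab_groupD(2)[OF T])
    have "\<exists>x. x \<in> carrier P \<and> (\<forall>i\<in>I. ab_map (\<pi> i) x = ab_map (t i) s)" if "s \<in> carrier T" for s
      using surj[of "\<lambda>i. ab_map (t i) s"] ab_map_closed[OF t that] by auto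
    then obtain h where h: "\<And>s. s \<in> carrier T \<Longrightarrow> h s \<in> carrier P"
      "\<And>s i. s \<in> carrier T \<Longrightarrow> i \<in> I \<Longrightarrow> ab_map (\<pi> i) (h s) = ab_map (t i) s"
      by metis
    have "h \<in> hom T P"
    proof (rule homI)
      fix s s' assume s: "s \<in> carrier T" "s' \<in> carrier T"
      show "h (s \<otimes>\<^bsub>T\<^esub> s') = h s \<otimes>\<^bsub>P\<^esub> h s'"
        by (rule inj') (use s h ab_map_mult[OF \<pi>] ab_map_mult[OF t] in simp_all)
    qed (rule h(1))
    note H = ab_arrow_Hom[OF T P this]
    show "\<exists>!k. k \<in> Hom Ab T P \<and> (\<forall>i\<in>I. cmp Ab (\<pi> i) k = t i)"
    proof (rule ex1I[of _ "ab_arrow T h P"])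
      have "cmp Ab (\<pi> i) (ab_arrow T h P) = t i" if i: "i \<in> I" for i
        by (rule Hom_Ab_eqI[OF cmp_Ab_Hom[OF H \<pi>[OF i]] t[OF i]])
          (simp add: ab_map_cmp[OF H \<pi>[OF i]] h i)
      then show "ab_arrow T h P \<in> Hom Ab T P \<and> (\<forall>i\<in>I. cmp Ab (\<pi> i) (ab_arrow T h P) = t i)"
        using H by blast
      fix k assume k: "k \<in> Hom Ab T P \<and> (\<forall>i\<in>I. cmp Ab (\<pi> i) k = t i)"
      then have kH: "k \<in> Hom Ab T P" by blast
      show "k = ab_arrow T h P"
      proof (rule Hom_Ab_eqI[OF kH H], rule inj')
        fix s assume s: "s \<in> carrier T"
        show "ab_map k s \<in> carrier P" "ab_map (ab_arrow T h P) s \<in> carrier P"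
          using ab_map_closed[OF kH s] ab_map_closed[OF H s] by simp_all
        fix i assume i: "i \<in> I"
        have "ab_map (\<pi> i) (ab_map k s) = ab_map (t i) s"
          using ab_map_cmp[OF kH \<pi>[OF i] s] k i by simp
        then show "ab_map (\<pi> i) (ab_map k s) = ab_map (\<pi> i) (ab_map (ab_arrow T h P) s)"
          using h(2)[OF s i] s by simp
      qed
    qed
  qed
qed

lemma product_Ab_trivial:
  assumes P: "is_product Ab I X P \<pi>" and X: "\<And>i. i \<in> I \<Longrightarrow> trivial_group (X i)"
  shows "trivial_group P"
proof -
  have sP: "small_ab_group P"
    using product_obj[OF P] by simp
  interpret group P by (rule small_ab_groupD(2)[OF sP])
  have "(\<lambda>_. \<one>\<^bsub>P\<^esub>) \<in> hom P P"
    by (auto simp: hom_def)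
  note z = ab_arrow_Hom[OF sP sP this]
  note id = ident_Ab_Hom[OF sP]
  have "ident Ab P = ab_arrow P (\<lambda>_. \<one>\<^bsub>P\<^esub>) P"
  proof (rule product_unique[OF category_Ab P id z])
    fix i assume i: "i \<in> I"
    note \<pi> = product_proj[OF P i]
    have triv: "x = y" if "x \<in> carrier (X i)" "y \<in> carrier (X i)" for x y
      using that X[OF i] by (auto simp: trivial_group_def)
    show "cmp Ab (\<pi> i) (ident Ab P) = cmp Ab (\<pi> i) (ab_arrow P (\<lambda>_. \<one>\<^bsub>P\<^esub>) P)"
      by (rule Hom_Ab_eqI[OF cmp_Ab_Hom[OF id \<pi>] cmp_Ab_Hom[OF z \<pi>]])
        (intro triv ab_map_closed[OF cmp_Ab_Hom[OF id \<pi>]] ab_map_closed[OF cmp_Ab_Hom[OF z \<pi>]])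
  qed
  then have "x = \<one>\<^bsub>P\<^esub>" if "x \<in> carrier P" for x
    using that ab_map_ident[OF that] ab_map_arrow[OF that, of "\<lambda>_. \<one>\<^bsub>P\<^esub>" P] by simp
  then show ?thesis
    using trivial_group_subset by blast
qed

locale ab_system =
  fixes I :: "'u set" and r and E :: "('u, 'u \<times> 'u, 'u monoid, 'u ab_arr) func"
  assumes order: "partial_order_on I r"
    and nonempty: "I \<noteq> {}"
    and upper_bound: "\<And>i j. i \<in> I \<Longrightarrow> j \<in> I \<Longrightarrow> \<exists>k. (i, k) \<in> r \<and> (j, k) \<in> r"
    and is_system: "is_functor (poset_cat I r) Ab E"
begin

abbreviation G where "G i \<equiv> fob E i"
abbreviation t where "t i j \<equiv> ab_map (far E (i, j))"

lemmas in_I = poset_carrier[OF order]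

lemma tr: "(i, j) \<in> r \<Longrightarrow> far E (i, j) \<in> Hom Ab (G i) (G j)"
  by (rule system_Hom[OF order is_system])

lemma G: "i \<in> I \<Longrightarrow> small_ab_group (G i)"
  using system_obj[OF order is_system] by simp

lemmas gG = small_ab_groupD(2)[OF G]

lemma t_closed: "(i, j) \<in> r \<Longrightarrow> x \<in> carrier (G i) \<Longrightarrow> t i j x \<in> carrier (G j)"
  by (rule ab_map_closed[OF tr])

lemma t_t: "(i, j) \<in> r \<Longrightarrow> (j, k) \<in> r \<Longrightarrow> x \<in> carrier (G i) \<Longrightarrow> t j k (t i j x) = t i k x"
  using ab_map_cmp[OF tr tr] system_cmp[OF order is_system] by simp

lemma cocone_t:
  assumes "is_cocone (poset_cat I r) Ab E L \<iota>" "(i, j) \<in> r" "x \<in> carrier (G i)"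
  shows "ab_map (\<iota> j) (t i j x) = ab_map (\<iota> i) x"
proof -
  have "\<iota> j \<in> Hom Ab (G j) L"
    using cocone_Hom[OF assms(1)] in_I[OF assms(2)] by simp
  moreover have "cmp Ab (\<iota> j) (far E (i, j)) = \<iota> i"
    using cocone_commute[OF assms(1)] assms(2) by (simp add: Hom_poset_cat)
  ultimately show ?thesis
    using ab_map_cmp[OF tr[OF assms(2)] _ assms(3)] by metis
qed

text \<open>
  A map out of \<open>L\<close> is defined on an element by choosing a stage from which the element comes. The kernel
  condition, applied to differences at a common stage, makes the value independent of the choice.
\<close>

lemma is_colimit_AbI:
  assumes coc: "is_cocone (poset_cat I r) Ab E L \<iota>"
    and surj: "\<And>x. x \<in> carrier L \<Longrightarrow> \<exists>i\<in>I. \<exists>y\<in>carrier (G i). x = ab_map (\<iota> i) y"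
    and ker: "\<And>i y. i \<in> I \<Longrightarrow> y \<in> carrier (G i) \<Longrightarrow> ab_map (\<iota> i) y = \<one>\<^bsub>L\<^esub> \<Longrightarrow>
      \<exists>j. (i, j) \<in> r \<and> t i j y = \<one>\<^bsub>G j\<^esub>"
  shows "is_colimit (poset_cat I r) Ab E L \<iota>"
  unfolding is_colimit_def
proof (intro conjI allI impI)
  show "is_cocone (poset_cat I r) Ab E L \<iota>" by (rule coc)
  fix M \<kappa> assume coM: "is_cocone (poset_cat I r) Ab E M \<kappa>"
  have L: "small_ab_group L" and M: "small_ab_group M"
    using cocone_obj[OF coc] cocone_obj[OF coM] by simp_all
  note gL = small_ab_groupD(2)[OF L] and gM = small_ab_groupD(2)[OF M]
  have \<iota>: "\<iota> i \<in> Hom Ab (G i) L" and \<kappa>: "\<kappa> i \<in> Hom Ab (G i) M" if "i \<in> I" for i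
    using cocone_Hom[OF coc] cocone_Hom[OF coM] that by simp_all
  have one_stage: "ab_map (\<kappa> i) y = ab_map (\<kappa> i) z"
    if i: "i \<in> I" and y: "y \<in> carrier (G i)" and z: "z \<in> carrier (G i)"
      and eq: "ab_map (\<iota> i) y = ab_map (\<iota> i) z" for i y z
  proof -
    let ?w = "y \<otimes>\<^bsub>G i\<^esub> inv\<^bsub>G i\<^esub> z"
    interpret Gi: group "G i" by (rule gG[OF i])
    have w: "?w \<in> carrier (G i)" using y z by simp
    have "ab_map (\<iota> i) ?w = \<one>\<^bsub>L\<^esub>"
      using hom_eq_iff[OF ab_map_hom[OF \<iota>[OF i]] gG[OF i] gL y z] eq by simp
    then obtain j where j: "(i, j) \<in> r" "t i j ?w = \<one>\<^bsub>G j\<^esub>"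
      using ker[OF i w] by blast
    have "ab_map (\<kappa> i) ?w = ab_map (\<kappa> j) \<one>\<^bsub>G j\<^esub>"
      using cocone_t[OF coM j(1) w] j(2) by simp
    also have "\<dots> = \<one>\<^bsub>M\<^esub>"
      using ab_map_one[OF \<kappa>] in_I[OF j(1)] by simp
    finally show ?thesis
      using hom_eq_iff[OF ab_map_hom[OF \<kappa>[OF i]] gG[OF i] gM y z] by simp
  qed
  have welldef: "ab_map (\<kappa> i) y = ab_map (\<kappa> j) z"
    if i: "i \<in> I" and j: "j \<in> I" and y: "y \<in> carrier (G i)" and z: "z \<in> carrier (G j)"
      and eq: "ab_map (\<iota> i) y = ab_map (\<iota> j) z" for i j y z
  proof -
    obtain k where k: "(i, k) \<in> r" "(j, k) \<in> r"
      using upper_bound[OF i j] by blast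
    have "ab_map (\<kappa> k) (t i k y) = ab_map (\<kappa> k) (t j k z)"
      using in_I[OF k(1)] t_closed[OF k(1) y] t_closed[OF k(2) z]
        cocone_t[OF coc k(1) y] cocone_t[OF coc k(2) z] eq by (intro one_stage) auto
    then show ?thesis
      using cocone_t[OF coM k(1) y] cocone_t[OF coM k(2) z] by simp
  qed
  have "\<exists>i y. i \<in> I \<and> y \<in> carrier (G i) \<and> x = ab_map (\<iota> i) y" if "x \<in> carrier L" for x
    using surj[OF that] by blast
  then obtain st el where st: "\<And>x. x \<in> carrier L \<Longrightarrow> st x \<in> I"
    and el: "\<And>x. x \<in> carrier L \<Longrightarrow> el x \<in> carrier (G (st x))"
    and x_eq: "\<And>x. x \<in> carrier L \<Longrightarrow> x = ab_map (\<iota> (st x)) (el x)"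
    by metis
  define h where "h x = ab_map (\<kappa> (st x)) (el x)" for x
  have h_\<iota>: "h (ab_map (\<iota> i) y) = ab_map (\<kappa> i) y" if "i \<in> I" "y \<in> carrier (G i)" for i y
  proof -
    let ?x = "ab_map (\<iota> i) y"
    have "?x \<in> carrier L"
      using ab_map_closed[OF \<iota>[OF that(1)] that(2)] .
    then show ?thesis
      unfolding h_def using st el x_eq[symmetric] that by (intro welldef) auto
  qed
  have "h \<in> hom L M"
  proof (rule homI)
    fix x assume x: "x \<in> carrier L"
    show "h x \<in> carrier M"
      unfolding h_def by (rule ab_map_closed[OF \<kappa>[OF st[OF x]] el[OF x]])
    fix x' assume x': "x' \<in> carrier L"
    obtain k where k: "(st x, k) \<in> r" "(st x', k) \<in> r"
      using upper_bound[OF st[OF x] st[OF x']] by blast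
    note kI = conjunct2[OF in_I[OF k(1)]]
    interpret Gk: group "G k" by (rule gG[OF kI])
    let ?y = "t (st x) k (el x)" and ?y' = "t (st x') k (el x')"
    have y: "?y \<in> carrier (G k)" "?y' \<in> carrier (G k)"
      using t_closed[OF k(1) el[OF x]] t_closed[OF k(2) el[OF x']] by auto
    have xy: "x = ab_map (\<iota> k) ?y" "x' = ab_map (\<iota> k) ?y'"
      using cocone_t[OF coc k(1) el[OF x]] cocone_t[OF coc k(2) el[OF x']] x_eq[OF x] x_eq[OF x'] by auto
    have "x \<otimes>\<^bsub>L\<^esub> x' = ab_map (\<iota> k) (?y \<otimes>\<^bsub>G k\<^esub> ?y')"
      using ab_map_mult[OF \<iota>[OF kI] y] xy by simp
    then have "h (x \<otimes>\<^bsub>L\<^esub> x') = ab_map (\<kappa> k) (?y \<otimes>\<^bsub>G k\<^esub> ?y')"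
      using h_\<iota>[OF kI Gk.m_closed[OF y]] by simp
    also have "\<dots> = ab_map (\<kappa> k) ?y \<otimes>\<^bsub>M\<^esub> ab_map (\<kappa> k) ?y'"
      by (rule ab_map_mult[OF \<kappa>[OF kI] y])
    also have "\<dots> = h x \<otimes>\<^bsub>M\<^esub> h x'"
      using h_\<iota>[OF kI y(1)] h_\<iota>[OF kI y(2)] xy by simp
    finally show "h (x \<otimes>\<^bsub>L\<^esub> x') = h x \<otimes>\<^bsub>M\<^esub> h x'" .
  qed
  note H = ab_arrow_Hom[OF L M this]
  show "\<exists>!k. k \<in> Hom Ab L M \<and> (\<forall>i\<in>obj (poset_cat I r). cmp Ab k (\<iota> i) = \<kappa> i)"
  proof (rule ex1I[of _ "ab_arrow L h M"])
    have "cmp Ab (ab_arrow L h M) (\<iota> i) = \<kappa> i" if i: "i \<in> I" for i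
      by (rule Hom_Ab_eqI[OF cmp_Ab_Hom[OF \<iota>[OF i] H] \<kappa>[OF i]])
        (simp add: ab_map_cmp[OF \<iota>[OF i] H] ab_map_closed[OF \<iota>[OF i]] h_\<iota>[OF i])
    then show "ab_arrow L h M \<in> Hom Ab L M \<and>
        (\<forall>i\<in>obj (poset_cat I r). cmp Ab (ab_arrow L h M) (\<iota> i) = \<kappa> i)"
      using H by simp
    fix k assume k: "k \<in> Hom Ab L M \<and> (\<forall>i\<in>obj (poset_cat I r). cmp Ab k (\<iota> i) = \<kappa> i)"
    then have kH: "k \<in> Hom Ab L M" by blast
    show "k = ab_arrow L h M"
    proof (rule Hom_Ab_eqI[OF kH H])
      fix x assume x: "x \<in> carrier L"
      have "ab_map k (ab_map (\<iota> (st x)) (el x)) = h x"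
        unfolding h_def using ab_map_cmp[OF \<iota>[OF st[OF x]] kH el[OF x]] k st[OF x] by simp
      then show "ab_map k x = ab_map (ab_arrow L h M) x"
        using x_eq[OF x] x by simp
    qed
  qed
qed

text \<open>
  As for sets, the union of the images of the legs is the vertex of a cocone; directedness makes it a subgroup.
\<close>

lemma colimit_Ab_stage:
  assumes col: "is_colimit (poset_cat I r) Ab E L \<iota>" and x: "x \<in> carrier L"
  obtains i y where "i \<in> I" "y \<in> carrier (G i)" "x = ab_map (\<iota> i) y"
proof -
  note coc = colimit_cocone[OF col]
  have L: "small_ab_group L"
    using cocone_obj[OF coc] by simp
  interpret L: comm_group L by (rule small_ab_groupD(1)[OF L])
  have \<iota>: "\<iota> i \<in> Hom Ab (G i) L" if "i \<in> I" for i
    using cocone_Hom[OF coc] that by simp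
  define H where "H = (\<Union>i\<in>I. ab_map (\<iota> i) ` carrier (G i))"
  have "subgroup H L"
  proof (rule L.subgroupI)
    show "H \<subseteq> carrier L"
      unfolding H_def using ab_map_closed[OF \<iota>] by blast
    obtain i where i: "i \<in> I" using nonempty by blast
    have "ab_map (\<iota> i) \<one>\<^bsub>G i\<^esub> \<in> H"
      unfolding H_def using i monoid.one_closed[OF group.is_monoid[OF gG[OF i]]] by blast
    then show "H \<noteq> {}" by blast
  next
    fix a assume "a \<in> H"
    then obtain i y where i: "i \<in> I" and y: "y \<in> carrier (G i)" "a = ab_map (\<iota> i) y"
      unfolding H_def by blast
    interpret group_hom "G i" L "ab_map (\<iota> i)"
      using gG[OF i] L.is_group ab_map_hom[OF \<iota>[OF i]] by (simp add: group_hom_def group_hom_axioms_def)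
    have "inv\<^bsub>L\<^esub> a = ab_map (\<iota> i) (inv\<^bsub>G i\<^esub> y)"
      using y by simp
    moreover have "inv\<^bsub>G i\<^esub> y \<in> carrier (G i)"
      using y by simp
    ultimately show "inv\<^bsub>L\<^esub> a \<in> H"
      unfolding H_def using i by blast
  next
    fix a b assume "a \<in> H" "b \<in> H"
    then obtain i y j z where i: "i \<in> I" and y: "y \<in> carrier (G i)" "a = ab_map (\<iota> i) y"
      and j: "j \<in> I" and z: "z \<in> carrier (G j)" "b = ab_map (\<iota> j) z"
      unfolding H_def by blast
    obtain k where k: "(i, k) \<in> r" "(j, k) \<in> r"
      using upper_bound[OF i j] by blast
    note kI = conjunct2[OF in_I[OF k(1)]]
    interpret Gk: group "G k" by (rule gG[OF kI])
    have "a \<otimes>\<^bsub>L\<^esub> b = ab_map (\<iota> k) (t i k y \<otimes>\<^bsub>G k\<^esub> t j k z)"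
      using ab_map_mult[OF \<iota>[OF kI] t_closed[OF k(1) y(1)] t_closed[OF k(2) z(1)]]
        cocone_t[OF coc k(1) y(1)] cocone_t[OF coc k(2) z(1)] y z by simp
    moreover have "t i k y \<otimes>\<^bsub>G k\<^esub> t j k z \<in> carrier (G k)"
      using t_closed[OF k(1) y(1)] t_closed[OF k(2) z(1)] by simp
    ultimately show "a \<otimes>\<^bsub>L\<^esub> b \<in> H"
      unfolding H_def using kI by blast
  qed
  note H = this
  let ?H = "L\<lparr>carrier := H\<rparr>"
  have HL: "H \<subseteq> carrier L"
    using subgroup.subset[OF H] .
  have "comm_group ?H"
  proof (rule group.group_comm_groupI)
    show "group ?H" using L.subgroup_imp_group[OF H] .
    show "x \<otimes>\<^bsub>?H\<^esub> y = y \<otimes>\<^bsub>?H\<^esub> x" if "x \<in> carrier ?H" "y \<in> carrier ?H" for x y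
      using that HL L.m_comm by auto
  qed
  then have sH: "small_ab_group ?H"
    using small_subset[OF small_ab_groupD(3)[OF L] HL] by (simp add: small_ab_group_def)
  have hom_H: "ab_map (\<iota> i) \<in> hom (G i) ?H" if i: "i \<in> I" for i
  proof (rule homI)
    show "ab_map (\<iota> i) y \<in> carrier ?H" if "y \<in> carrier (G i)" for y
      using that i by (auto simp: H_def)
  qed (simp add: ab_map_mult[OF \<iota>[OF i]])
  define \<iota>' where "\<iota>' i = ab_arrow (G i) (ab_map (\<iota> i)) ?H" for i
  have \<iota>': "\<iota>' i \<in> Hom Ab (G i) ?H" if "i \<in> I" for i
    unfolding \<iota>'_def by (rule ab_arrow_Hom[OF G[OF that] sH hom_H[OF that]])
  have \<iota>'_map: "ab_map (\<iota>' i) y = ab_map (\<iota> i) y" if "y \<in> carrier (G i)" for i y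
    using that by (simp add: \<iota>'_def)
  have "is_cocone (poset_cat I r) Ab E ?H \<iota>'"
    unfolding is_cocone_def
  proof (intro conjI ballI)
    show "?H \<in> obj Ab" using sH by simp
    show "\<iota>' i \<in> Hom Ab (G i) ?H" if "i \<in> obj (poset_cat I r)" for i
      using \<iota>' that by simp
    fix a assume a: "a \<in> arr (poset_cat I r)"
    obtain i j where ij: "a = (i, j)" "(i, j) \<in> r"
      using a by (cases a) auto
    have i: "i \<in> I" and j: "j \<in> I" using in_I[OF ij(2)] by auto
    have "cmp Ab (\<iota>' j) (far E (i, j)) = \<iota>' i"
    proof (rule Hom_Ab_eqI[OF cmp_Ab_Hom[OF tr[OF ij(2)] \<iota>'[OF j]] \<iota>'[OF i]])
      fix y assume y: "y \<in> carrier (G i)"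
      show "ab_map (cmp Ab (\<iota>' j) (far E (i, j))) y = ab_map (\<iota>' i) y"
        using ab_map_cmp[OF tr[OF ij(2)] \<iota>'[OF j] y] \<iota>'_map[OF t_closed[OF ij(2) y]]
          \<iota>'_map[OF y] cocone_t[OF coc ij(2) y] by simp
    qed
    then show "cmp Ab (\<iota>' (tgt (poset_cat I r) a)) (far E a) = \<iota>' (src (poset_cat I r) a)"
      using ij by simp
  qed
  from colimit_factor[OF col this] obtain h where h: "h \<in> Hom Ab L ?H"
    "\<And>i. i \<in> I \<Longrightarrow> cmp Ab h (\<iota> i) = \<iota>' i"
    by (metis obj_poset_cat)
  have "(\<lambda>y. y) \<in> hom ?H L"
    using HL by (auto simp: hom_def)
  note inc = ab_arrow_Hom[OF sH L this]
  let ?inc = "ab_arrow ?H (\<lambda>y. y) L"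
  have "cmp Ab ?inc h = ident Ab L"
  proof (rule colimit_unique[OF category_Ab category_poset_cat[OF order] is_system col
        cmp_Ab_Hom[OF h(1) inc] ident_Ab_Hom[OF L]])
    fix i assume "i \<in> obj (poset_cat I r)"
    then have i: "i \<in> I" by simp
    show "cmp Ab (cmp Ab ?inc h) (\<iota> i) = cmp Ab (ident Ab L) (\<iota> i)"
    proof (rule Hom_Ab_eqI[OF cmp_Ab_Hom[OF \<iota>[OF i] cmp_Ab_Hom[OF h(1) inc]]
          cmp_Ab_Hom[OF \<iota>[OF i] ident_Ab_Hom[OF L]]])
      fix y assume y: "y \<in> carrier (G i)"
      note \<iota>y = ab_map_closed[OF \<iota>[OF i] y]
      have "ab_map h (ab_map (\<iota> i) y) = ab_map (\<iota> i) y"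
        using ab_map_cmp[OF \<iota>[OF i] h(1) y] h(2)[OF i] \<iota>'_map[OF y] by simp
      then show "ab_map (cmp Ab (cmp Ab ?inc h) (\<iota> i)) y = ab_map (cmp Ab (ident Ab L) (\<iota> i)) y"
        using ab_map_cmp[OF \<iota>[OF i] cmp_Ab_Hom[OF h(1) inc] y]
          ab_map_cmp[OF \<iota>[OF i] ident_Ab_Hom[OF L] y] ab_map_cmp[OF h(1) inc \<iota>y]
          ab_map_closed[OF h(1) \<iota>y] \<iota>y by simp
    qed
  qed
  then have "ab_map ?inc (ab_map h x) = x"
    using ab_map_cmp[OF h(1) inc x] ab_map_ident[OF x] by simp
  then have "x \<in> H"
    using ab_map_closed[OF h(1) x] by simp
  then show thesis
    using that unfolding H_def by blast
qed

text \<open>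
  An element that vanishes in the colimit vanishes in every cocone. The cocone that detects eventual
  vanishing has as its vertex the reduced product: the product of all stages modulo the families that are eventually
  trivial. An element \<open>y\<close> of stage \<open>k\<close> goes to the family of its images at the stages \<open>j \<ge> k\<close>, with the
  neutral element elsewhere.
\<close>

lemma colimit_Ab_vanish:
  assumes U: "universe TYPE('u)" and I: "small TYPE('u) I"
    and col: "is_colimit (poset_cat I r) Ab E L \<iota>"
    and i: "i \<in> I" and x: "x \<in> carrier (G i)" and x0: "ab_map (\<iota> i) x = \<one>\<^bsub>L\<^esub>"
  obtains j where "(i, j) \<in> r" "t i j x = \<one>\<^bsub>G j\<^esub>"
proof -
  let ?P = "product_group I G"
  have grp: "group ?P"
    using gG by simp
  interpret P: group ?P by (rule grp)
  have "comm_group ?P"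
  proof (rule P.group_comm_groupI)
    fix f g assume fg: "f \<in> carrier ?P" "g \<in> carrier ?P"
    have "f j \<otimes>\<^bsub>G j\<^esub> g j = g j \<otimes>\<^bsub>G j\<^esub> f j" if j: "j \<in> I" for j
      using fg j comm_groupE(4)[OF small_ab_groupD(1)[OF G[OF j]]] by (auto simp: PiE_iff)
    then show "f \<otimes>\<^bsub>?P\<^esub> g = g \<otimes>\<^bsub>?P\<^esub> f" by (auto simp: fun_eq_iff)
  qed
  note commP = this
  have smallP: "small TYPE('u) (carrier ?P)"
    using small_PiE[OF U I small_ab_groupD(3)[OF G]] by simp
  have inv_P: "(inv\<^bsub>?P\<^esub> f) j = inv\<^bsub>G j\<^esub> f j" if "f \<in> carrier ?P" "j \<in> I" for f j
    using that gG by simp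
  define N where "N = {f \<in> carrier ?P. \<exists>k\<in>I. \<forall>j. (k, j) \<in> r \<longrightarrow> f j = \<one>\<^bsub>G j\<^esub>}"
  have "subgroup N ?P"
  proof (rule P.subgroupI)
    show "N \<subseteq> carrier ?P" unfolding N_def by blast
    have "\<one>\<^bsub>?P\<^esub> \<in> N"
      unfolding N_def using i P.one_closed in_I by auto
    then show "N \<noteq> {}" by blast
  next
    fix f assume "f \<in> N"
    then obtain k where f: "f \<in> carrier ?P" and k: "k \<in> I" "\<And>j. (k, j) \<in> r \<Longrightarrow> f j = \<one>\<^bsub>G j\<^esub>"
      unfolding N_def by blast
    have "(inv\<^bsub>?P\<^esub> f) j = \<one>\<^bsub>G j\<^esub>" if "(k, j) \<in> r" for j
      using inv_P[OF f] k(2)[OF that] in_I[OF that] group.is_monoid[OF gG]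
      by (simp add: monoid.inv_one)
    then show "inv\<^bsub>?P\<^esub> f \<in> N"
      unfolding N_def using P.inv_closed[OF f] k(1) by blast
  next
    fix f g assume "f \<in> N" "g \<in> N"
    then obtain k l where f: "f \<in> carrier ?P" and k: "k \<in> I" "\<And>j. (k, j) \<in> r \<Longrightarrow> f j = \<one>\<^bsub>G j\<^esub>"
      and g: "g \<in> carrier ?P" and l: "l \<in> I" "\<And>j. (l, j) \<in> r \<Longrightarrow> g j = \<one>\<^bsub>G j\<^esub>"
      unfolding N_def by blast
    obtain m where m: "(k, m) \<in> r" "(l, m) \<in> r"
      using upper_bound[OF k(1) l(1)] by blast
    have "(f \<otimes>\<^bsub>?P\<^esub> g) j = \<one>\<^bsub>G j\<^esub>" if "(m, j) \<in> r" for j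
      using k(2)[OF poset_trans[OF order m(1) that]] l(2)[OF poset_trans[OF order m(2) that]]
        in_I[OF that] group.is_monoid[OF gG] by (simp add: monoid.l_one monoid.one_closed)
    then show "f \<otimes>\<^bsub>?P\<^esub> g \<in> N"
      unfolding N_def using P.m_closed[OF f g] in_I[OF m(1)] by blast
  qed
  then obtain Q :: "'u monoid" and q where Q: "small_ab_group Q" and q: "q \<in> hom ?P Q"
    and qN: "\<forall>f\<in>carrier ?P. q f = \<one>\<^bsub>Q\<^esub> \<longleftrightarrow> f \<in> N"
    using small_quotient_group[OF commP smallP] by metis
  define e where "e k y = (\<lambda>j\<in>I. if (k, j) \<in> r then t k j y else \<one>\<^bsub>G j\<^esub>)" for k y
  have e: "e k y \<in> carrier ?P" if "k \<in> I" "y \<in> carrier (G k)" for k y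
    using that t_closed group.is_monoid[OF gG] by (auto simp: e_def monoid.one_closed)
  have "(\<lambda>y. q (e k y)) \<in> hom (G k) Q" if k: "k \<in> I" for k
  proof (rule homI)
    fix y assume y: "y \<in> carrier (G k)"
    show "q (e k y) \<in> carrier Q"
      by (rule hom_in_carrier[OF q e[OF k y]])
    fix z assume z: "z \<in> carrier (G k)"
    have "e k (y \<otimes>\<^bsub>G k\<^esub> z) j = (e k y \<otimes>\<^bsub>?P\<^esub> e k z) j" for j
      using ab_map_mult[OF tr y z] group.is_monoid[OF gG]
      by (cases "j \<in> I") (auto simp: e_def monoid.l_one monoid.one_closed)
    then have "e k (y \<otimes>\<^bsub>G k\<^esub> z) = e k y \<otimes>\<^bsub>?P\<^esub> e k z" by blast
    then show "q (e k (y \<otimes>\<^bsub>G k\<^esub> z)) = q (e k y) \<otimes>\<^bsub>Q\<^esub> q (e k z)"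
      using hom_mult[OF q e[OF k y] e[OF k z]] by simp
  qed
  then have \<kappa>: "ab_arrow (G k) (\<lambda>y. q (e k y)) Q \<in> Hom Ab (G k) Q" if "k \<in> I" for k
    using ab_arrow_Hom[OF G Q] that by blast
  have qe: "q (e l (t k l y)) = q (e k y)" if kl: "(k, l) \<in> r" and y: "y \<in> carrier (G k)" for k l y
  proof -
    have k: "k \<in> I" and l: "l \<in> I" using in_I[OF kl] by auto
    note c = e[OF l t_closed[OF kl y]] e[OF k y]
    let ?w = "e l (t k l y) \<otimes>\<^bsub>?P\<^esub> inv\<^bsub>?P\<^esub> e k y"
    have w: "?w \<in> carrier ?P" using c by blast
    have "?w j = \<one>\<^bsub>G j\<^esub>" if lj: "(l, j) \<in> r" for j
    proof -
      have j: "j \<in> I" using in_I[OF lj] by blast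
      have kj: "(k, j) \<in> r" by (rule poset_trans[OF order kl lj])
      have "?w j = t k j y \<otimes>\<^bsub>G j\<^esub> inv\<^bsub>G j\<^esub> t k j y"
        using j lj kj inv_P[OF c(2) j] t_t[OF kl lj y] by (simp add: e_def)
      then show ?thesis
        using group.r_inv[OF gG[OF j] t_closed[OF kj y]] by simp
    qed
    then have "?w \<in> N"
      unfolding N_def using w l by blast
    then show ?thesis
      using hom_eq_iff[OF q grp small_ab_groupD(2)[OF Q] c] qN w by blast
  qed
  let ?\<kappa> = "\<lambda>k. ab_arrow (G k) (\<lambda>y. q (e k y)) Q"
  have "is_cocone (poset_cat I r) Ab E Q ?\<kappa>"
    unfolding is_cocone_def
  proof (intro conjI ballI)
    show "Q \<in> obj Ab" using Q by simp
    show "?\<kappa> k \<in> Hom Ab (G k) Q" if "k \<in> obj (poset_cat I r)" for k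
      using \<kappa> that by simp
    fix a assume a: "a \<in> arr (poset_cat I r)"
    obtain k l where kl: "a = (k, l)" "(k, l) \<in> r"
      using a by (cases a) auto
    have k: "k \<in> I" and l: "l \<in> I" using in_I[OF kl(2)] by auto
    have "cmp Ab (?\<kappa> l) (far E (k, l)) = ?\<kappa> k"
    proof (rule Hom_Ab_eqI[OF cmp_Ab_Hom[OF tr[OF kl(2)] \<kappa>[OF l]] \<kappa>[OF k]])
      fix y assume y: "y \<in> carrier (G k)"
      show "ab_map (cmp Ab (?\<kappa> l) (far E (k, l))) y = ab_map (?\<kappa> k) y"
        using ab_map_cmp[OF tr[OF kl(2)] \<kappa>[OF l] y] t_closed[OF kl(2) y] y qe[OF kl(2) y] by simp
    qed
    then show "cmp Ab (?\<kappa> (tgt (poset_cat I r) a)) (far E a) = ?\<kappa> (src (poset_cat I r) a)"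
      using kl by simp
  qed
  from colimit_factor[OF col this] obtain h where h: "h \<in> Hom Ab L Q"
    "\<And>k. k \<in> I \<Longrightarrow> cmp Ab h (\<iota> k) = ?\<kappa> k"
    by (metis obj_poset_cat)
  have "\<iota> i \<in> Hom Ab (G i) L"
    using cocone_Hom[OF colimit_cocone[OF col]] i by simp
  from ab_map_cmp[OF this h(1) x] have "q (e i x) = ab_map h \<one>\<^bsub>L\<^esub>"
    using h(2)[OF i] x x0 by simp
  then have "e i x \<in> N"
    using ab_map_one[OF h(1)] qN e[OF i x] by simp
  then obtain k where k: "k \<in> I" "\<And>j. (k, j) \<in> r \<Longrightarrow> e i x j = \<one>\<^bsub>G j\<^esub>"
    unfolding N_def by blast
  obtain j where j: "(i, j) \<in> r" "(k, j) \<in> r"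
    using upper_bound[OF i k(1)] by blast
  have "t i j x = \<one>\<^bsub>G j\<^esub>"
    using k(2)[OF j(2)] j(1) in_I[OF j(1)] by (simp add: e_def)
  then show thesis
    using that j(1) by blast
qed

end

lemma comp_functor_is_functor:
  assumes J: "category J" and D: "is_functor J C D" and F: "is_functor C E F"
  shows "is_functor J E (comp_functor J F D)"
proof -
  have fob: "fob (comp_functor J F D) j = fob F (fob D j)" if "j \<in> obj J" for j
    using that by (simp add: comp_functor_def)
  have far: "far (comp_functor J F D) a = far F (far D a)" if "a \<in> Hom J i j" for a i j
    using Hom_arr[OF that] by (simp add: comp_functor_def)
  show ?thesis
    unfolding is_functor_def
  proof (intro conjI ballI allI impI)
    show "fob (comp_functor J F D) \<in> obj J \<rightarrow>\<^sub>E obj E"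
      using fob_obj[OF F] fob_obj[OF D] by (simp add: comp_functor_def)
    have "far F (far D a) \<in> arr E" if "a \<in> arr J" for a
      by (rule Hom_arr[OF far_Hom[OF F far_Hom[OF D arr_Hom[OF that]]]])
    then show "far (comp_functor J F D) \<in> arr J \<rightarrow>\<^sub>E arr E"
      by (simp add: comp_functor_def)
  next
    fix i j a assume a: "a \<in> Hom J i j"
    show "far (comp_functor J F D) a \<in> Hom E (fob (comp_functor J F D) i) (fob (comp_functor J F D) j)"
      using far_Hom[OF F far_Hom[OF D a]] far[OF a] fob Hom_objD[OF J a] by simp
  next
    fix j assume j: "j \<in> obj J"
    show "far (comp_functor J F D) (ident J j) = ident E (fob (comp_functor J F D) j)"
      using far[OF ident_Hom[OF J j]] fob[OF j] far_ident[OF D j] far_ident[OF F fob_obj[OF D j]] by simp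
  next
    fix i j k a b assume ab: "a \<in> Hom J i j" "b \<in> Hom J j k"
    show "far (comp_functor J F D) (cmp J b a) =
        cmp E (far (comp_functor J F D) b) (far (comp_functor J F D) a)"
      using far[OF cmp_Hom[OF J ab]] far[OF ab(1)] far[OF ab(2)] far_cmp[OF D ab]
        far_cmp[OF F far_Hom[OF D ab(1)] far_Hom[OF D ab(2)]] by simp
  qed
qed

section \<open>Objects annihilated by functors\<close>

lemma fun_objD:
  assumes "F \<in> fun_obj lam (C :: ('o, 'm) cat)"
  shows "is_functor C (Ab :: ('u monoid, 'u ab_arr) cat) F"
    and "preserves_directed_colimits TYPE('u) lam C Ab F"
    and "preserves_products TYPE('u) C Ab F"
  using assms by (simp_all add: fun_obj_def)

lemma ab_system_comp:
  fixes C :: "('o, 'm) cat" and F :: "('o, 'm, 'u) ab_functor"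
  assumes lam: "infinite_regular_cardinal lam" and F: "is_functor C Ab F"
    and col: "is_directed_colimit TYPE('u) lam C I r D L \<iota>"
  shows "ab_system I r (comp_functor (poset_cat I r) F D)"
proof
  note dir = directed_colimit_directed[OF col]
  show order: "partial_order_on I r"
    by (rule directed_colimit_order[OF col])
  show "I \<noteq> {}"
    using directed_nonempty[OF lam dir] by auto
  show "\<exists>k. (i, k) \<in> r \<and> (j, k) \<in> r" if "i \<in> I" "j \<in> I" for i j
    using directed_upper_bound[OF lam dir that] by metis
  show "is_functor (poset_cat I r) Ab (comp_functor (poset_cat I r) F D)"
    by (rule comp_functor_is_functor[OF category_poset_cat[OF order] directed_colimit_functor[OF col] F])
qed

lemma
  fixes C :: "('o, 'm) cat" and F :: "('o, 'm, 'u) ab_functor"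
  assumes lam: "infinite_regular_cardinal lam" and F: "F \<in> fun_obj lam C"
    and col: "is_directed_colimit TYPE('u) lam C I r D L \<iota>"
  shows fun_obj_stage: "x \<in> carrier (fob F L) \<Longrightarrow>
      \<exists>i\<in>I. \<exists>y\<in>carrier (fob F (fob D i)). x = ab_map (far F (\<iota> i)) y"
    and fun_obj_vanish: "universe TYPE('u) \<Longrightarrow> i \<in> I \<Longrightarrow> y \<in> carrier (fob F (fob D i)) \<Longrightarrow>
      ab_map (far F (\<iota> i)) y = \<one>\<^bsub>fob F L\<^esub> \<Longrightarrow>
      \<exists>j. (i, j) \<in> r \<and> ab_map (far F (far D (i, j))) y = \<one>\<^bsub>fob F (fob D j)\<^esub>"
proof -
  let ?E = "comp_functor (poset_cat I r) F D"
  interpret ab_system I r ?E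
    by (rule ab_system_comp[OF lam fun_objD(1)[OF F] col])
  have E: "is_colimit (poset_cat I r) Ab ?E (fob F L) (\<lambda>i. far F (\<iota> i))"
    using fun_objD(2)[OF F] col unfolding preserves_directed_colimits_def by simp
  have fob: "fob ?E i = fob F (fob D i)" if "i \<in> I" for i
    using that by (simp add: comp_functor_def)
  have far: "far ?E (i, j) = far F (far D (i, j))" if "(i, j) \<in> r" for i j
    using that by (simp add: comp_functor_def)
  show "\<exists>i\<in>I. \<exists>y\<in>carrier (fob F (fob D i)). x = ab_map (far F (\<iota> i)) y" if x: "x \<in> carrier (fob F L)"
  proof -
    obtain i y where "i \<in> I" "y \<in> carrier (fob ?E i)" "x = ab_map (far F (\<iota> i)) y"
      using colimit_Ab_stage[OF E x] .
    then show ?thesis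
      using fob by auto
  qed
  show "\<exists>j. (i, j) \<in> r \<and> ab_map (far F (far D (i, j))) y = \<one>\<^bsub>fob F (fob D j)\<^esub>"
    if U: "universe TYPE('u)" and i: "i \<in> I" and y: "y \<in> carrier (fob F (fob D i))"
      and y0: "ab_map (far F (\<iota> i)) y = \<one>\<^bsub>fob F L\<^esub>"
  proof -
    have y': "y \<in> carrier (fob ?E i)"
      using y fob[OF i] by simp
    obtain j where "(i, j) \<in> r" "ab_map (far ?E (i, j)) y = \<one>\<^bsub>fob ?E j\<^esub>"
      using colimit_Ab_vanish[OF U directed_colimit_small[OF col] E i y' y0] .
    then show ?thesis
      using fob far in_I by auto
  qed
qed

text \<open>
  An element of \<open>F A\<close> is carried by a presented stage \<open>fob D i\<close> of \<open>A\<close>. Its image in \<open>F B\<close> is trivial, and this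
  is witnessed by a map \<open>g'\<close> from \<open>fob D i\<close> to a presented stage of \<open>B\<close> that already kills it. Purity factors the
  leg \<open>\<iota> i\<close> through \<open>g'\<close>.
\<close>

lemma fun_obj_pure_subobject:
  fixes C :: "('o, 'm) cat" and F :: "('o, 'm, 'u) ab_functor"
  assumes U: "universe TYPE('u)" and lam: "infinite_regular_cardinal lam"
    and lp: "locally_presentable TYPE('u) lam C" and F: "F \<in> fun_obj lam C"
    and f: "pure TYPE('u) lam C A B f" and FB: "trivial_group (fob F B)"
  shows "trivial_group (fob F A)"
proof -
  have C: "category C"
    using lp unfolding locally_presentable_def by (elim conjE)
  note Ffun = fun_objD(1)[OF F]
  have fH: "f \<in> Hom C A B"
    using f unfolding pure_def by (elim conjE)
  have A: "A \<in> obj C" and B: "B \<in> obj C"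
    using Hom_objD[OF C fH] by auto
  obtain G where G: "small TYPE('u) G" "\<forall>A\<in>G. presented TYPE('u) lam C A"
    and gen: "\<forall>T\<in>obj C. \<exists>(K :: 'u set) r D \<iota>.
       is_directed_colimit TYPE('u) lam C K r D T \<iota> \<and> fob D ` K \<subseteq> G"
    using presentable_generators[OF lp] .
  obtain I :: "'u set" and r D \<iota> where colA: "is_directed_colimit TYPE('u) lam C I r D A \<iota>"
    and DG: "fob D ` I \<subseteq> G"
    using bspec[OF gen A] by (elim exE conjE)
  obtain J :: "'u set" and s E \<kappa> where colB: "is_directed_colimit TYPE('u) lam C J s E B \<kappa>"
    and EG: "fob E ` J \<subseteq> G"
    using bspec[OF gen B] by (elim exE conjE)
  have FA: "small_ab_group (fob F A)"
    using fob_obj[OF Ffun A] by simp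
  interpret FA: group "fob F A" by (rule small_ab_groupD(2)[OF FA])
  have "x = \<one>\<^bsub>fob F A\<^esub>" if x: "x \<in> carrier (fob F A)" for x
  proof -
    obtain i y where i: "i \<in> I" and y: "y \<in> carrier (fob F (fob D i))"
      and xy: "x = ab_map (far F (\<iota> i)) y"
      using fun_obj_stage[OF lam F colA x] by blast
    note \<iota> = directed_colimit_leg[OF colA i]
    have Di: "presented TYPE('u) lam C (fob D i)"
      using G(2) DG i by blast
    obtain j g where j: "j \<in> J" and g: "g \<in> Hom C (fob D i) (fob E j)"
      and fg: "cmp C f (\<iota> i) = cmp C (\<kappa> j) g"
      using presented_factor[OF Di C colB cmp_Hom[OF C \<iota> fH]] by blast
    note \<kappa> = directed_colimit_leg[OF colB j]
    have Fg: "ab_map (far F g) y \<in> carrier (fob F (fob E j))"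
      by (rule ab_map_closed[OF far_Hom[OF Ffun g] y])
    have "ab_map (far F (\<kappa> j)) (ab_map (far F g) y) \<in> carrier (fob F B)"
      by (rule ab_map_closed[OF far_Hom[OF Ffun \<kappa>] Fg])
    then have "ab_map (far F (\<kappa> j)) (ab_map (far F g) y) = \<one>\<^bsub>fob F B\<^esub>"
      using FB unfolding trivial_group_def by auto
    then obtain k where k: "(j, k) \<in> s"
      and zero: "ab_map (far F (far E (j, k))) (ab_map (far F g) y) = \<one>\<^bsub>fob F (fob E k)\<^esub>"
      using fun_obj_vanish[OF lam F colB U j Fg] by blast
    note orderB = directed_colimit_order[OF colB]
    have kJ: "k \<in> J"
      using poset_carrier[OF orderB k] by blast
    note Ejk = system_Hom[OF orderB directed_colimit_functor[OF colB] k]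
    define g' where "g' = cmp C (far E (j, k)) g"
    have g': "g' \<in> Hom C (fob D i) (fob E k)"
      unfolding g'_def by (rule cmp_Hom[OF C g Ejk])
    have Fg'y: "ab_map (far F g') y = \<one>\<^bsub>fob F (fob E k)\<^esub>"
      unfolding g'_def far_cmp[OF Ffun g Ejk] ab_map_cmp[OF far_Hom[OF Ffun g] far_Hom[OF Ffun Ejk] y]
      by (rule zero)
    note \<kappa>k = directed_colimit_leg[OF colB kJ]
    have "cmp C f (\<iota> i) = cmp C (\<kappa> k) g'"
      unfolding g'_def cmp_assoc[OF C g Ejk \<kappa>k] directed_colimit_commute[OF colB k] by (rule fg)
    moreover have "presented TYPE('u) lam C (fob E k)"
      using G(2) EG kJ by blast
    ultimately obtain w where w: "w \<in> Hom C (fob E k) A" and \<iota>w: "\<iota> i = cmp C w g'"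
      using f Di g' \<iota> \<kappa>k unfolding pure_def by metis
    have "x = ab_map (far F w) (ab_map (far F g') y)"
      unfolding xy \<iota>w far_cmp[OF Ffun g' w] by (rule ab_map_cmp[OF far_Hom[OF Ffun g'] far_Hom[OF Ffun w] y])
    then show ?thesis
      unfolding Fg'y ab_map_one[OF far_Hom[OF Ffun w]] .
  qed
  then show ?thesis
    using FA.trivial_group_subset by blast
qed

text \<open>
  Products and directed colimits of trivial groups are trivial, and pure subobjects are covered by
  \<open>fun_obj_pure_subobject\<close>.
\<close>

lemma annihilated_definable:
  fixes C :: "('o, 'm) cat" and \<F> :: "('o, 'm, 'u) ab_functor set"
  assumes U: "universe TYPE('u)" and lam: "infinite_regular_cardinal lam"
    and lp: "locally_presentable TYPE('u) lam C" and \<F>: "\<F> \<subseteq> fun_obj lam C"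
  shows "definable_subcategory TYPE('u) lam C {X \<in> obj C. \<forall>F\<in>\<F>. trivial_group (fob F X)}"
    (is "definable_subcategory _ _ _ ?D")
  unfolding definable_subcategory_def
proof (intro conjI)
  show "?D \<subseteq> obj C" by blast
  show "closed_under_products TYPE('u) C ?D"
    unfolding closed_under_products_def
  proof (intro allI impI)
    fix I :: "'u set" and X P \<pi>
    assume I: "small TYPE('u) I" and X: "X ` I \<subseteq> ?D" and P: "is_product C I X P \<pi>"
    have "trivial_group (fob F P)" if F: "F \<in> \<F>" for F
    proof (rule product_Ab_trivial)
      have "X ` I \<subseteq> obj C" using X by blast
      then show "is_product Ab I (\<lambda>i. fob F (X i)) (fob F P) (\<lambda>i. far F (\<pi> i))"
        using fun_objD(3)[of F lam C] \<F> F I P unfolding preserves_products_def by blast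
      show "trivial_group (fob F (X i))" if "i \<in> I" for i
        using X F that by blast
    qed
    then show "P \<in> ?D"
      using product_obj[OF P] by blast
  qed
  show "closed_under_directed_colimits TYPE('u) lam C ?D"
    unfolding closed_under_directed_colimits_def
  proof (intro allI impI)
    fix I :: "'u set" and r D L \<iota>
    assume col: "is_directed_colimit TYPE('u) lam C I r D L \<iota>" and D: "fob D ` I \<subseteq> ?D"
    have "trivial_group (fob F L)" if F: "F \<in> \<F>" for F
    proof -
      have F': "F \<in> fun_obj lam C" using F \<F> by blast
      note Ffun = fun_objD(1)[OF F']
      have L: "small_ab_group (fob F L)"
        using fob_obj[OF Ffun directed_colimit_obj[OF col]] by simp
      interpret L: group "fob F L" by (rule small_ab_groupD(2)[OF L])
      have "x = \<one>\<^bsub>fob F L\<^esub>" if x: "x \<in> carrier (fob F L)" for x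
      proof -
        obtain i y where i: "i \<in> I" and y: "y \<in> carrier (fob F (fob D i))"
          and xy: "x = ab_map (far F (\<iota> i)) y"
          using fun_obj_stage[OF lam F' col x] by blast
        have "trivial_group (fob F (fob D i))"
          using D i F by blast
        then have "y = \<one>\<^bsub>fob F (fob D i)\<^esub>"
          using y unfolding trivial_group_def by blast
        then show ?thesis
          using xy ab_map_one[OF far_Hom[OF Ffun directed_colimit_leg[OF col i]]] by simp
      qed
      then show ?thesis
        using L.trivial_group_subset by blast
    qed
    then show "L \<in> ?D"
      using directed_colimit_obj[OF col] by blast
  qed
  show "closed_under_pure_subobjects TYPE('u) lam C ?D"
    unfolding closed_under_pure_subobjects_def
    using fun_obj_pure_subobject[OF U lam lp] \<F> by blast
qed


section \<open>The functor measuring failure of factorization\<close>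

lemma
  assumes "preadditive_structure C \<Gamma>" "A \<in> obj C" "B \<in> obj C"
  shows Hom_comm_group: "comm_group (\<Gamma> A B)"
    and carrier_Hom: "carrier (\<Gamma> A B) = Hom C A B"
  using assms unfolding preadditive_structure_def by auto

lemma
  assumes "preadditive_structure C \<Gamma>" "category C"
  shows precompose_hom: "f \<in> Hom C A B \<Longrightarrow> X \<in> obj C \<Longrightarrow> (\<lambda>h. cmp C h f) \<in> hom (\<Gamma> B X) (\<Gamma> A X)"
    and postcompose_hom: "f \<in> Hom C A B \<Longrightarrow> X \<in> obj C \<Longrightarrow> (\<lambda>h. cmp C f h) \<in> hom (\<Gamma> X A) (\<Gamma> X B)"
  using assms(1) Hom_objD[OF assms(2)] unfolding preadditive_structure_def by blast+

text \<open>
  The solutions \<open>h : M \<rightarrow> X\<close> of the condition that \<open>h u\<close> factor through \<open>g : K \<rightarrow> L\<close>. For \<open>u = id\<close> they are the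
  image of \<open>Hom(L, X) \<rightarrow> Hom(K, X)\<close>; allowing a general \<open>u : K \<rightarrow> M\<close> makes it possible to transport a test along the
  stages of a directed colimit without forming pushouts of \<open>g\<close>.
\<close>

definition factoring where
  "factoring C L M g u X = {h \<in> Hom C M X. \<exists>v\<in>Hom C L X. cmp C h u = cmp C v g}"

lemma factoring_subgroup:
  assumes \<Gamma>: "preadditive_structure C \<Gamma>" and C: "category C"
    and g: "g \<in> Hom C K L" and u: "u \<in> Hom C K M" and X: "X \<in> obj C"
  shows "subgroup (factoring C L M g u X) (\<Gamma> M X)"
proof -
  have obj: "K \<in> obj C" "L \<in> obj C" "M \<in> obj C"
    using Hom_objD[OF C g] Hom_objD[OF C u] by auto
  note carrier = carrier_Hom[OF \<Gamma> _ X]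
  interpret GM: group "\<Gamma> M X" by (rule comm_group.axioms(2)[OF Hom_comm_group[OF \<Gamma> obj(3) X]])
  interpret GL: group "\<Gamma> L X" by (rule comm_group.axioms(2)[OF Hom_comm_group[OF \<Gamma> obj(2) X]])
  interpret GK: group "\<Gamma> K X" by (rule comm_group.axioms(2)[OF Hom_comm_group[OF \<Gamma> obj(1) X]])
  interpret pu: group_hom "\<Gamma> M X" "\<Gamma> K X" "\<lambda>h. cmp C h u"
    using precompose_hom[OF \<Gamma> C u X] by unfold_locales
  interpret pg: group_hom "\<Gamma> L X" "\<Gamma> K X" "\<lambda>v. cmp C v g"
    using precompose_hom[OF \<Gamma> C g X] by unfold_locales
  let ?N = "factoring C L M g u X"
  have N: "h \<in> ?N \<longleftrightarrow> h \<in> carrier (\<Gamma> M X) \<and> (\<exists>v\<in>carrier (\<Gamma> L X). cmp C h u = cmp C v g)" for h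
    unfolding factoring_def carrier[OF obj(3)] carrier[OF obj(2)] by blast
  show ?thesis
  proof (rule GM.subgroupI)
    show "?N \<subseteq> carrier (\<Gamma> M X)"
      using N by blast
    have "\<one>\<^bsub>\<Gamma> M X\<^esub> \<in> ?N"
      unfolding N using pu.hom_one pg.hom_one GM.one_closed GL.one_closed by metis
    then show "?N \<noteq> {}" by blast
  next
    fix h assume "h \<in> ?N"
    then obtain v where "h \<in> carrier (\<Gamma> M X)" "v \<in> carrier (\<Gamma> L X)" "cmp C h u = cmp C v g"
      unfolding N by blast
    then show "inv\<^bsub>\<Gamma> M X\<^esub> h \<in> ?N"
      unfolding N using pu.hom_inv pg.hom_inv GM.inv_closed GL.inv_closed by metis
  next
    fix h h' assume "h \<in> ?N" "h' \<in> ?N"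
    then obtain v v' where "h \<in> carrier (\<Gamma> M X)" "v \<in> carrier (\<Gamma> L X)" "cmp C h u = cmp C v g"
      "h' \<in> carrier (\<Gamma> M X)" "v' \<in> carrier (\<Gamma> L X)" "cmp C h' u = cmp C v' g"
      unfolding N by blast
    then show "h \<otimes>\<^bsub>\<Gamma> M X\<^esub> h' \<in> ?N"
      unfolding N using pu.hom_mult pg.hom_mult GM.m_closed GL.m_closed by metis
  qed
qed

lemma factoring_postcompose:
  assumes C: "category C" and g: "g \<in> Hom C K L" and u: "u \<in> Hom C K M"
    and f: "f \<in> Hom C X Y" and h: "h \<in> factoring C L M g u X"
  shows "cmp C f h \<in> factoring C L M g u Y"
proof -
  obtain v where hH: "h \<in> Hom C M X" and v: "v \<in> Hom C L X" "cmp C h u = cmp C v g"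
    using h unfolding factoring_def by blast
  have "cmp C (cmp C f h) u = cmp C (cmp C f v) g"
    using cmp_assoc[OF C u hH f] cmp_assoc[OF C g v(1) f] v(2) by simp
  then show ?thesis
    unfolding factoring_def using cmp_Hom[OF C hH f] cmp_Hom[OF C v(1) f] by blast
qed

text \<open>
  The groups \<open>Q X\<close> are copies in \<open>Ab\<close> of the quotients \<open>Hom(M, X) / N X\<close>, with quotient maps \<open>q X\<close>; they are
  parameters because the copies involve a choice for each \<open>X\<close>.
\<close>

locale factoring_quotient =
  fixes lam :: "'l rel" and C :: "('o, 'm) cat" and \<Gamma> :: "'o \<Rightarrow> 'o \<Rightarrow> 'm monoid"
    and K L M :: 'o and g u :: 'm and Q :: "'o \<Rightarrow> 'u monoid" and q :: "'o \<Rightarrow> 'm \<Rightarrow> 'u"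
  assumes lam: "infinite_regular_cardinal lam"
    and C: "category C" and \<Gamma>: "preadditive_structure C \<Gamma>"
    and presented: "presented TYPE('u) lam C K" "presented TYPE('u) lam C L" "presented TYPE('u) lam C M"
    and g: "g \<in> Hom C K L" and u: "u \<in> Hom C K M"
    and Q: "X \<in> obj C \<Longrightarrow> small_ab_group (Q X)"
    and q: "X \<in> obj C \<Longrightarrow> q X \<in> hom (\<Gamma> M X) (Q X)"
    and q_image: "X \<in> obj C \<Longrightarrow> q X ` Hom C M X = carrier (Q X)"
    and q_kernel: "X \<in> obj C \<Longrightarrow> h \<in> Hom C M X \<Longrightarrow> q X h = \<one>\<^bsub>Q X\<^esub> \<longleftrightarrow> h \<in> factoring C L M g u X"
begin

abbreviation N where "N \<equiv> factoring C L M g u"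

lemma M: "M \<in> obj C" and L: "L \<in> obj C"
  using Hom_objD[OF C g] Hom_objD[OF C u] by auto

lemma q_closed: "h \<in> Hom C M X \<Longrightarrow> q X h \<in> carrier (Q X)"
  using q_image[of X] Hom_objD[OF C, of h M X] by blast

lemma q_surj:
  assumes "X \<in> obj C" "x \<in> carrier (Q X)"
  obtains h where "h \<in> Hom C M X" "x = q X h"
  using q_image[OF assms(1)] assms(2) by blast

text \<open>
  Postcomposition with \<open>f\<close> is additive and maps \<open>N X\<close> to \<open>N Y\<close>, so it descends to the quotients.
\<close>

lemma q_postcompose_eq:
  assumes f: "f \<in> Hom C X Y" and h: "h \<in> Hom C M X" "h' \<in> Hom C M X" and eq: "q X h = q X h'"
  shows "q Y (cmp C f h) = q Y (cmp C f h')"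
proof -
  have X: "X \<in> obj C" and Y: "Y \<in> obj C"
    using Hom_objD[OF C f] by auto
  note GX = comm_group.axioms(2)[OF Hom_comm_group[OF \<Gamma> M X]]
    and GY = comm_group.axioms(2)[OF Hom_comm_group[OF \<Gamma> M Y]]
  note QX = small_ab_groupD(2)[OF Q[OF X]] and QY = small_ab_groupD(2)[OF Q[OF Y]]
  interpret GX: group "\<Gamma> M X" by (rule GX)
  interpret GY: group "\<Gamma> M Y" by (rule GY)
  interpret f: group_hom "\<Gamma> M X" "\<Gamma> M Y" "\<lambda>h. cmp C f h"
    using postcompose_hom[OF \<Gamma> C f M] by unfold_locales
  have hc: "h \<in> carrier (\<Gamma> M X)" "h' \<in> carrier (\<Gamma> M X)"
    using h carrier_Hom[OF \<Gamma> M X] by auto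
  let ?d = "h \<otimes>\<^bsub>\<Gamma> M X\<^esub> inv\<^bsub>\<Gamma> M X\<^esub> h'"
  have d: "?d \<in> Hom C M X"
    using hc carrier_Hom[OF \<Gamma> M X] GX.m_closed GX.inv_closed by blast
  have "?d \<in> N X"
    using hom_eq_iff[OF q[OF X] GX QX hc] eq q_kernel[OF X d] by simp
  then have "cmp C f ?d \<in> N Y"
    by (rule factoring_postcompose[OF C g u f])
  then have "q Y (cmp C f ?d) = \<one>\<^bsub>Q Y\<^esub>"
    using q_kernel[OF Y cmp_Hom[OF C d f]] by blast
  moreover have "cmp C f ?d = cmp C f h \<otimes>\<^bsub>\<Gamma> M Y\<^esub> inv\<^bsub>\<Gamma> M Y\<^esub> cmp C f h'"
    using hc by simp
  ultimately show ?thesis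
    using hom_eq_iff[OF q[OF Y] GY QY f.hom_closed[OF hc(1)] f.hom_closed[OF hc(2)]] by simp
qed

definition F :: "('o, 'm, 'u) ab_functor" where
  "F = \<lparr>fob = (\<lambda>X \<in> obj C. Q X),
        far = (\<lambda>f \<in> arr C. ab_arrow (Q (src C f))
          (\<lambda>x. q (tgt C f) (cmp C f (inv_into (Hom C M (src C f)) (q (src C f)) x))) (Q (tgt C f)))\<rparr>"

lemma fob_F: "X \<in> obj C \<Longrightarrow> fob F X = Q X"
  by (simp add: F_def)

lemma far_F_q:
  assumes f: "f \<in> Hom C X Y" and h: "h \<in> Hom C M X"
  shows "ab_map (far F f) (q X h) = q Y (cmp C f h)"
proof -
  let ?h = "inv_into (Hom C M X) (q X) (q X h)"
  have "q X h \<in> q X ` Hom C M X" using h by blast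
  then have "?h \<in> Hom C M X" "q X ?h = q X h"
    by (rule inv_into_into, rule f_inv_into_f)
  then have "q Y (cmp C f ?h) = q Y (cmp C f h)"
    by (rule q_postcompose_eq[OF f _ h])
  then show ?thesis
    using HomD[OF f] q_closed[OF h] by (simp add: F_def)
qed

lemma far_F_Hom:
  assumes f: "f \<in> Hom C X Y"
  shows "far F f \<in> Hom Ab (Q X) (Q Y)"
proof -
  have X: "X \<in> obj C" and Y: "Y \<in> obj C"
    using Hom_objD[OF C f] by auto
  interpret QX: group "Q X" by (rule small_ab_groupD(2)[OF Q[OF X]])
  have "ab_map (far F f) \<in> hom (Q X) (Q Y)"
  proof (rule homI)
    fix x assume x: "x \<in> carrier (Q X)"
    obtain h where h: "h \<in> Hom C M X" "x = q X h"
      using q_surj[OF X x] .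
    show "ab_map (far F f) x \<in> carrier (Q Y)"
      using far_F_q[OF f h(1)] q_closed[OF cmp_Hom[OF C h(1) f]] h(2) by simp
    fix x' assume x': "x' \<in> carrier (Q X)"
    obtain h' where h': "h' \<in> Hom C M X" "x' = q X h'"
      using q_surj[OF X x'] .
    have hc: "h \<in> carrier (\<Gamma> M X)" "h' \<in> carrier (\<Gamma> M X)"
      using h h' carrier_Hom[OF \<Gamma> M X] by auto
    have fc: "cmp C f h \<in> carrier (\<Gamma> M Y)" "cmp C f h' \<in> carrier (\<Gamma> M Y)"
      using cmp_Hom[OF C h(1) f] cmp_Hom[OF C h'(1) f] carrier_Hom[OF \<Gamma> M Y] by auto
    have sum: "h \<otimes>\<^bsub>\<Gamma> M X\<^esub> h' \<in> Hom C M X"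
      using hc carrier_Hom[OF \<Gamma> M X]
        monoid.m_closed[OF group.is_monoid[OF comm_group.axioms(2)[OF Hom_comm_group[OF \<Gamma> M X]]]] by blast
    have "ab_map (far F f) (x \<otimes>\<^bsub>Q X\<^esub> x') = q Y (cmp C f (h \<otimes>\<^bsub>\<Gamma> M X\<^esub> h'))"
      using far_F_q[OF f sum] hom_mult[OF q[OF X] hc] h(2) h'(2) by simp
    also have "\<dots> = q Y (cmp C f h) \<otimes>\<^bsub>Q Y\<^esub> q Y (cmp C f h')"
      using hom_mult[OF postcompose_hom[OF \<Gamma> C f M] hc] hom_mult[OF q[OF Y] fc] by simp
    also have "\<dots> = ab_map (far F f) x \<otimes>\<^bsub>Q Y\<^esub> ab_map (far F f) x'"
      using far_F_q[OF f h(1)] far_F_q[OF f h'(1)] h(2) h'(2) by simp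
    finally show "ab_map (far F f) (x \<otimes>\<^bsub>Q X\<^esub> x') = ab_map (far F f) x \<otimes>\<^bsub>Q Y\<^esub> ab_map (far F f) x'" .
  qed
  then show ?thesis
    using HomD[OF f] Q[OF X] Q[OF Y] by (auto simp: F_def Hom_Ab ab_arrow_def ab_map_def)
qed

lemma functor_F: "is_functor C Ab F"
  unfolding is_functor_def
proof (intro conjI ballI allI impI)
  show "fob F \<in> obj C \<rightarrow>\<^sub>E obj Ab"
    using Q by (auto simp: F_def)
  have "far F f \<in> arr Ab" if "f \<in> arr C" for f
    by (rule Hom_arr[OF far_F_Hom[OF arr_Hom[OF that]]])
  then show "far F \<in> arr C \<rightarrow>\<^sub>E arr Ab"
    by (auto simp: F_def)
next
  fix X Y f assume f: "f \<in> Hom C X Y"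
  show "far F f \<in> Hom Ab (fob F X) (fob F Y)"
    using far_F_Hom[OF f] fob_F Hom_objD[OF C f] by simp
next
  fix X assume X: "X \<in> obj C"
  have "far F (ident C X) = ident Ab (Q X)"
  proof (rule Hom_Ab_eqI[OF far_F_Hom[OF ident_Hom[OF C X]] ident_Ab_Hom[OF Q[OF X]]])
    fix x assume x: "x \<in> carrier (Q X)"
    obtain h where h: "h \<in> Hom C M X" "x = q X h"
      using q_surj[OF X x] .
    show "ab_map (far F (ident C X)) x = ab_map (ident Ab (Q X)) x"
      using far_F_q[OF ident_Hom[OF C X] h(1)] cmp_ident_left[OF C h(1)] h(2) x by simp
  qed
  then show "far F (ident C X) = ident Ab (fob F X)"
    using fob_F[OF X] by simp
next
  fix X Y Z f f' assume f: "f \<in> Hom C X Y" and f': "f' \<in> Hom C Y Z"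
  show "far F (cmp C f' f) = cmp Ab (far F f') (far F f)"
  proof (rule Hom_Ab_eqI[OF far_F_Hom[OF cmp_Hom[OF C f f']] cmp_Ab_Hom[OF far_F_Hom[OF f] far_F_Hom[OF f']]])
    fix x assume x: "x \<in> carrier (Q X)"
    obtain h where h: "h \<in> Hom C M X" "x = q X h"
      using q_surj[OF conjunct1[OF Hom_objD[OF C f]] x] .
    show "ab_map (far F (cmp C f' f)) x = ab_map (cmp Ab (far F f') (far F f)) x"
      using far_F_q[OF cmp_Hom[OF C f f'] h(1)] ab_map_cmp[OF far_F_Hom[OF f] far_F_Hom[OF f'] x]
        far_F_q[OF f h(1)] far_F_q[OF f' cmp_Hom[OF C h(1) f]] cmp_assoc[OF C h(1) f f'] h(2) by simp
  qed
qed

text \<open>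
  A family in the product of the \<open>Hom(M, X\<^sub>i)\<close> is a map into the product \<open>P\<close>, and if each component satisfies the
  factorization condition then the factors \<open>v i\<close> combine to one \<open>w : L \<rightarrow> P\<close>.
\<close>

lemma preserves_products_F: "preserves_products TYPE('u) C Ab F"
  unfolding preserves_products_def
proof (intro allI impI)
  fix I :: "'u set" and X P \<pi>
  assume "small TYPE('u) I" and XI: "X ` I \<subseteq> obj C" and P: "is_product C I X P \<pi>"
  have X: "X i \<in> obj C" if "i \<in> I" for i
    using XI that by blast
  note P_obj = product_obj[OF P] and \<pi> = product_proj[OF P]
  have "is_product Ab I (\<lambda>i. fob F (X i)) (Q P) (\<lambda>i. far F (\<pi> i))"
  proof (rule is_product_AbI)
    show "small_ab_group (Q P)" by (rule Q[OF P_obj])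
    show "far F (\<pi> i) \<in> Hom Ab (Q P) (fob F (X i))" if "i \<in> I" for i
      using far_F_Hom[OF \<pi>[OF that]] fob_F[OF X[OF that]] by simp
  next
    fix x assume x: "x \<in> carrier (Q P)" and zero: "\<And>i. i \<in> I \<Longrightarrow> ab_map (far F (\<pi> i)) x = \<one>\<^bsub>fob F (X i)\<^esub>"
    obtain h where h: "h \<in> Hom C M P" "x = q P h"
      using q_surj[OF P_obj x] .
    have "\<exists>v. v \<in> Hom C L (X i) \<and> cmp C (cmp C (\<pi> i) h) u = cmp C v g" if i: "i \<in> I" for i
    proof -
      have "q (X i) (cmp C (\<pi> i) h) = \<one>\<^bsub>Q (X i)\<^esub>"
        using zero[OF i] far_F_q[OF \<pi>[OF i] h(1)] h(2) fob_F[OF X[OF i]] by simp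
      then have "cmp C (\<pi> i) h \<in> N (X i)"
        using q_kernel[OF X[OF i] cmp_Hom[OF C h(1) \<pi>[OF i]]] by blast
      then show ?thesis unfolding factoring_def by blast
    qed
    then obtain v where v: "\<And>i. i \<in> I \<Longrightarrow> v i \<in> Hom C L (X i)"
      "\<And>i. i \<in> I \<Longrightarrow> cmp C (cmp C (\<pi> i) h) u = cmp C (v i) g"
      by metis
    obtain w where w: "w \<in> Hom C L P" "\<And>i. i \<in> I \<Longrightarrow> cmp C (\<pi> i) w = v i"
      using product_pair[of C I X P \<pi> L v, OF P L v(1)] by metis
    have "cmp C h u = cmp C w g"
    proof (rule product_unique[OF C P cmp_Hom[OF C u h(1)] cmp_Hom[OF C g w(1)]])
      fix i assume i: "i \<in> I"
      show "cmp C (\<pi> i) (cmp C h u) = cmp C (\<pi> i) (cmp C w g)"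
        unfolding cmp_assoc[OF C u h(1) \<pi>[OF i]] cmp_assoc[OF C g w(1) \<pi>[OF i]] w(2)[OF i] v(2)[OF i] ..
    qed
    then have "h \<in> N P"
      unfolding factoring_def using h(1) w(1) by blast
    then show "x = \<one>\<^bsub>Q P\<^esub>"
      using q_kernel[OF P_obj h(1)] h(2) by blast
  next
    fix y assume y: "\<And>i. i \<in> I \<Longrightarrow> y i \<in> carrier (fob F (X i))"
    have "\<exists>h. h \<in> Hom C M (X i) \<and> y i = q (X i) h" if i: "i \<in> I" for i
    proof -
      have "y i \<in> carrier (Q (X i))" using y[OF i] fob_F[OF X[OF i]] by simp
      then show ?thesis using q_surj[OF X[OF i]] by blast
    qed
    then obtain h where h: "\<And>i. i \<in> I \<Longrightarrow> h i \<in> Hom C M (X i)" "\<And>i. i \<in> I \<Longrightarrow> y i = q (X i) (h i)"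
      by metis
    obtain k where k: "k \<in> Hom C M P" "\<And>i. i \<in> I \<Longrightarrow> cmp C (\<pi> i) k = h i"
      using product_pair[of C I X P \<pi> M h, OF P M h(1)] by metis
    have "ab_map (far F (\<pi> i)) (q P k) = y i" if i: "i \<in> I" for i
      unfolding far_F_q[OF \<pi>[OF i] k(1)] k(2)[OF i] h(2)[OF i] ..
    then show "\<exists>x\<in>carrier (Q P). \<forall>i\<in>I. ab_map (far F (\<pi> i)) x = y i"
      using q_closed[OF k(1)] by blast
  qed
  then show "is_product Ab I (\<lambda>i. fob F (X i)) (fob F P) (\<lambda>i. far F (\<pi> i))"
    unfolding fob_F[OF P_obj] .
qed

text \<open>
  Elements come from stages because \<open>M\<close> is presented. If \<open>h\<close> at stage \<open>i\<close> satisfies the factorization condition in the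
  colimit, the factor \<open>v\<close> comes from a stage because \<open>L\<close> is presented, and the equation between maps out of \<open>K\<close>
  holds at a later stage because \<open>K\<close> is presented.
\<close>

lemma preserves_directed_colimits_F: "preserves_directed_colimits TYPE('u) lam C Ab F"
  unfolding preserves_directed_colimits_def
proof (intro allI impI)
  fix I :: "'u set" and r D X \<iota>
  assume col: "is_directed_colimit TYPE('u) lam C I r D X \<iota>"
  let ?E = "comp_functor (poset_cat I r) F D"
  interpret S: ab_system I r ?E
    by (rule ab_system_comp[OF lam functor_F col])
  note order = directed_colimit_order[OF col] and D = directed_colimit_functor[OF col]
  note X = directed_colimit_obj[OF col] and \<iota> = directed_colimit_leg[OF col]
  have fob: "fob ?E i = Q (fob D i)" if "i \<in> I" for i
    using that fob_F[OF system_obj[OF order D that]] by (simp add: comp_functor_def)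
  have far: "far ?E (i, j) = far F (far D (i, j))" if "(i, j) \<in> r" for i j
    using that by (simp add: comp_functor_def)
  show "is_colimit (poset_cat I r) Ab ?E (fob F X) (\<lambda>i. far F (\<iota> i))"
    unfolding fob_F[OF X]
  proof (rule S.is_colimit_AbI)
    show "is_cocone (poset_cat I r) Ab ?E (Q X) (\<lambda>i. far F (\<iota> i))"
      unfolding is_cocone_def
    proof (intro conjI ballI)
      show "Q X \<in> obj Ab" using Q[OF X] by simp
      show "far F (\<iota> i) \<in> Hom Ab (fob ?E i) (Q X)" if "i \<in> obj (poset_cat I r)" for i
        using that fob far_F_Hom[OF \<iota>] by simp
      fix a assume a: "a \<in> arr (poset_cat I r)"
      obtain i j where ij: "a = (i, j)" "(i, j) \<in> r"
        using a by (cases a) auto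
      have j: "j \<in> I" using poset_carrier[OF order ij(2)] by blast
      have "cmp Ab (far F (\<iota> j)) (far ?E (i, j)) = far F (\<iota> i)"
        unfolding far[OF ij(2)] far_cmp[OF functor_F system_Hom[OF order D ij(2)] \<iota>[OF j], symmetric]
          directed_colimit_commute[OF col ij(2)] ..
      then show "cmp Ab (far F (\<iota> (tgt (poset_cat I r) a))) (far ?E a) = far F (\<iota> (src (poset_cat I r) a))"
        using ij by simp
    qed
  next
    fix x assume x: "x \<in> carrier (Q X)"
    obtain h where h: "h \<in> Hom C M X" "x = q X h"
      using q_surj[OF X x] .
    obtain i k where i: "i \<in> I" and k: "k \<in> Hom C M (fob D i)" and hk: "h = cmp C (\<iota> i) k"
      using presented_factor[OF presented(3) C col h(1)] by blast
    have "x = ab_map (far F (\<iota> i)) (q (fob D i) k)"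
      unfolding far_F_q[OF \<iota>[OF i] k] h(2) hk ..
    moreover have "q (fob D i) k \<in> carrier (fob ?E i)"
      using q_closed[OF k] fob[OF i] by simp
    ultimately show "\<exists>i\<in>I. \<exists>y\<in>carrier (fob ?E i). x = ab_map (far F (\<iota> i)) y"
      using i by blast
  next
    fix i y assume i: "i \<in> I" and y: "y \<in> carrier (fob ?E i)" and zero: "ab_map (far F (\<iota> i)) y = \<one>\<^bsub>Q X\<^esub>"
    note Di = system_obj[OF order D]
    have "y \<in> carrier (Q (fob D i))" using y fob[OF i] by simp
    then obtain h where h: "h \<in> Hom C M (fob D i)" "y = q (fob D i) h"
      using q_surj[OF Di[OF i]] by blast
    note \<iota>h = cmp_Hom[OF C h(1) \<iota>[OF i]]
    have "cmp C (\<iota> i) h \<in> N X"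
      using zero far_F_q[OF \<iota>[OF i] h(1)] h(2) q_kernel[OF X \<iota>h] by simp
    then obtain v where v: "v \<in> Hom C L X" "cmp C (cmp C (\<iota> i) h) u = cmp C v g"
      unfolding factoring_def by blast
    obtain j w where j: "j \<in> I" and w: "w \<in> Hom C L (fob D j)" and vw: "v = cmp C (\<iota> j) w"
      using presented_factor[OF presented(2) C col v(1)] by blast
    obtain k where k: "(i, k) \<in> r" "(j, k) \<in> r"
      using S.upper_bound[OF i j] by blast
    have kI: "k \<in> I" using poset_carrier[OF order k(1)] by blast
    note Dik = system_Hom[OF order D k(1)] and Djk = system_Hom[OF order D k(2)]
    let ?a = "cmp C (cmp C (far D (i, k)) h) u" and ?b = "cmp C (cmp C (far D (j, k)) w) g"
    note hk = cmp_Hom[OF C h(1) Dik] and wk = cmp_Hom[OF C w Djk]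
    have "cmp C (\<iota> k) ?a = cmp C (\<iota> k) ?b"
    proof -
      have "cmp C (\<iota> k) ?a = cmp C (cmp C (\<iota> i) h) u"
        unfolding cmp_assoc[OF C u hk \<iota>[OF kI]] cmp_assoc[OF C h(1) Dik \<iota>[OF kI]]
          directed_colimit_commute[OF col k(1)] ..
      moreover have "cmp C (\<iota> k) ?b = cmp C (cmp C (\<iota> j) w) g"
        unfolding cmp_assoc[OF C g wk \<iota>[OF kI]] cmp_assoc[OF C w Djk \<iota>[OF kI]]
          directed_colimit_commute[OF col k(2)] ..
      ultimately show ?thesis
        using v(2) vw by simp
    qed
    then obtain l where l: "(k, l) \<in> r" "cmp C (far D (k, l)) ?a = cmp C (far D (k, l)) ?b"
      using presented_eq[OF presented(1) C col lam kI cmp_Hom[OF C u hk] cmp_Hom[OF C g wk]] by blast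
    note Dkl = system_Hom[OF order D l(1)]
    have il: "(i, l) \<in> r" and jl: "(j, l) \<in> r"
      using poset_trans[OF order _ l(1)] k by auto
    have lI: "l \<in> I" using poset_carrier[OF order il] by blast
    have "cmp C (cmp C (far D (i, l)) h) u = cmp C (cmp C (far D (j, l)) w) g"
      using l(2) unfolding cmp_assoc[OF C u hk Dkl] cmp_assoc[OF C h(1) Dik Dkl]
        cmp_assoc[OF C g wk Dkl] cmp_assoc[OF C w Djk Dkl]
        system_cmp[OF order D k(1) l(1)] system_cmp[OF order D k(2) l(1)] .
    moreover note hl = cmp_Hom[OF C h(1) system_Hom[OF order D il]]
    ultimately have "cmp C (far D (i, l)) h \<in> N (fob D l)"
      unfolding factoring_def using cmp_Hom[OF C w system_Hom[OF order D jl]] by blast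
    then have "ab_map (far F (far D (i, l))) y = \<one>\<^bsub>Q (fob D l)\<^esub>"
      unfolding h(2) far_F_q[OF system_Hom[OF order D il] h(1)] q_kernel[OF Di[OF lI] hl] .
    then show "\<exists>l. (i, l) \<in> r \<and> ab_map (far ?E (i, l)) y = \<one>\<^bsub>fob ?E l\<^esub>"
      using il far[OF il] fob[OF lI] by auto
  qed
qed

lemma F_fun_obj: "F \<in> fun_obj lam C"
  using functor_F preserves_products_F preserves_directed_colimits_F by (simp add: fun_obj_def)

lemma trivial_F:
  assumes X: "X \<in> obj C"
  shows "trivial_group (fob F X) \<longleftrightarrow> Hom C M X \<subseteq> N X"
proof -
  interpret QX: group "Q X" by (rule small_ab_groupD(2)[OF Q[OF X]])
  have "trivial_group (fob F X) \<longleftrightarrow> carrier (Q X) \<subseteq> {\<one>\<^bsub>Q X\<^esub>}"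
    unfolding fob_F[OF X] by (rule QX.trivial_group_subset)
  also have "\<dots> \<longleftrightarrow> (\<forall>h\<in>Hom C M X. q X h = \<one>\<^bsub>Q X\<^esub>)"
    unfolding q_image[OF X, symmetric] by blast
  also have "\<dots> \<longleftrightarrow> Hom C M X \<subseteq> N X"
    using q_kernel[OF X] by blast
  finally show ?thesis .
qed

end

lemma factoring_functor_exists:
  fixes lam :: "'l rel" and C :: "('o, 'm) cat"
  assumes lam: "infinite_regular_cardinal lam" and C: "category C"
    and ls: "locally_small TYPE('u) C" and \<Gamma>: "preadditive_structure C \<Gamma>"
    and presented: "presented TYPE('u) lam C K" "presented TYPE('u) lam C L" "presented TYPE('u) lam C M"
    and g: "g \<in> Hom C K L" and u: "u \<in> Hom C K M"
  obtains F :: "('o, 'm, 'u) ab_functor" where "F \<in> fun_obj lam C"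
    "\<forall>X\<in>obj C. trivial_group (fob F X) \<longleftrightarrow> Hom C M X \<subseteq> factoring C L M g u X"
proof -
  have M: "M \<in> obj C"
    using Hom_objD[OF C u] by blast
  have "\<exists>Qq. small_ab_group (fst Qq :: 'u monoid) \<and> snd Qq \<in> hom (\<Gamma> M X) (fst Qq) \<and>
      snd Qq ` Hom C M X = carrier (fst Qq) \<and>
      (\<forall>h\<in>Hom C M X. snd Qq h = \<one>\<^bsub>fst Qq\<^esub> \<longleftrightarrow> h \<in> factoring C L M g u X)" if X: "X \<in> obj C" for X
  proof -
    note carrier = carrier_Hom[OF \<Gamma> M X]
    have small: "small TYPE('u) (carrier (\<Gamma> M X))"
      unfolding carrier using ls M X unfolding locally_small_def by blast
    obtain Q :: "'u monoid" and q where "small_ab_group Q" "q \<in> hom (\<Gamma> M X) Q"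
      "q ` carrier (\<Gamma> M X) = carrier Q"
      "\<forall>h\<in>carrier (\<Gamma> M X). q h = \<one>\<^bsub>Q\<^esub> \<longleftrightarrow> h \<in> factoring C L M g u X"
      using small_quotient_group[OF Hom_comm_group[OF \<Gamma> M X] small factoring_subgroup[OF \<Gamma> C g u X]] .
    then show ?thesis
      unfolding carrier by (intro exI[of _ "(Q, q)"]) simp
  qed
  then obtain Qq where Qq: "\<And>X. X \<in> obj C \<Longrightarrow> small_ab_group (fst (Qq X) :: 'u monoid) \<and>
      snd (Qq X) \<in> hom (\<Gamma> M X) (fst (Qq X)) \<and> snd (Qq X) ` Hom C M X = carrier (fst (Qq X)) \<and>
      (\<forall>h\<in>Hom C M X. snd (Qq X) h = \<one>\<^bsub>fst (Qq X)\<^esub> \<longleftrightarrow> h \<in> factoring C L M g u X)"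
    by metis
  interpret factoring_quotient lam C \<Gamma> K L M g u "\<lambda>X. fst (Qq X)" "\<lambda>X. snd (Qq X)"
    by unfold_locales (use lam C \<Gamma> presented g u Qq in blast)+
  show thesis
    by (rule that[OF F_fun_obj]) (simp add: trivial_F)
qed

section \<open>Reduced products and pure embeddings\<close>

text \<open>
  The reduced product \<open>colim\<^sub>k (\<Prod>j. B\<^sub>j)\<close>, where \<open>j\<close> runs through the indices \<open>j \<ge> k\<close> in \<open>S\<close>, with the
  restrictions as transition maps. Indexing by all \<open>k \<in> I\<close>, while the factors are only given on \<open>S\<close>,
  allows the colimit to be compared with other colimits over \<open>I\<close>.
\<close>

lemma reduced_product_exists:
  fixes C :: "('o, 'm) cat" and I :: "'u set" and B :: "'u \<Rightarrow> 'o"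
  assumes U: "universe TYPE('u)" and lp: "locally_presentable TYPE('u) lam C"
    and \<D>: "\<D> \<subseteq> obj C" and closed_prod: "closed_under_products TYPE('u) C \<D>"
    and closed_colim: "closed_under_directed_colimits TYPE('u) lam C \<D>"
    and I: "small TYPE('u) I" and dir: "directed_poset lam I r"
    and S: "S \<subseteq> I" and B: "\<forall>j\<in>S. B j \<in> \<D>"
  obtains E R \<rho> \<pi> where "is_directed_colimit TYPE('u) lam C I r E R \<rho>" "R \<in> \<D>"
    "\<forall>k\<in>I. is_product C {j\<in>S. (k, j) \<in> r} B (fob E k) (\<pi> k)"
    "\<forall>k l j. (k, l) \<in> r \<longrightarrow> j \<in> S \<longrightarrow> (l, j) \<in> r \<longrightarrow> cmp C (\<pi> l j) (far E (k, l)) = \<pi> k j"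
proof -
  have C: "category C" and cocomp: "cocomplete TYPE('u) C"
    using lp unfolding locally_presentable_def by blast+
  have order: "partial_order_on I r"
    using dir unfolding directed_poset_def by blast
  note trans = poset_trans[OF order] and in_I = poset_carrier[OF order]
  let ?T = "\<lambda>k. {j\<in>S. (k, j) \<in> r}"
  have T_small: "small TYPE('u) (?T k)" for k
    by (rule small_subset[OF I]) (use S in blast)
  have BT: "\<forall>j\<in>?T k. B j \<in> obj C" for k
    using B \<D> by blast
  have "\<exists>p. is_product C (?T k) B (fst p) (snd p)" for k
  proof -
    obtain P \<pi> where "is_product C (?T k) B P \<pi>"
      using presentable_product_exists[OF U lp T_small BT] .
    then show ?thesis by (intro exI[of _ "(P, \<pi>)"]) simp
  qed
  then obtain p where p: "\<And>k. is_product C (?T k) B (fst (p k)) (snd (p k))"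
    by metis
  define P where "P k = fst (p k)" for k
  define \<pi> where "\<pi> k = snd (p k)" for k
  have P: "is_product C (?T k) B (P k) (\<pi> k)" for k
    using p unfolding P_def \<pi>_def by simp
  note P_obj = product_obj[OF P]
  have P\<D>: "P k \<in> \<D>" for k
    using closed_under_products_small[OF closed_prod T_small _ P] B by blast
  have \<pi>: "\<pi> k j \<in> Hom C (P k) (B j)" if "j \<in> S" "(k, j) \<in> r" for k j
    using product_proj[OF P, of j k] that by simp
  have e_ex: "\<exists>e. e \<in> Hom C (P k) (P l) \<and> (\<forall>j\<in>?T l. cmp C (\<pi> l j) e = \<pi> k j)"
    if kl: "(k, l) \<in> r" for k l
  proof -
    have "\<pi> k j \<in> Hom C (P k) (B j)" if "j \<in> ?T l" for j
      using that \<pi>[of j k] trans[OF kl] by blast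
    from product_ex1[OF P P_obj this, of l] show ?thesis by blast
  qed
  define e where "e k l = (SOME e. e \<in> Hom C (P k) (P l) \<and> (\<forall>j\<in>?T l. cmp C (\<pi> l j) e = \<pi> k j))" for k l
  have e_both: "e k l \<in> Hom C (P k) (P l) \<and> (\<forall>j\<in>?T l. cmp C (\<pi> l j) (e k l) = \<pi> k j)"
    if "(k, l) \<in> r" for k l
    unfolding e_def by (rule someI_ex[OF e_ex[OF that]])
  note e = conjunct1[OF e_both] and e_\<pi> = bspec[OF conjunct2[OF e_both]]
  define E where "E = \<lparr>fob = (\<lambda>k\<in>I. P k), far = (\<lambda>a\<in>r. e (fst a) (snd a))\<rparr>"
  have fob: "fob E k = P k" if "k \<in> I" for k
    using that by (simp add: E_def)
  have far: "far E (k, l) = e k l" if "(k, l) \<in> r" for k l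
    using that by (simp add: E_def)
  have e_id: "e k k = ident C (P k)" if k: "k \<in> I" for k
  proof (rule product_unique[OF C P e[OF poset_refl[OF order k]] ident_Hom[OF C P_obj]])
    fix j assume j: "j \<in> ?T k"
    show "cmp C (\<pi> k j) (e k k) = cmp C (\<pi> k j) (ident C (P k))"
      using e_\<pi>[OF poset_refl[OF order k] j] cmp_ident_right[OF C \<pi>] j by simp
  qed
  have e_cmp: "e k m = cmp C (e l m) (e k l)" if kl: "(k, l) \<in> r" and lm: "(l, m) \<in> r" for k l m
  proof (rule product_unique[OF C P e[OF trans[OF kl lm]] cmp_Hom[OF C e[OF kl] e[OF lm]]])
    fix j assume j: "j \<in> ?T m"
    then have jS: "j \<in> S" and mj: "(m, j) \<in> r" by auto
    have j': "j \<in> ?T l" using jS trans[OF lm mj] by blast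
    show "cmp C (\<pi> m j) (e k m) = cmp C (\<pi> m j) (cmp C (e l m) (e k l))"
      unfolding cmp_assoc[OF C e[OF kl] e[OF lm] \<pi>[OF jS mj]] e_\<pi>[OF lm j] e_\<pi>[OF kl j']
        e_\<pi>[OF trans[OF kl lm] j] ..
  qed
  have E: "is_functor (poset_cat I r) C E"
    unfolding is_functor_def
  proof (intro conjI ballI allI impI)
    show "fob E \<in> obj (poset_cat I r) \<rightarrow>\<^sub>E obj C"
      using P_obj by (simp add: E_def)
    show "far E \<in> arr (poset_cat I r) \<rightarrow>\<^sub>E arr C"
      using Hom_arr[OF e] by (auto simp: E_def)
  next
    fix k l a assume "a \<in> Hom (poset_cat I r) k l"
    then have a: "a = (k, l)" "(k, l) \<in> r" by (auto simp: Hom_poset_cat)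
    show "far E a \<in> Hom C (fob E k) (fob E l)"
      using a(1) far[OF a(2)] e[OF a(2)] fob in_I[OF a(2)] by simp
  next
    fix k assume "k \<in> obj (poset_cat I r)"
    then have k: "k \<in> I" by simp
    have "ident (poset_cat I r) k = (k, k)" by (simp add: poset_cat_def)
    then show "far E (ident (poset_cat I r) k) = ident C (fob E k)"
      using far[OF poset_refl[OF order k]] e_id[OF k] fob[OF k] by simp
  next
    fix k l m a b assume "a \<in> Hom (poset_cat I r) k l" "b \<in> Hom (poset_cat I r) l m"
    then have a: "a = (k, l)" "(k, l) \<in> r" and b: "b = (l, m)" "(l, m) \<in> r"
      by (auto simp: Hom_poset_cat)
    have "cmp (poset_cat I r) b a = (k, m)"
      using a b by (simp add: poset_cat_def)
    then show "far E (cmp (poset_cat I r) b a) = cmp C (far E b) (far E a)"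
      using a(1) b(1) far[OF a(2)] far[OF b(2)] far[OF trans[OF a(2) b(2)]] e_cmp[OF a(2) b(2)] by simp
  qed
  have "r \<subseteq> I \<times> I"
    using in_I by auto
  then have r_small: "small TYPE('u) r"
    using small_subset[OF small_Sigma[OF U I I]] by blast
  obtain R \<rho> where R: "is_colimit (poset_cat I r) C E R \<rho>"
    by (rule cocomplete_any_small_category[OF cocomp category_poset_cat[OF order] _ _ E])
      (simp_all add: I r_small)
  then have col: "is_directed_colimit TYPE('u) lam C I r E R \<rho>"
    unfolding is_directed_colimit_def using I dir E by blast
  have E\<D>: "fob E ` I \<subseteq> \<D>"
    using P\<D> fob by auto
  have R\<D>: "R \<in> \<D>"
    using closed_colim col E\<D> unfolding closed_under_directed_colimits_def by blast
  have prod: "\<forall>k\<in>I. is_product C (?T k) B (fob E k) (\<pi> k)"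
    using P fob by simp
  have trans_\<pi>: "\<forall>k l j. (k, l) \<in> r \<longrightarrow> j \<in> S \<longrightarrow> (l, j) \<in> r \<longrightarrow> cmp C (\<pi> l j) (far E (k, l)) = \<pi> k j"
    using e_\<pi> far by simp
  show thesis
    by (rule that[OF col R\<D> prod trans_\<pi>])
qed

text \<open>
  In terms of functors: each factorization functor that vanishes on \<open>\<D>\<close> also vanishes at \<open>A\<close>.
\<close>

definition inherits_factorizations ::
    "'u itself \<Rightarrow> 'l rel \<Rightarrow> ('o, 'm) cat \<Rightarrow> 'o set \<Rightarrow> 'o \<Rightarrow> bool" where
  "inherits_factorizations U lam C \<D> A \<longleftrightarrow>
     (\<forall>K L M g u. presented U lam C K \<longrightarrow> presented U lam C L \<longrightarrow> presented U lam C M \<longrightarrow>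
        g \<in> Hom C K L \<longrightarrow> u \<in> Hom C K M \<longrightarrow>
        (\<forall>B\<in>\<D>. Hom C M B \<subseteq> factoring C L M g u B) \<longrightarrow> Hom C M A \<subseteq> factoring C L M g u A)"

text \<open>
  Write \<open>u\<close> as \<open>\<iota> j\<close> after \<open>w j : K \<rightarrow> fob D j\<close> for all \<open>j \<ge> i\<close>. It suffices that for one such \<open>j\<close> all maps from
  \<open>fob D j\<close> to objects of \<open>\<D>\<close> satisfy the factorization condition for \<open>w j\<close>: then so does \<open>\<iota> j : fob D j \<rightarrow> A\<close>.
  Otherwise choose maps \<open>h j : fob D j \<rightarrow> B j\<close> that violate it; they assemble to a map \<open>f\<close> from \<open>A\<close> to the reduced
  product of the \<open>B j\<close>, and the factorization of \<open>f u\<close> through \<open>g\<close> descends to one of the \<open>h l\<close>.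
\<close>

lemma factors_if_all_into_definable_factor:
  fixes C :: "('o, 'm) cat"
  assumes U: "universe TYPE('u)" and lam: "infinite_regular_cardinal lam"
    and lp: "locally_presentable TYPE('u) lam C"
    and \<D>: "definable_subcategory TYPE('u) lam C \<D>"
    and A: "A \<in> obj C"
    and test: "inherits_factorizations TYPE('u) lam C \<D> A"
    and K: "presented TYPE('u) lam C K" and L: "presented TYPE('u) lam C L"
    and g: "g \<in> Hom C K L" and u: "u \<in> Hom C K A"
    and all: "\<forall>B\<in>\<D>. Hom C A B \<subseteq> factoring C L A g u B"
  shows "\<exists>v\<in>Hom C L A. u = cmp C v g"
proof -
  have C: "category C"
    using lp unfolding locally_presentable_def by (elim conjE)
  have \<D>_obj: "\<D> \<subseteq> obj C" and closed_prod: "closed_under_products TYPE('u) C \<D>"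
    and closed_colim: "closed_under_directed_colimits TYPE('u) lam C \<D>"
    using \<D> unfolding definable_subcategory_def by blast+
  obtain G where G: "small TYPE('u) G" "\<forall>A\<in>G. presented TYPE('u) lam C A"
    and gen: "\<forall>T\<in>obj C. \<exists>(K :: 'u set) r D \<iota>.
       is_directed_colimit TYPE('u) lam C K r D T \<iota> \<and> fob D ` K \<subseteq> G"
    using presentable_generators[OF lp] .
  obtain I :: "'u set" and r D \<iota> where col: "is_directed_colimit TYPE('u) lam C I r D A \<iota>"
    and DG: "fob D ` I \<subseteq> G"
    using bspec[OF gen A] by (elim exE conjE)
  note order = directed_colimit_order[OF col] and D = directed_colimit_functor[OF col]
  note dir = directed_colimit_directed[OF col]
  note trans = poset_trans[OF order] and in_I = poset_carrier[OF order]
  note D_Hom = system_Hom[OF order D] and \<iota> = directed_colimit_leg[OF col]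
  have D_presented: "presented TYPE('u) lam C (fob D j)" if "j \<in> I" for j
    using G(2) DG that by blast
  obtain i u0 where i: "i \<in> I" and u0: "u0 \<in> Hom C K (fob D i)" and u_eq: "u = cmp C (\<iota> i) u0"
    using presented_factor[OF K C col u] by blast
  define w where "w j = cmp C (far D (i, j)) u0" for j
  have w: "w j \<in> Hom C K (fob D j)" if "(i, j) \<in> r" for j
    unfolding w_def by (rule cmp_Hom[OF C u0 D_Hom[OF that]])
  have w_trans: "cmp C (far D (j, k)) (w j) = w k" if "(i, j) \<in> r" "(j, k) \<in> r" for j k
    unfolding w_def cmp_assoc[OF C u0 D_Hom[OF that(1)] D_Hom[OF that(2)]] system_cmp[OF order D that] ..
  have \<iota>w: "cmp C (\<iota> j) (w j) = u" if "(i, j) \<in> r" for j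
    unfolding w_def cmp_assoc[OF C u0 D_Hom[OF that] \<iota>[OF conjunct2[OF in_I[OF that]]]]
      directed_colimit_commute[OF col that] u_eq ..
  have "\<exists>j. (i, j) \<in> r \<and> (\<forall>B\<in>\<D>. Hom C (fob D j) B \<subseteq> factoring C L (fob D j) g (w j) B)"
  proof (rule ccontr)
    assume no: "\<not> ?thesis"
    let ?S = "{j. (i, j) \<in> r}"
    have "\<exists>B h. (i, j) \<in> r \<longrightarrow> B \<in> \<D> \<and> h \<in> Hom C (fob D j) B \<and> h \<notin> factoring C L (fob D j) g (w j) B" for j
      using no by blast
    then obtain B h where B\<D>: "\<And>j. (i, j) \<in> r \<Longrightarrow> B j \<in> \<D>"
      and h: "\<And>j. (i, j) \<in> r \<Longrightarrow> h j \<in> Hom C (fob D j) (B j)"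
      and bad: "\<And>j. (i, j) \<in> r \<Longrightarrow> h j \<notin> factoring C L (fob D j) g (w j) (B j)"
      by metis
    have S: "?S \<subseteq> I" "\<forall>j\<in>?S. B j \<in> \<D>"
      using in_I B\<D> by auto
    obtain E R \<rho> \<pi> where colR: "is_directed_colimit TYPE('u) lam C I r E R \<rho>" and R\<D>: "R \<in> \<D>"
      and prod: "\<forall>k\<in>I. is_product C {j\<in>?S. (k, j) \<in> r} B (fob E k) (\<pi> k)"
      and \<pi>_trans: "\<forall>k l j. (k, l) \<in> r \<longrightarrow> j \<in> ?S \<longrightarrow> (l, j) \<in> r \<longrightarrow> cmp C (\<pi> l j) (far E (k, l)) = \<pi> k j"
      using reduced_product_exists[OF U lp \<D>_obj closed_prod closed_colim
          directed_colimit_small[OF col] dir S] .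
    note E = directed_colimit_functor[OF colR]
    note E_Hom = system_Hom[OF order E] and \<rho> = directed_colimit_leg[OF colR]
    have \<pi>: "\<pi> k j \<in> Hom C (fob E k) (B j)" if "(i, j) \<in> r" "(k, j) \<in> r" for k j
      using product_proj[OF bspec[OF prod conjunct1[OF in_I[OF that(2)]]]] that by simp
    have "\<exists>\<theta>. k \<in> I \<longrightarrow> \<theta> \<in> Hom C (fob D k) (fob E k) \<and>
        (\<forall>j. (i, j) \<in> r \<longrightarrow> (k, j) \<in> r \<longrightarrow> cmp C (\<pi> k j) \<theta> = cmp C (h j) (far D (k, j)))" for k
    proof (cases "k \<in> I")
      case True
      have "cmp C (h j) (far D (k, j)) \<in> Hom C (fob D k) (B j)" if "j \<in> {j\<in>?S. (k, j) \<in> r}" for j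
        using that cmp_Hom[OF C D_Hom[of k j] h[of j]] by simp
      from product_ex1[OF bspec[OF prod True] system_obj[OF order D True] this]
      show ?thesis by auto
    qed blast
    then obtain \<theta> where \<theta>: "\<And>k. k \<in> I \<Longrightarrow> \<theta> k \<in> Hom C (fob D k) (fob E k)"
      and \<pi>\<theta>: "\<And>k j. k \<in> I \<Longrightarrow> (i, j) \<in> r \<Longrightarrow> (k, j) \<in> r \<Longrightarrow>
        cmp C (\<pi> k j) (\<theta> k) = cmp C (h j) (far D (k, j))"
      by metis
    have \<theta>_natural: "cmp C (\<theta> l) (far D (k, l)) = cmp C (far E (k, l)) (\<theta> k)" if kl: "(k, l) \<in> r" for k l
    proof -
      have k: "k \<in> I" and l: "l \<in> I" using in_I[OF kl] by auto
      show ?thesis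
      proof (rule product_unique[OF C bspec[OF prod l] cmp_Hom[OF C D_Hom[OF kl] \<theta>[OF l]]
            cmp_Hom[OF C \<theta>[OF k] E_Hom[OF kl]]])
        fix j assume "j \<in> {j\<in>?S. (l, j) \<in> r}"
        then have ij: "(i, j) \<in> r" and lj: "(l, j) \<in> r" by auto
        have "cmp C (\<pi> l j) (cmp C (\<theta> l) (far D (k, l))) = cmp C (h j) (far D (k, j))"
          unfolding cmp_assoc[OF C D_Hom[OF kl] \<theta>[OF l] \<pi>[OF ij lj]] \<pi>\<theta>[OF l ij lj]
            cmp_assoc[OF C D_Hom[OF kl] D_Hom[OF lj] h[OF ij], symmetric] system_cmp[OF order D kl lj] ..
        also have "\<dots> = cmp C (\<pi> k j) (\<theta> k)"
          unfolding \<pi>\<theta>[OF k ij trans[OF kl lj]] ..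
        also have "\<dots> = cmp C (cmp C (\<pi> l j) (far E (k, l))) (\<theta> k)"
          using \<pi>_trans kl ij lj by simp
        also have "\<dots> = cmp C (\<pi> l j) (cmp C (far E (k, l)) (\<theta> k))"
          unfolding cmp_assoc[OF C \<theta>[OF k] E_Hom[OF kl] \<pi>[OF ij lj]] ..
        finally show "cmp C (\<pi> l j) (cmp C (\<theta> l) (far D (k, l))) =
          cmp C (\<pi> l j) (cmp C (far E (k, l)) (\<theta> k))" .
      qed
    qed
    have "is_cocone (poset_cat I r) C D R (\<lambda>k. cmp C (\<rho> k) (\<theta> k))"
      unfolding is_cocone_def
    proof (intro conjI ballI)
      show "R \<in> obj C" by (rule directed_colimit_obj[OF colR])
      show "cmp C (\<rho> k) (\<theta> k) \<in> Hom C (fob D k) R" if "k \<in> obj (poset_cat I r)" for k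
        using cmp_Hom[OF C \<theta> \<rho>] that by simp
      fix a assume a: "a \<in> arr (poset_cat I r)"
      obtain k l where kl: "a = (k, l)" "(k, l) \<in> r"
        using a by (cases a) auto
      have k: "k \<in> I" and l: "l \<in> I" using in_I[OF kl(2)] by auto
      have "cmp C (cmp C (\<rho> l) (\<theta> l)) (far D (k, l)) = cmp C (\<rho> k) (\<theta> k)"
        unfolding cmp_assoc[OF C D_Hom[OF kl(2)] \<theta>[OF l] \<rho>[OF l], symmetric] \<theta>_natural[OF kl(2)]
          cmp_assoc[OF C \<theta>[OF k] E_Hom[OF kl(2)] \<rho>[OF l]] directed_colimit_commute[OF colR kl(2)] ..
      then show "cmp C (cmp C (\<rho> (tgt (poset_cat I r) a)) (\<theta> (tgt (poset_cat I r) a))) (far D a) =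
          cmp C (\<rho> (src (poset_cat I r) a)) (\<theta> (src (poset_cat I r) a))"
        using kl by simp
    qed
    from colimit_factor[OF directed_colimit_colimit[OF col] this]
    obtain f where f: "f \<in> Hom C A R" "\<And>k. k \<in> I \<Longrightarrow> cmp C f (\<iota> k) = cmp C (\<rho> k) (\<theta> k)"
      by (metis obj_poset_cat)
    obtain v where v: "v \<in> Hom C L R" and fu: "cmp C f u = cmp C v g"
      using bspec[OF all R\<D>] f(1) unfolding factoring_def by blast
    obtain k0 v0 where k0: "k0 \<in> I" and v0: "v0 \<in> Hom C L (fob E k0)" and v_eq: "v = cmp C (\<rho> k0) v0"
      using presented_factor[OF L C colR v] by blast
    obtain k where k: "k \<in> I" "(i, k) \<in> r" "(k0, k) \<in> r"
      using directed_upper_bound[OF lam dir i k0] .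
    note wk = w[OF k(2)] and vk = cmp_Hom[OF C v0 E_Hom[OF k(3)]]
    have "cmp C (\<rho> k) (cmp C (\<theta> k) (w k)) = cmp C f u"
      unfolding cmp_assoc[OF C wk \<theta>[OF k(1)] \<rho>[OF k(1)]] f(2)[OF k(1), symmetric]
        cmp_assoc[OF C wk \<iota>[OF k(1)] f(1), symmetric] \<iota>w[OF k(2)] ..
    moreover have "cmp C (\<rho> k) (cmp C (cmp C (far E (k0, k)) v0) g) = cmp C v g"
      unfolding cmp_assoc[OF C g vk \<rho>[OF k(1)]] cmp_assoc[OF C v0 E_Hom[OF k(3)] \<rho>[OF k(1)]]
        directed_colimit_commute[OF colR k(3)] v_eq ..
    ultimately obtain l where kl: "(k, l) \<in> r" and eq:
        "cmp C (far E (k, l)) (cmp C (\<theta> k) (w k)) =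
         cmp C (far E (k, l)) (cmp C (cmp C (far E (k0, k)) v0) g)"
      using presented_eq[OF K C colR lam k(1) cmp_Hom[OF C wk \<theta>[OF k(1)]] cmp_Hom[OF C g vk]] fu
      by metis
    \<comment> \<open>Projecting to the component \<open>l\<close> of stage \<open>l\<close> turns the equation into a factorization of \<open>h l\<close> after \<open>w l\<close>.\<close>
    have il: "(i, l) \<in> r" by (rule trans[OF k(2) kl])
    have l: "l \<in> I" using in_I[OF il] by blast
    have ll: "(l, l) \<in> r" by (rule poset_refl[OF order l])
    define v1 where "v1 = cmp C (far E (k, l)) (cmp C (far E (k0, k)) v0)"
    have v1: "v1 \<in> Hom C L (fob E l)"
      unfolding v1_def by (rule cmp_Hom[OF C vk E_Hom[OF kl]])
    have "cmp C (\<theta> l) (w l) = cmp C v1 g"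
      unfolding w_trans[OF k(2) kl, symmetric] cmp_assoc[OF C wk D_Hom[OF kl] \<theta>[OF l]]
        \<theta>_natural[OF kl] cmp_assoc[OF C wk \<theta>[OF k(1)] E_Hom[OF kl], symmetric] eq
        v1_def cmp_assoc[OF C g vk E_Hom[OF kl]] ..
    moreover have "cmp C (\<pi> l l) (cmp C (\<theta> l) (w l)) = cmp C (h l) (w l)"
      unfolding cmp_assoc[OF C w[OF il] \<theta>[OF l] \<pi>[OF il ll]] \<pi>\<theta>[OF l il ll]
        system_refl[OF order D l] cmp_ident_right[OF C h[OF il]] ..
    ultimately have "cmp C (h l) (w l) = cmp C (cmp C (\<pi> l l) v1) g"
      unfolding cmp_assoc[OF C g v1 \<pi>[OF il ll], symmetric] by simp
    then have "h l \<in> factoring C L (fob D l) g (w l) (B l)"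
      unfolding factoring_def using h[OF il] cmp_Hom[OF C v1 \<pi>[OF il ll]] by blast
    then show False
      using bad[OF il] by blast
  qed
  then obtain j where j: "(i, j) \<in> r"
    and good: "\<forall>B\<in>\<D>. Hom C (fob D j) B \<subseteq> factoring C L (fob D j) g (w j) B"
    by blast
  have jI: "j \<in> I" using in_I[OF j] by blast
  have "\<iota> j \<in> factoring C L (fob D j) g (w j) A"
    using test[unfolded inherits_factorizations_def, rule_format, OF K L D_presented[OF jI] g w[OF j]]
      good \<iota>[OF jI] by blast
  then show ?thesis
    using \<iota>w[OF j] unfolding factoring_def by auto
qed

text \<open>
  Every presented object is a retract of a generator, because its identity factors through a stage of its
  presentation as a directed colimit. A test \<open>g : K \<rightarrow> L\<close> is thus a retract of a test between generators.
\<close>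

lemma pure_if_pure_for_generators:
  fixes C :: "('o, 'm) cat"
  assumes C: "category C" and f: "f \<in> Hom C A B"
    and G: "\<forall>A\<in>G. presented TYPE('u) lam C A"
    and gen: "\<forall>T\<in>obj C. \<exists>(K :: 'u set) r D \<iota>.
       is_directed_colimit TYPE('u) lam C K r D T \<iota> \<and> fob D ` K \<subseteq> G"
    and test: "\<And>K L g u. K \<in> G \<Longrightarrow> L \<in> G \<Longrightarrow> g \<in> Hom C K L \<Longrightarrow> u \<in> Hom C K A \<Longrightarrow>
      \<exists>v\<in>Hom C L B. cmp C f u = cmp C v g \<Longrightarrow> \<exists>w\<in>Hom C L A. u = cmp C w g"
  shows "pure TYPE('u) lam C A B f"
  unfolding pure_def
proof (intro conjI allI impI)
  show "f \<in> Hom C A B" by (rule f)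
  have retract: "\<exists>P\<in>G. \<exists>s\<in>Hom C K P. \<exists>p\<in>Hom C P K. cmp C p s = ident C K"
    if K: "presented TYPE('u) lam C K" for K
  proof -
    have obj: "K \<in> obj C"
      using K unfolding presented_def by blast
    obtain I :: "'u set" and r D \<iota> where col: "is_directed_colimit TYPE('u) lam C I r D K \<iota>"
      and DG: "fob D ` I \<subseteq> G"
      using bspec[OF gen obj] by (elim exE conjE)
    obtain i s where i: "i \<in> I" and s: "s \<in> Hom C K (fob D i)" "ident C K = cmp C (\<iota> i) s"
      using presented_factor[OF K C col ident_Hom[OF C obj]] by blast
    have "fob D i \<in> G" using DG i by blast
    then show ?thesis
      using s directed_colimit_leg[OF col i] by metis
  qed
  fix K L g u assume K: "presented TYPE('u) lam C K" and L: "presented TYPE('u) lam C L"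
    and g: "g \<in> Hom C K L" and u: "u \<in> Hom C K A" and ex: "\<exists>v\<in>Hom C L B. cmp C f u = cmp C v g"
  obtain v where v: "v \<in> Hom C L B" and fu: "cmp C f u = cmp C v g"
    using ex by blast
  obtain K' s p where K': "K' \<in> G" and s: "s \<in> Hom C K K'" and p: "p \<in> Hom C K' K"
    and ps: "cmp C p s = ident C K"
    using retract[OF K] by blast
  obtain L' s' p' where L': "L' \<in> G" and s': "s' \<in> Hom C L L'" and p': "p' \<in> Hom C L' L"
    and ps': "cmp C p' s' = ident C L"
    using retract[OF L] by blast
  note gp = cmp_Hom[OF C p g]
  note g' = cmp_Hom[OF C gp s'] and u' = cmp_Hom[OF C p u]
  have "cmp C f (cmp C u p) = cmp C (cmp C v g) p"
    unfolding cmp_assoc[OF C p u f] fu ..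
  also have "\<dots> = cmp C v (cmp C g p)"
    unfolding cmp_assoc[OF C p g v] ..
  also have "\<dots> = cmp C v (cmp C (cmp C p' s') (cmp C g p))"
    unfolding ps' cmp_ident_left[OF C gp] ..
  also have "\<dots> = cmp C (cmp C v p') (cmp C s' (cmp C g p))"
    unfolding cmp_assoc[OF C gp s' p', symmetric] cmp_assoc[OF C g' p' v] ..
  finally have "\<exists>w\<in>Hom C L' A. cmp C u p = cmp C w (cmp C s' (cmp C g p))"
    using test[OF K' L' g' u'] cmp_Hom[OF C p' v] by blast
  then obtain w where w: "w \<in> Hom C L' A" and up: "cmp C u p = cmp C w (cmp C s' (cmp C g p))"
    by blast
  have "u = cmp C (cmp C u p) s"
    unfolding cmp_assoc[OF C s p u, symmetric] ps cmp_ident_right[OF C u] ..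
  also have "\<dots> = cmp C (cmp C w s') (cmp C (cmp C g p) s)"
    unfolding up cmp_assoc[OF C gp s' w] cmp_assoc[OF C s gp cmp_Hom[OF C s' w]] ..
  also have "\<dots> = cmp C (cmp C w s') g"
    unfolding cmp_assoc[OF C s p g, symmetric] ps cmp_ident_right[OF C g] ..
  finally show "\<exists>w\<in>Hom C L A. u = cmp C w g"
    using cmp_Hom[OF C s' w] by blast
qed

text \<open>
  For each \<open>g : K \<rightarrow> L\<close> between generators and each \<open>u : K \<rightarrow> A\<close> that does not factor through \<open>g\<close> there is a map \<open>f\<close>
  from \<open>A\<close> into \<open>\<D>\<close> such that \<open>f u\<close> does not factor through \<open>g\<close>. These pairs \<open>(g, u)\<close> form a small set, and the
  product of the maps \<open>f\<close> is pure: a factorization in the product would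
  project to a factorization in each component.
\<close>

lemma definable_contains_inheriting:
  fixes C :: "('o, 'm) cat"
  assumes U: "universe TYPE('u)" and lam: "infinite_regular_cardinal lam"
    and lp: "locally_presentable TYPE('u) lam C"
    and \<D>: "definable_subcategory TYPE('u) lam C \<D>"
    and A: "A \<in> obj C"
    and test: "inherits_factorizations TYPE('u) lam C \<D> A"
  shows "A \<in> \<D>"
proof -
  have C: "category C" and ls: "locally_small TYPE('u) C"
    using lp unfolding locally_presentable_def by blast+
  have \<D>_obj: "\<D> \<subseteq> obj C" and closed_prod: "closed_under_products TYPE('u) C \<D>"
    and closed_pure: "closed_under_pure_subobjects TYPE('u) lam C \<D>"
    using \<D> unfolding definable_subcategory_def by blast+
  obtain G where G: "small TYPE('u) G" "\<forall>A\<in>G. presented TYPE('u) lam C A"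
    and gen: "\<forall>T\<in>obj C. \<exists>(K :: 'u set) r D \<iota>.
       is_directed_colimit TYPE('u) lam C K r D T \<iota> \<and> fob D ` K \<subseteq> G"
    using presentable_generators[OF lp] .
  have G_obj: "G \<subseteq> obj C"
    using G(2) unfolding presented_def by blast
  define W where "W = {(K, L, g, u). K \<in> G \<and> L \<in> G \<and> g \<in> Hom C K L \<and> u \<in> Hom C K A \<and>
    \<not> (\<exists>v\<in>Hom C L A. u = cmp C v g)}"
  have "small TYPE('u) (SIGMA K:G. SIGMA L:G. Hom C K L \<times> Hom C K A)"
    using ls G_obj A unfolding locally_small_def
    by (intro small_Sigma[OF U] G(1)) auto
  moreover have "W \<subseteq> (SIGMA K:G. SIGMA L:G. Hom C K L \<times> Hom C K A)"
    unfolding W_def by auto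
  ultimately have W_small: "small TYPE('u) W"
    by (rule small_subset)
  have "\<exists>B f. B \<in> \<D> \<and> f \<in> Hom C A B \<and> (\<forall>K L g u. t = (K, L, g, u) \<longrightarrow> f \<notin> factoring C L A g u B)"
    if "t \<in> W" for t
  proof -
    obtain K L g u where t: "t = (K, L, g, u)" by (cases t)
    have K: "K \<in> G" and L: "L \<in> G" and g: "g \<in> Hom C K L" and u: "u \<in> Hom C K A"
      and no: "\<not> (\<exists>v\<in>Hom C L A. u = cmp C v g)"
      using that unfolding t W_def by auto
    have "\<not> (\<forall>B\<in>\<D>. Hom C A B \<subseteq> factoring C L A g u B)"
      using factors_if_all_into_definable_factor[OF U lam lp \<D> A test bspec[OF G(2) K] bspec[OF G(2) L] g u] no
      by blast
    then show ?thesis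
      unfolding t by blast
  qed
  then obtain B f where B: "\<And>t. t \<in> W \<Longrightarrow> B t \<in> \<D>" and f: "\<And>t. t \<in> W \<Longrightarrow> f t \<in> Hom C A (B t)"
    and bad: "\<And>t K L g u. t \<in> W \<Longrightarrow> t = (K, L, g, u) \<Longrightarrow> f t \<notin> factoring C L A g u (B t)"
    by metis
  have B_obj: "\<forall>t\<in>W. B t \<in> obj C"
    using B \<D>_obj by blast
  obtain P \<pi> where P: "is_product C W B P \<pi>"
    using presentable_product_exists[OF U lp W_small B_obj] .
  note \<pi> = product_proj[OF P]
  have P\<D>: "P \<in> \<D>"
    by (rule closed_under_products_small[OF closed_prod W_small B P])
  obtain k where k: "k \<in> Hom C A P" "\<And>t. t \<in> W \<Longrightarrow> cmp C (\<pi> t) k = f t"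
    using product_pair[of C W B P \<pi> A f, OF P A f] by metis
  have "pure TYPE('u) lam C A P k"
  proof (rule pure_if_pure_for_generators[OF C k(1) G(2) gen])
    fix K L g u assume K: "K \<in> G" and L: "L \<in> G" and g: "g \<in> Hom C K L" and u: "u \<in> Hom C K A"
      and ex: "\<exists>v\<in>Hom C L P. cmp C k u = cmp C v g"
    show "\<exists>w\<in>Hom C L A. u = cmp C w g"
    proof (rule ccontr)
      assume no: "\<not> ?thesis"
      let ?t = "(K, L, g, u)"
      have t: "?t \<in> W"
        unfolding W_def using K L g u no by blast
      obtain v where v: "v \<in> Hom C L P" "cmp C k u = cmp C v g"
        using ex by blast
      have "cmp C (f ?t) u = cmp C (cmp C (\<pi> ?t) v) g"
        unfolding k(2)[OF t, symmetric] cmp_assoc[OF C u k(1) \<pi>[OF t], symmetric] v(2)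
          cmp_assoc[OF C g v(1) \<pi>[OF t]] ..
      then have "f ?t \<in> factoring C L A g u (B ?t)"
        unfolding factoring_def using f[OF t] cmp_Hom[OF C v(1) \<pi>[OF t]] by blast
      then show False
        using bad[OF t refl] by blast
    qed
  qed
  then show ?thesis
    using closed_pure A P\<D> unfolding closed_under_pure_subobjects_def by blast
qed

theorem corollary2p8:
  fixes lam :: "'l rel" and C :: "('o, 'm) cat" and \<D> :: "'o set"
  assumes "universe TYPE('u)"
    and "infinite_regular_cardinal lam"
    and "lam <o |UNIV :: 'u set|"
    and "locally_presentable TYPE('u) lam C"
    and "additive C"
    and "\<D> \<subseteq> obj C"
  shows "definable_subcategory TYPE('u) lam C \<D> \<longleftrightarrow>
    (\<exists>\<F> \<subseteq> obj (fun_cat lam C :: (('o, 'm, 'u) ab_functor, _) cat).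
       \<D> = {X \<in> obj C. \<forall>F \<in> \<F>. trivial_group (fob F X)})"
proof
  note lp = assms(4)
  have C: "category C" and ls: "locally_small TYPE('u) C"
    using lp unfolding locally_presentable_def by blast+
  obtain \<Gamma> where \<Gamma>: "preadditive_structure C \<Gamma>"
    using assms(5) unfolding additive_def by blast
  have fun_cat: "obj (fun_cat lam C :: (('o, 'm, 'u) ab_functor, _) cat) = fun_obj lam C"
    by (simp add: fun_cat_def)
  {
    assume \<D>: "definable_subcategory TYPE('u) lam C \<D>"
    define \<F> where "\<F> = {F \<in> fun_obj lam C. \<forall>X\<in>\<D>. trivial_group (fob (F :: ('o, 'm, 'u) ab_functor) X)}"
    have "A \<in> \<D>" if A: "A \<in> obj C" and zero: "\<forall>F\<in>\<F>. trivial_group (fob F A)" for A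
    proof (rule definable_contains_inheriting[OF assms(1,2) lp \<D> A], unfold inherits_factorizations_def,
        intro allI impI)
      fix K L M g u
      assume pres: "presented TYPE('u) lam C K" "presented TYPE('u) lam C L" "presented TYPE('u) lam C M"
        and g: "g \<in> Hom C K L" and u: "u \<in> Hom C K M"
        and all: "\<forall>B\<in>\<D>. Hom C M B \<subseteq> factoring C L M g u B"
      obtain F :: "('o, 'm, 'u) ab_functor" where F: "F \<in> fun_obj lam C"
        and triv: "\<forall>X\<in>obj C. trivial_group (fob F X) \<longleftrightarrow> Hom C M X \<subseteq> factoring C L M g u X"
        using factoring_functor_exists[OF assms(2) C ls \<Gamma> pres g u] .
      have "F \<in> \<F>"
        unfolding \<F>_def using F triv all assms(6) by blast
      then show "Hom C M A \<subseteq> factoring C L M g u A"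
        using zero triv A by blast
    qed
    then have "\<D> = {X \<in> obj C. \<forall>F\<in>\<F>. trivial_group (fob F X)}"
      using assms(6) unfolding \<F>_def by blast
    moreover have "\<F> \<subseteq> fun_obj lam C"
      unfolding \<F>_def by blast
    ultimately show "\<exists>\<F> \<subseteq> obj (fun_cat lam C :: (('o, 'm, 'u) ab_functor, _) cat).
        \<D> = {X \<in> obj C. \<forall>F \<in> \<F>. trivial_group (fob F X)}"
      unfolding fun_cat by blast
  next
    assume "\<exists>\<F> \<subseteq> obj (fun_cat lam C :: (('o, 'm, 'u) ab_functor, _) cat).
        \<D> = {X \<in> obj C. \<forall>F \<in> \<F>. trivial_group (fob F X)}"
    then obtain \<F> :: "('o, 'm, 'u) ab_functor set" where "\<F> \<subseteq> fun_obj lam C"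
      and "\<D> = {X \<in> obj C. \<forall>F \<in> \<F>. trivial_group (fob F X)}"
      unfolding fun_cat by blast
    then show "definable_subcategory TYPE('u) lam C \<D>"
      using annihilated_definable[OF assms(1,2) lp] by simp
  }
qed

end
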